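(* Let $G$ be a connected affine algebraic group over $\mathbb{C}$, let $H\subset G$ be a closed subgroup, and let $\mathcal{X}:G/H\to\mathbb{C}$ be a non-constant nowhere vanishing regular function with $\mathcal{X}(eH)=1$, regarded as a morphism $G/H\to\mathbb{C}^*$. Let $S$ be the kernel of the associated character $\mathcal{X}':G\to\mathbb{C}^*$ (so $H\subset S$). If $S$ is connected, then the fibration $$S/H\to G/H\xrightarrow{\mathcal{X}}\mathbb{C}^*$$ is (rationally) cohomologically trivial.
   Context: All algebraic groups and varieties are over $\mathbb{C}$, with their classical (complex analytic) topology. The associated character of $\mathcal{X}$ is the composite $\mathcal{X}'=\mathcal{X}\circ\pi:G\to\mathbb{C}^*$, with $\pi:G\to G/H$ the quotient map; it is a morphism of varieties to $\mathbb{C}^*$ sending the identity to $1$ and is therefore a homomorphism of algebraic groups (Rosenlicht). The fibre of $\mathcal{X}$ over $1$ is $S/H$. A fibration $F\hookrightarrow E\to B$ is called (rationally) cohomologically trivial if for each $k$ there is an isomorphism of $\mathbb{Q}$-vector spaces $H^k(E;\mathbb{Q})\cong\bigoplus_{p+q=k}H^p(F;\mathbb{Q})\otimes H^q(B;\mathbb{Q})$, where $H^*(-;\mathbb{Q})$ is singular cohomology. *)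

theory Defs
  imports
    "HOL-Analysis.Analysis"
    "HOL-Algebra.Module"
    "HOL-Algebra.Left_Coset"
    "HOL-Algebra.AbelCoset"
    "HOL-Homology.Homology"
begin

section \<open>Rational vector spaces\<close>

text \<open>
  Rational vector spaces are HOL-Algebra modules over the field below.  The record type
  \<^type>\<open>module\<close> extends rings, so it has fields for a multiplication and a unit; these play no role
  for modules and are left \<^const>\<open>undefined\<close>.
\<close>

definition rat_field :: "rat ring" where
  "rat_field = \<lparr>carrier = UNIV, mult = (*), one = 1, zero = 0, add = (+)\<rparr>"

definition pointwise_module :: "('a \<Rightarrow> rat) set \<Rightarrow> (rat, 'a \<Rightarrow> rat) module" where
  "pointwise_module C =
     \<lparr>carrier = C, mult = undefined, one = undefined, zero = (\<lambda>x. 0),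
      add = (\<lambda>f g x. f x + g x), smult = (\<lambda>c f x. c * f x)\<rparr>"

definition free_module :: "'a set \<Rightarrow> (rat, 'a \<Rightarrow> rat) module" where
  "free_module A = pointwise_module {f. finite {x. f x \<noteq> 0} \<and> {x. f x \<noteq> 0} \<subseteq> A}"

text \<open>
  The scalar multiplication adds the submodule back in, because for the scalar 0 the set of
  multiples of the members of a coset is a singleton and not a coset.
\<close>

definition quotient_module ::
    "('r, 'a, 'x) module_scheme \<Rightarrow> 'a set \<Rightarrow> ('r, 'a set) module" where
  "quotient_module M N =
     \<lparr>carrier = a_rcosets\<^bsub>M\<^esub> N, mult = undefined, one = undefined, zero = N,
      add = (\<lambda>A B. A <+>\<^bsub>M\<^esub> B), smult = (\<lambda>c A. \<Union>a\<in>A. N +>\<^bsub>M\<^esub> (c \<odot>\<^bsub>M\<^esub> a))\<rparr>"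

definition submodule_span ::
    "('r, 's) ring_scheme \<Rightarrow> ('r, 'a, 'x) module_scheme \<Rightarrow> 'a set \<Rightarrow> 'a set" where
  "submodule_span R M A = \<Inter>{N. submodule N R M \<and> A \<subseteq> N}"

definition basis_vec :: "'a \<Rightarrow> 'a \<Rightarrow> rat" where
  "basis_vec a = (\<lambda>x. if x = a then 1 else 0)"

definition bilinear_relations ::
    "(rat, 'a) module \<Rightarrow> (rat, 'b) module \<Rightarrow> ('a \<times> 'b \<Rightarrow> rat) set" where
  "bilinear_relations V W =
     {(\<lambda>x. basis_vec (v \<oplus>\<^bsub>V\<^esub> v', w) x - basis_vec (v, w) x - basis_vec (v', w) x) | v v' w.
        v \<in> carrier V \<and> v' \<in> carrier V \<and> w \<in> carrier W} \<union>
     {(\<lambda>x. basis_vec (v, w \<oplus>\<^bsub>W\<^esub> w') x - basis_vec (v, w) x - basis_vec (v, w') x) | v w w'.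
        v \<in> carrier V \<and> w \<in> carrier W \<and> w' \<in> carrier W} \<union>
     {(\<lambda>x. basis_vec (c \<odot>\<^bsub>V\<^esub> v, w) x - c * basis_vec (v, w) x) | c v w.
        v \<in> carrier V \<and> w \<in> carrier W} \<union>
     {(\<lambda>x. basis_vec (v, c \<odot>\<^bsub>W\<^esub> w) x - c * basis_vec (v, w) x) | c v w.
        v \<in> carrier V \<and> w \<in> carrier W}"

definition tensor_module ::
    "(rat, 'a) module \<Rightarrow> (rat, 'b) module \<Rightarrow> (rat, ('a \<times> 'b \<Rightarrow> rat) set) module" where
  "tensor_module V W =
     (let F = free_module (carrier V \<times> carrier W)
      in quotient_module F (submodule_span rat_field F (bilinear_relations V W)))"

text \<open>
  The direct product of a family; used for finite index sets only, where it is the direct sum.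
\<close>

definition finite_direct_sum ::
    "'i set \<Rightarrow> ('i \<Rightarrow> ('r, 'a) module) \<Rightarrow> ('r, 'i \<Rightarrow> 'a) module" where
  "finite_direct_sum I M =
     \<lparr>carrier = (\<Pi>\<^sub>E i\<in>I. carrier (M i)), mult = undefined, one = undefined,
      zero = (\<lambda>i\<in>I. \<zero>\<^bsub>M i\<^esub>), add = (\<lambda>f g. \<lambda>i\<in>I. f i \<oplus>\<^bsub>M i\<^esub> g i),
      smult = (\<lambda>c f. \<lambda>i\<in>I. c \<odot>\<^bsub>M i\<^esub> f i)\<rparr>"

definition module_isomorphic ::
    "('r, 's) ring_scheme \<Rightarrow> ('r, 'a) module \<Rightarrow> ('r, 'b) module \<Rightarrow> bool" where
  "module_isomorphic R M N \<longleftrightarrow>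
     (\<exists>h. bij_betw h (carrier M) (carrier N) \<and>
          (\<forall>x\<in>carrier M. \<forall>y\<in>carrier M. h (x \<oplus>\<^bsub>M\<^esub> y) = h x \<oplus>\<^bsub>N\<^esub> h y) \<and>
          (\<forall>c\<in>carrier R. \<forall>x\<in>carrier M. h (c \<odot>\<^bsub>M\<^esub> x) = c \<odot>\<^bsub>N\<^esub> h x))"


section \<open>Singular cohomology with rational coefficients\<close>

text \<open>
  A homomorphism from the singular chain group to the rationals is given by its values on the
  singular simplices; as a function on all of the ambient type it is extended by 0.
\<close>

definition singular_cochains :: "nat \<Rightarrow> 'a topology \<Rightarrow> (((nat \<Rightarrow> real) \<Rightarrow> 'a) \<Rightarrow> rat) set" where
  "singular_cochains p X = {\<phi>. \<forall>s. \<phi> s \<noteq> 0 \<longrightarrow> singular_simplex p X s}"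

definition cochain_eval :: "(((nat \<Rightarrow> real) \<Rightarrow> 'a) \<Rightarrow> rat) \<Rightarrow> 'a chain \<Rightarrow> rat" where
  "cochain_eval \<phi> c = (\<Sum>s\<in>Poly_Mapping.keys c. of_int (Poly_Mapping.lookup c s) * \<phi> s)"

definition coboundary ::
    "nat \<Rightarrow> 'a topology \<Rightarrow> (((nat \<Rightarrow> real) \<Rightarrow> 'a) \<Rightarrow> rat) \<Rightarrow> ((nat \<Rightarrow> real) \<Rightarrow> 'a) \<Rightarrow> rat" where
  "coboundary p X \<phi> =
     (\<lambda>s. if singular_simplex (Suc p) X s
          then cochain_eval \<phi> (chain_boundary (Suc p) (frag_of s)) else 0)"

definition singular_cocycles :: "nat \<Rightarrow> 'a topology \<Rightarrow> (((nat \<Rightarrow> real) \<Rightarrow> 'a) \<Rightarrow> rat) set" where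
  "singular_cocycles p X = {\<phi> \<in> singular_cochains p X. coboundary p X \<phi> = (\<lambda>s. 0)}"

definition singular_coboundaries :: "nat \<Rightarrow> 'a topology \<Rightarrow> (((nat \<Rightarrow> real) \<Rightarrow> 'a) \<Rightarrow> rat) set" where
  "singular_coboundaries p X =
     (case p of 0 \<Rightarrow> {\<lambda>s. 0} | Suc q \<Rightarrow> coboundary q X ` singular_cochains q X)"

definition rat_cohomology ::
    "nat \<Rightarrow> 'a topology \<Rightarrow> (rat, (((nat \<Rightarrow> real) \<Rightarrow> 'a) \<Rightarrow> rat) set) module" where
  "rat_cohomology p X =
     quotient_module (pointwise_module (singular_cocycles p X)) (singular_coboundaries p X)"

text \<open>
  Cohomological triviality of a fibration with fibre \<open>F\<close>, total space \<open>E\<close> and base \<open>B\<close>: an abstract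
  isomorphism of rational vector spaces in each degree.  The condition involves the maps of the
  fibration only through the three spaces.
\<close>

definition cohomologically_trivial :: "'f topology \<Rightarrow> 'e topology \<Rightarrow> 'b topology \<Rightarrow> bool" where
  "cohomologically_trivial F E B \<longleftrightarrow>
     (\<forall>k. module_isomorphic rat_field
            (rat_cohomology k E)
            (finite_direct_sum {(p, q). p + q = k}
               (\<lambda>(p, q). tensor_module (rat_cohomology p F) (rat_cohomology q B))))"


section \<open>Affine algebraic groups\<close>

inductive_set polynomial_functions :: "('a \<Rightarrow> complex) set \<Rightarrow> ('a \<Rightarrow> complex) set"
  for coords :: "('a \<Rightarrow> complex) set" where
  const: "(\<lambda>x. c) \<in> polynomial_functions coords"
| coord: "f \<in> coords \<Longrightarrow> f \<in> polynomial_functions coords"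
| add: "f \<in> polynomial_functions coords \<Longrightarrow> g \<in> polynomial_functions coords \<Longrightarrow>
        (\<lambda>x. f x + g x) \<in> polynomial_functions coords"
| mult: "f \<in> polynomial_functions coords \<Longrightarrow> g \<in> polynomial_functions coords \<Longrightarrow>
        (\<lambda>x. f x * g x) \<in> polynomial_functions coords"

definition affine_polynomials :: "(complex ^ 'n \<Rightarrow> complex) set" where
  "affine_polynomials = polynomial_functions (range (\<lambda>i x. x $ i))"

definition affine_polynomials2 :: "((complex ^ 'n) \<times> (complex ^ 'n) \<Rightarrow> complex) set" where
  "affine_polynomials2 =
     polynomial_functions (range (\<lambda>i z. fst z $ i) \<union> range (\<lambda>i z. snd z $ i))"

definition zariski_closed :: "(complex ^ 'n) set \<Rightarrow> bool" where
  "zariski_closed V \<longleftrightarrow> (\<exists>P \<subseteq> affine_polynomials. V = {x. \<forall>p\<in>P. p x = 0})"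

text \<open>
  A closed subvariety of an affine space with a group structure whose multiplication and inversion
  are morphisms, i.e. restrictions of polynomial maps.
\<close>

definition affine_algebraic_group :: "(complex ^ 'n) monoid \<Rightarrow> bool" where
  "affine_algebraic_group G \<longleftrightarrow>
     group G \<and> zariski_closed (carrier G) \<and>
     (\<forall>i. \<exists>p\<in>affine_polynomials2. \<forall>x\<in>carrier G. \<forall>y\<in>carrier G. (x \<otimes>\<^bsub>G\<^esub> y) $ i = p (x, y)) \<and>
     (\<forall>i. \<exists>p\<in>affine_polynomials. \<forall>x\<in>carrier G. (inv\<^bsub>G\<^esub> x) $ i = p x)"

definition closed_algebraic_subgroup :: "(complex ^ 'n) set \<Rightarrow> (complex ^ 'n) monoid \<Rightarrow> bool" where
  "closed_algebraic_subgroup H G \<longleftrightarrow> subgroup H G \<and> zariski_closed H"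

definition regular_on :: "(complex ^ 'n) set \<Rightarrow> (complex ^ 'n \<Rightarrow> complex) \<Rightarrow> bool" where
  "regular_on V f \<longleftrightarrow> (\<exists>p\<in>affine_polynomials. \<forall>x\<in>V. f x = p x)"

definition coset_proj :: "('a, 'm) monoid_scheme \<Rightarrow> 'a set \<Rightarrow> 'a \<Rightarrow> 'a set" where
  "coset_proj G H = (\<lambda>g. g <#\<^bsub>G\<^esub> H)"

text \<open>
  The structure sheaf of the quotient variety consists by definition of the functions whose
  pullback along the projection is regular on the group.
\<close>

definition regular_on_quotient ::
    "(complex ^ 'n) monoid \<Rightarrow> (complex ^ 'n) set \<Rightarrow> ((complex ^ 'n) set \<Rightarrow> complex) \<Rightarrow> bool" where
  "regular_on_quotient G H X \<longleftrightarrow> regular_on (carrier G) (X \<circ> coset_proj G H)"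

definition quotient_topology :: "'a topology \<Rightarrow> ('a \<Rightarrow> 'b) \<Rightarrow> 'b topology" where
  "quotient_topology X f =
     topology (\<lambda>U. U \<subseteq> f ` topspace X \<and> openin X {x \<in> topspace X. f x \<in> U})"

text \<open>
  The space of left cosets with its classical topology: the projection is a quotient map for the
  classical topologies.
\<close>

definition coset_space :: "('a::topological_space, 'm) monoid_scheme \<Rightarrow> 'a set \<Rightarrow> 'a set topology" where
  "coset_space G H = quotient_topology (top_of_set (carrier G)) (coset_proj G H)"

definition Cstar :: "complex monoid" where
  "Cstar = \<lparr>carrier = - {0}, mult = (*), one = 1\<rparr>"


section \<open>Well-definedness\<close>

lemma openin_quotient_topology:
  "openin (quotient_topology X f) U \<longleftrightarrow>
     U \<subseteq> f ` topspace X \<and> openin X {x \<in> topspace X. f x \<in> U}"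
proof -
  have eq1: "{x \<in> topspace X. f x \<in> S \<inter> T} =
      {x \<in> topspace X. f x \<in> S} \<inter> {x \<in> topspace X. f x \<in> T}" for S T
    by auto
  have eq2: "{x \<in> topspace X. f x \<in> \<Union>K} = (\<Union>S\<in>K. {x \<in> topspace X. f x \<in> S})" for K
    by auto
  have "istopology (\<lambda>U. U \<subseteq> f ` topspace X \<and> openin X {x \<in> topspace X. f x \<in> U})"
    unfolding istopology_def eq1 eq2 by (auto intro!: openin_Int openin_Union)
  then show ?thesis
    by (simp add: quotient_topology_def)
qed

lemma quotient_map_quotient_topology: "quotient_map X (quotient_topology X f) f"
proof -
  have "{x \<in> topspace X. f x \<in> f ` topspace X} = topspace X"
    by auto
  then have "openin (quotient_topology X f) (f ` topspace X)"
    by (simp add: openin_quotient_topology)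
  then have top: "topspace (quotient_topology X f) = f ` topspace X"
    by (meson openin_quotient_topology openin_subset openin_topspace subset_antisym)
  show ?thesis
    unfolding quotient_map_def top by (auto simp: openin_quotient_topology)
qed

lemma topspace_coset_space: "topspace (coset_space G H) = lcosets\<^bsub>G\<^esub> H"
  using quotient_imp_surjective_map[OF quotient_map_quotient_topology
      [where X = "top_of_set (carrier G)" and f = "coset_proj G H"]]
  by (auto simp: coset_space_def coset_proj_def LCOSETS_def)

lemma cring_rat_field: "cring rat_field"
proof -
  have "\<exists>y. x + y = 0" for x :: rat
    by (rule exI[of _ "- x"]) simp
  then show ?thesis
    by (intro cringI abelian_groupI comm_monoidI)
       (auto simp: rat_field_def algebra_simps add_eq_0_iff)
qed

lemma module_pointwise:
  assumes C: "(\<lambda>x. 0) \<in> C" "\<And>f g. f \<in> C \<Longrightarrow> g \<in> C \<Longrightarrow> (\<lambda>x. f x + g x) \<in> C"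
    "\<And>c f. f \<in> C \<Longrightarrow> (\<lambda>x. c * f x) \<in> C"
  shows "module rat_field (pointwise_module C)"
proof (rule moduleI)
  have inv: "\<exists>g\<in>C. (\<lambda>x. f x + g x) = (\<lambda>x. 0)" if "f \<in> C" for f
    by (rule bexI[OF _ C(3)[OF that, of "-1"]]) simp
  show "abelian_group (pointwise_module C)"
    by (rule abelian_groupI) (simp_all add: pointwise_module_def C inv ac_simps)
qed (simp_all add: cring_rat_field, simp_all add: rat_field_def pointwise_module_def C ring_distribs mult.assoc)

lemma module_free: "module rat_field (free_module A)"
  unfolding free_module_def
proof (rule module_pointwise, goal_cases)
  case (2 f g)
  then have "finite ({x. f x \<noteq> 0} \<union> {x. g x \<noteq> 0})"
    by simp
  then have "finite {x. f x + g x \<noteq> 0}"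
    by (rule rev_finite_subset) auto
  moreover have "f x = 0 \<and> g x = 0" if "x \<notin> A" for x
    using 2 that by blast
  then have "{x. f x + g x \<noteq> 0} \<subseteq> A"
    by force
  ultimately show ?case
    by simp
qed auto

lemma module_quotient:
  assumes M: "module R M" and N: "submodule N R M"
  shows "module R (quotient_module M N)"
proof -
  interpret M: module R M by (rule M)
  interpret N: submodule N R M by (rule N)
  interpret abelian_subgroup N M
    by (rule abelian_subgroupI3) (auto intro: additive_subgroup.intro N.subgroup_axioms M.abelian_group_axioms)
  have smult: "c \<odot>\<^bsub>quotient_module M N\<^esub> (N +>\<^bsub>M\<^esub> x) = N +>\<^bsub>M\<^esub> (c \<odot>\<^bsub>M\<^esub> x)"
    if c: "c \<in> carrier R" and x: "x \<in> carrier M" for c x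
  proof -
    have "N +>\<^bsub>M\<^esub> (c \<odot>\<^bsub>M\<^esub> a) = N +>\<^bsub>M\<^esub> (c \<odot>\<^bsub>M\<^esub> x)" if a: "a \<in> N +>\<^bsub>M\<^esub> x" for a
    proof -
      obtain n where n: "n \<in> N" "a = n \<oplus>\<^bsub>M\<^esub> x"
        using a by (auto simp: a_r_coset_def')
      then have "c \<odot>\<^bsub>M\<^esub> a = c \<odot>\<^bsub>M\<^esub> n \<oplus>\<^bsub>M\<^esub> c \<odot>\<^bsub>M\<^esub> x"
        using c x a_Hcarr by (simp add: M.smult_r_distr)
      then have "c \<odot>\<^bsub>M\<^esub> a \<in> N +>\<^bsub>M\<^esub> (c \<odot>\<^bsub>M\<^esub> x)"
        using n c by (auto simp: a_r_coset_def')
      then show ?thesis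
        using a_repr_independence' c x M.smult_closed by metis
    qed
    then have "(\<Union>a\<in>N +>\<^bsub>M\<^esub> x. N +>\<^bsub>M\<^esub> (c \<odot>\<^bsub>M\<^esub> a)) = (\<Union>a\<in>N +>\<^bsub>M\<^esub> x. N +>\<^bsub>M\<^esub> (c \<odot>\<^bsub>M\<^esub> x))"
      by (intro SUP_cong refl)
    also have "\<dots> = N +>\<^bsub>M\<^esub> (c \<odot>\<^bsub>M\<^esub> x)"
      using a_rcos_self[OF x] by (intro SUP_eq_const) auto
    finally show ?thesis
      by (simp add: quotient_module_def)
  qed
  have carrier: "carrier (quotient_module M N) = {N +>\<^bsub>M\<^esub> x | x. x \<in> carrier M}"
    by (auto simp: quotient_module_def A_RCOSETS_def')
  have add: "(N +>\<^bsub>M\<^esub> x) \<oplus>\<^bsub>quotient_module M N\<^esub> (N +>\<^bsub>M\<^esub> y) = N +>\<^bsub>M\<^esub> (x \<oplus>\<^bsub>M\<^esub> y)"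
    if "x \<in> carrier M" "y \<in> carrier M" for x y
    using that by (simp add: quotient_module_def a_rcos_sum)
  have zero: "\<zero>\<^bsub>quotient_module M N\<^esub> = N +>\<^bsub>M\<^esub> \<zero>\<^bsub>M\<^esub>"
    using a_rcos_const[OF zero_closed] by (simp add: quotient_module_def)
  show ?thesis
  proof (rule moduleI)
    show "abelian_group (quotient_module M N)"
    proof (rule abelian_groupI, goal_cases)
      case (6 A)
      then obtain x where x: "x \<in> carrier M" "A = N +>\<^bsub>M\<^esub> x"
        by (auto simp: carrier)
      then show ?case
        by (intro bexI[of _ "N +>\<^bsub>M\<^esub> (\<ominus>\<^bsub>M\<^esub> x)"]) (auto simp: add zero carrier M.l_neg)
    qed (auto simp: carrier add zero M.a_ac)
  qed (auto simp: carrier add smult M.smult_l_distr M.smult_r_distr M.smult_assoc1 M.is_cring)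
qed

lemma submodule_submodule_span:
  assumes M: "module R M" and A: "A \<subseteq> carrier M"
  shows "submodule (submodule_span R M A) R M"
proof -
  interpret M: module R M by (rule M)
  note E = M.submoduleE
  show ?thesis
    unfolding submodule_span_def
  proof (rule M.submoduleI, goal_cases)
    case 1
    show ?case using A M.carrier_is_submodule by blast
  next
    case 2
    show ?case by (auto simp: submodule_def dest: subgroup.one_closed)
  next
    case (3 a)
    then show ?case using E(3) by blast
  next
    case (4 a b)
    then show ?case using E(5) by blast
  next
    case (5 a x)
    then show ?case using E(4) by blast
  qed
qed

lemma module_tensor:
  assumes "module rat_field V" "module rat_field W"
  shows "module rat_field (tensor_module V W)"
proof -
  interpret V: module rat_field V by fact
  interpret W: module rat_field W by fact
  have c: "c \<in> carrier rat_field" for c by (simp add: rat_field_def)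
  have fin: "f \<in> carrier (free_module A)"
    if "{x. f x \<noteq> 0} \<subseteq> B" "finite B" "B \<subseteq> A" for f and A B :: "('a \<times> 'b) set"
    using that finite_subset[of "{x. f x \<noteq> 0}" B]
    by (auto simp: free_module_def pointwise_module_def)
  have "bilinear_relations V W \<subseteq> carrier (free_module (carrier V \<times> carrier W))"
    unfolding bilinear_relations_def
  proof (safe, goal_cases)
    case (1 _ v v' w)
    then show ?case
      by (intro fin[where B = "{(v \<oplus>\<^bsub>V\<^esub> v', w), (v, w), (v', w)}"]) (auto simp: basis_vec_def)
  next
    case (2 _ v w w')
    then show ?case
      by (intro fin[where B = "{(v, w \<oplus>\<^bsub>W\<^esub> w'), (v, w), (v, w')}"]) (auto simp: basis_vec_def)
  next
    case (3 _ k v w)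
    then show ?case
      by (intro fin[where B = "{(k \<odot>\<^bsub>V\<^esub> v, w), (v, w)}"]) (auto simp: basis_vec_def c)
  next
    case (4 _ k v w)
    then show ?case
      by (intro fin[where B = "{(v, k \<odot>\<^bsub>W\<^esub> w), (v, w)}"]) (auto simp: basis_vec_def c)
  qed
  then show ?thesis
    unfolding tensor_module_def Let_def
    by (intro module_quotient submodule_submodule_span module_free)
qed

lemma cochain_eval_superset:
  assumes "finite K" "Poly_Mapping.keys c \<subseteq> K"
  shows "cochain_eval \<phi> c = (\<Sum>s\<in>K. of_int (Poly_Mapping.lookup c s) * \<phi> s)"
  unfolding cochain_eval_def using assms
  by (intro sum.mono_neutral_left) (auto simp: in_keys_iff)

lemma cochain_eval_0: "cochain_eval \<phi> 0 = 0"
  by (simp add: cochain_eval_def)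

lemma cochain_eval_frag_of: "cochain_eval \<phi> (frag_of s) = \<phi> s"
  by (simp add: cochain_eval_def)

lemma cochain_eval_diff: "cochain_eval \<phi> (a - b) = cochain_eval \<phi> a - cochain_eval \<phi> b"
proof -
  define K where "K = Poly_Mapping.keys a \<union> Poly_Mapping.keys b"
  have "cochain_eval \<phi> c = (\<Sum>s\<in>K. of_int (Poly_Mapping.lookup c s) * \<phi> s)"
    if "c \<in> {a, b, a - b}" for c
    using that keys_diff[of a b] by (intro cochain_eval_superset) (auto simp: K_def)
  then show ?thesis
    by (simp add: lookup_minus left_diff_distrib sum_subtractf)
qed

lemma cochain_eval_chain_boundary:
  "cochain_eval \<phi> (chain_boundary p c) =
     cochain_eval (\<lambda>s. cochain_eval \<phi> (chain_boundary p (frag_of s))) c"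
proof (rule frag_induction[of c UNIV], goal_cases)
  case 1
  show ?case by simp
next
  case 2
  show ?case by (simp add: cochain_eval_0)
next
  case (3 s)
  show ?case by (simp add: cochain_eval_frag_of)
next
  case (4 a b)
  then show ?case by (simp add: chain_boundary_diff cochain_eval_diff)
qed

lemma coboundary_coboundary: "coboundary (Suc p) X (coboundary p X \<phi>) = (\<lambda>s. 0)"
proof (rule ext)
  fix s
  show "coboundary (Suc p) X (coboundary p X \<phi>) s = 0"
  proof (cases "singular_simplex (Suc (Suc p)) X s")
    case True
    define c where "c = chain_boundary (Suc (Suc p)) (frag_of s)"
    have s: "singular_chain (Suc (Suc p)) X (frag_of s)"
      using True by (simp add: singular_chain_of)
    have keys: "singular_simplex (Suc p) X t" if "t \<in> Poly_Mapping.keys c" for t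
      using singular_chain_boundary[OF s] that by (auto simp: c_def singular_chain_def)
    have "coboundary (Suc p) X (coboundary p X \<phi>) s = cochain_eval (coboundary p X \<phi>) c"
      using True by (simp add: coboundary_def c_def)
    also have "\<dots> = cochain_eval (\<lambda>t. cochain_eval \<phi> (chain_boundary (Suc p) (frag_of t))) c"
      unfolding cochain_eval_def[of _ c] by (intro sum.cong refl) (simp add: coboundary_def keys)
    also have "\<dots> = cochain_eval \<phi> (chain_boundary (Suc p) c)"
      by (rule cochain_eval_chain_boundary[symmetric])
    also have "chain_boundary (Suc p) c = 0"
      using chain_boundary_boundary_alt[OF s] by (simp add: c_def)
    finally show ?thesis
      by (simp add: cochain_eval_0)
  qed (simp add: coboundary_def)
qed

lemma coboundary_add:
  "coboundary p X (\<lambda>s. f s + g s) = (\<lambda>s. coboundary p X f s + coboundary p X g s)"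
  by (rule ext) (simp add: coboundary_def cochain_eval_def distrib_left sum.distrib)

lemma coboundary_scale: "coboundary p X (\<lambda>s. c * f s) = (\<lambda>s. c * coboundary p X f s)"
  by (rule ext) (simp add: coboundary_def cochain_eval_def sum_distrib_left mult.left_commute)

lemma coboundary_zero: "coboundary p X (\<lambda>s. 0) = (\<lambda>s. 0)"
  by (rule ext) (simp add: coboundary_def cochain_eval_def)

lemma singular_cochains_closed:
  "(\<lambda>s. 0) \<in> singular_cochains p X"
  "f \<in> singular_cochains p X \<Longrightarrow> g \<in> singular_cochains p X \<Longrightarrow> (\<lambda>s. f s + g s) \<in> singular_cochains p X"
  "f \<in> singular_cochains p X \<Longrightarrow> (\<lambda>s. c * f s) \<in> singular_cochains p X"
  by (force simp: singular_cochains_def)+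

lemma module_cocycles: "module rat_field (pointwise_module (singular_cocycles p X))"
  by (rule module_pointwise)
     (simp_all add: singular_cocycles_def singular_cochains_closed coboundary_add coboundary_scale
       coboundary_zero)

lemma module_coboundaries: "module rat_field (pointwise_module (singular_coboundaries p X))"
proof (cases p)
  case 0
  then show ?thesis
    by (intro module_pointwise) (simp_all add: singular_coboundaries_def)
next
  case (Suc q)
  show ?thesis
  proof (rule module_pointwise, goal_cases)
    case 1
    show ?case
      unfolding Suc singular_coboundaries_def nat.case
      by (rule image_eqI[where x = "\<lambda>s. 0"]) (simp_all add: coboundary_zero singular_cochains_closed)
  next
    case (2 f g)
    then show ?case
      unfolding Suc singular_coboundaries_def nat.case
      by (auto simp flip: coboundary_add intro!: imageI singular_cochains_closed)
  next
    case (3 c f)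
    then show ?case
      unfolding Suc singular_coboundaries_def nat.case
      by (auto simp flip: coboundary_scale intro!: imageI singular_cochains_closed)
  qed
qed

lemma module_rat_cohomology: "module rat_field (rat_cohomology p X)"
proof -
  have "coboundary q X f \<in> singular_cochains (Suc q) X" for q f
    by (simp add: singular_cochains_def coboundary_def)
  then have "singular_coboundaries p X \<subseteq> singular_cocycles p X"
    by (cases p) (auto simp: singular_coboundaries_def singular_cocycles_def singular_cochains_closed
        coboundary_zero coboundary_coboundary)
  then have "submodule (singular_coboundaries p X) rat_field (pointwise_module (singular_cocycles p X))"
    using module_coboundaries[of p X]
    by (intro module.module_incl_imp_submodule[OF module_cocycles]) (simp_all add: pointwise_module_def)
  then show ?thesis
    unfolding rat_cohomology_def by (intro module_quotient module_cocycles)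
qed

end

theory Submission
  imports Defs "HOL-Complex_Analysis.Complex_Analysis"
begin

text \<open>
  The function \<open>f = X \<circ> \<pi>\<close> on the group is a character (Rosenlicht), and connectedness of its kernel
  \<open>S\<close> yields a continuous section \<open>\<sigma>\<close> of \<open>f\<close> over the punctured plane. Hence \<open>(A, z) \<mapsto> \<sigma> z A\<close> is a
  homeomorphism from \<open>S/H \<times> \<complex>\<^sup>*\<close> onto \<open>G/H\<close>, and the claim is the Kuenneth formula for a product with
  the punctured plane, proved in integral homology and dualised into the rationals.

  The character property and the section both rest on the fact that every element of a connected
  algebraic group lies on an entire curve of exponential type through the unit: along such a
  curve a regular function without zeros is the exponential of a linear function. The curves are
  products of exponentials of left invariant derivations; these act on finite dimensional spaces of
  regular functions, so that their Taylor coefficients satisfy linear recurrences.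
\<close>

section \<open>Homology of products with the punctured plane\<close>

text \<open>Connectedness of \<open>S\<close> enters only at the circle. A curve \<open>c\<close>
  with \<open>f (c z) = exp z\<close> lifts the circle to a path whose end points differ by an
  element of \<open>S\<close>, and an entire curve inside \<open>S\<close> closes it. For the
  squaring map on the punctured plane, where \<open>S\<close> has two points, no section exists.
  Curves replace one-parameter subgroups because a product of two exponentials need not be an
  exponential, while Rosenlicht's identity compares \<open>f\<close> along \<open>c\<close>, along
  \<open>d\<close> and along their pointwise product. That curves fill the group is shown without a
  manifold structure: difference quotients of polynomials show that tangential coordinates separate
  points near the unit, and Brouwer's theorem shows that products of exponentials attain them. No
  finiteness of the homology of \<open>S/H\<close> is required: it is dualised as it stands because
  the rationals are divisible, and the other tensor factor, the cohomology of the punctured plane,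
  is zero or a line in each degree, so that tensoring with it is harmless for spaces of any
  dimension.\<close>

definition cyl :: "'a topology \<Rightarrow> complex set \<Rightarrow> ('a \<times> complex) topology" where
  "cyl F T = prod_topology F (top_of_set T)"

text \<open>Pairs are written with \<open>UNIV \<times> T'\<close> so that the complements,
  differences and restrictions needed for excision remain products and only the planar factor
  changes.\<close>

lemma subtopology_cyl: "subtopology (cyl F T) (UNIV \<times> T') = cyl F (T \<inter> T')"
  by (simp add: cyl_def prod_topology_subtopology(2) subtopology_subtopology Times_Int_Times
      del: subtopology_topspace)

lemma topspace_cyl: "topspace (cyl F T) = topspace F \<times> T"
  by (simp add: cyl_def)

text \<open>The straight-line homotopy in the planar factor. Segments to a single point suffice,
  which admits the slit plane although it is not convex.\<close>

lemma homotopic_cyl_contraction: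
  assumes "a \<in> T'" "\<And>t. t \<in> T' \<Longrightarrow> closed_segment t a \<subseteq> T'"
  shows "homotopic_with (\<lambda>h. True) (cyl F T') (cyl F T') (\<lambda>(x, t). (x, a)) id"
proof -
  have "homotopic_with_canon (\<lambda>z. True) T' T' (\<lambda>t. a) id"
    using assms by (intro homotopic_with_linear) (auto simp: closed_segment_commute)
  then have "homotopic_with (\<lambda>h. True) (cyl F T') (cyl F T') (\<lambda>z. (id (fst z), a)) (\<lambda>z. (id (fst z), id (snd z)))"
    unfolding cyl_def
    by (rule homotopic_with_prod_topology[where p = "\<lambda>_. True" and q = "\<lambda>_. True", rotated]) auto
  then show ?thesis
    by (simp add: case_prod_unfold id_def)
qed

text \<open>One contraction serves the space and the subspace at once, since both are star-shaped
  about the same point \<open>a\<close>.\<close>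

lemma trivial_relative_homology_cyl:
  assumes "a \<in> T'" "T' \<subseteq> T" "\<And>t. t \<in> T' \<Longrightarrow> closed_segment t a \<subseteq> T'"
    "\<And>t. t \<in> T \<Longrightarrow> closed_segment t a \<subseteq> T"
  shows "trivial_group (relative_homology_group p (cyl F T) (UNIV \<times> T'))"
proof (rule trivial_relative_homology_group_gen)
  have [simp]: "T \<inter> T' = T'" using assms by auto
  show "continuous_map (cyl F T) (subtopology (cyl F T) (UNIV \<times> T')) (\<lambda>(x, t). (x, a))"
    unfolding subtopology_cyl using assms(1)
    by (auto simp: cyl_def continuous_map_pairwise o_def case_prod_unfold continuous_map_fst)
  show "homotopic_with (\<lambda>h. True) (subtopology (cyl F T) (UNIV \<times> T'))
     (subtopology (cyl F T) (UNIV \<times> T')) (\<lambda>(x, t). (x, a)) id"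
    unfolding subtopology_cyl using homotopic_cyl_contraction[of a T' F] assms by simp
  show "homotopic_with (\<lambda>h. True) (cyl F T) (cyl F T) (\<lambda>(x, t). (x, a)) id"
    using homotopic_cyl_contraction[of a T F] assms by auto
qed

lemma homology_cyl_starlike:
  assumes "a \<in> T" "\<And>t. t \<in> T \<Longrightarrow> closed_segment t a \<subseteq> T"
  shows "homology_group p (cyl F T) \<cong> homology_group p F"
proof (rule homotopy_equivalent_space_imp_isomorphic_homology_groups)
  show "cyl F T homotopy_equivalent_space F"
    unfolding homotopy_equivalent_space_def
  proof (intro exI conjI)
    show "continuous_map (cyl F T) F fst" by (simp add: cyl_def continuous_map_fst)
    show "continuous_map F (cyl F T) (\<lambda>x. (x, a))"
      using assms by (simp add: cyl_def continuous_map_pairwise o_def)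
    show "homotopic_with (\<lambda>x. True) (cyl F T) (cyl F T) ((\<lambda>x. (x, a)) \<circ> fst) id"
      using homotopic_cyl_contraction[OF assms, of F] by (simp add: o_def case_prod_unfold)
    show "homotopic_with (\<lambda>x. True) F F (fst \<circ> (\<lambda>x. (x, a))) id"
      by (simp add: o_def id_def)
  qed
qed

text \<open>Products with the whole of \<open>F\<close> preserve open and closed sets, which reduces
  the hypothesis of excision to a question about subsets of the plane.\<close>

lemma cyl_closure_interior:
  assumes "closed K" "open A" "K \<inter> T \<subseteq> A"
  shows "cyl F T closure_of (UNIV \<times> K) \<subseteq> cyl F T interior_of (UNIV \<times> A)"
proof -
  have "closedin (top_of_set T) (K \<inter> T)"
    using closedin_closed_Int[OF assms(1), of T] by (simp add: Int_commute)
  then have "closedin (cyl F T) (topspace F \<times> (K \<inter> T))"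
    unfolding cyl_def by (simp add: closedin_prod_Times_iff)
  then have "closedin (cyl F T) (topspace (cyl F T) \<inter> (UNIV \<times> K))"
    by (simp add: topspace_cyl Times_Int_Times Int_commute)
  then have c: "cyl F T closure_of (UNIV \<times> K) = topspace (cyl F T) \<inter> (UNIV \<times> K)"
    by (metis closure_of_closedin closure_of_restrict)
  have "openin (top_of_set T) (A \<inter> T)"
    using openin_open_Int[OF assms(2), of T] by (simp add: Int_commute)
  then have "openin (cyl F T) (topspace F \<times> (A \<inter> T))"
    unfolding cyl_def by (simp add: openin_prod_Times_iff)
  then have "topspace F \<times> (A \<inter> T) \<subseteq> cyl F T interior_of (UNIV \<times> A)"
    by (intro interior_of_maximal) auto
  then show ?thesis
    unfolding c using assms by (auto simp: topspace_cyl)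
qed

text \<open>Open, star-shaped about \<open>1\<close>, and containing the closed right half plane
  without 0: it contracts to the point \<open>1\<close>, and the right half plane can be excised
  from it.\<close>

definition slit_plane :: "complex set" where
  "slit_plane = - {z. Im z = 0 \<and> Re z \<le> 0}"

text \<open>Split off the retract over \<open>1\<close>, thicken it to the slit plane, and excise the right half plane. What
  remains is the left half plane relative to its two open quadrants, and the exact sequence of the
  triple with one quadrant shifts the degree.\<close>

lemma homology_cyl_punctured_plane:
  "homology_group p (cyl F (-{0})) \<cong> homology_group p F \<times>\<times> homology_group (p - 1) F"
proof -
  define L where "L = {z. Re z < 0}"
  define Lp where "Lp = {z. Re z < 0 \<and> 0 < Im z}"
  define Lm where "Lm = {z. Re z < 0 \<and> Im z < 0}"
  define K where "K = {z. Re z \<ge> 0}"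
  let ?X = "cyl F (-{0})"
  let ?A = slit_plane
  have half: "convex L" unfolding L_def by (rule convex_halfspace_Re_lt)
  have cp: "convex Lp" "convex Lm"
    unfolding Lp_def Lm_def
    by (auto simp: Collect_conj_eq convex_Int convex_halfspace_Re_lt convex_halfspace_Im_lt convex_halfspace_Im_gt)
  have seg: "closed_segment t a \<subseteq> C" if "convex C" "a \<in> C" "t \<in> C" for C and t a :: complex
    using that by (simp add: closed_segment_subset)
  have segA: "closed_segment t 1 \<subseteq> ?A" if "t \<in> ?A" for t
  proof
    fix x assume "x \<in> closed_segment t 1"
    then obtain u where u: "0 \<le> u" "u \<le> 1" and x: "x = (1 - u) *\<^sub>R t + u *\<^sub>R 1"
      by (auto simp: closed_segment_def)
    have im: "Im x = (1 - u) * Im t" and re: "Re x = (1 - u) * Re t + u" by (auto simp: x)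
    show "x \<in> ?A"
    proof (cases "Im t = 0")
      case True
      then have "Re t > 0" using that by (auto simp: slit_plane_def)
      then have "Re x > 0" using u unfolding re
        by (cases "u = 1") (auto intro!: add_pos_nonneg)
      then show ?thesis by (simp add: slit_plane_def)
    next
      case False
      show ?thesis
      proof (cases "u = 1")
        case True then show ?thesis by (simp add: x slit_plane_def)
      next
        case False
        then show ?thesis using \<open>Im t \<noteq> 0\<close> im by (simp add: slit_plane_def)
      qed
    qed
  qed
  have 1: "homology_group p ?X \<cong> homology_group p (subtopology ?X (topspace F \<times> {1}))
      \<times>\<times> relative_homology_group p ?X (topspace F \<times> {1})"
  proof (rule isomorphic_group_homology_group_prod_retract)
    have "continuous_map ?X (subtopology ?X (topspace F \<times> {1})) (\<lambda>(x, t). (x, 1))"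
      unfolding continuous_map_in_subtopology
      by (auto simp: cyl_def continuous_map_pairwise o_def case_prod_unfold continuous_map_fst)
    then show "topspace F \<times> {1} = {} \<or> topspace F \<times> {1} retract_of_space ?X"
      by (auto simp: retract_of_space_def topspace_cyl)
  qed
  \<comment> \<open>Only the trace on the space matters, so the retract may be written with
    \<open>UNIV\<close> like the other pairs.\<close>
  have eq1: "subtopology ?X (topspace F \<times> {1}) = cyl F {1}"
    using subtopology_cyl[of F "-{0}" "{1}"] subtopology_restrict[of ?X "UNIV \<times> {1}"]
    by (simp add: topspace_cyl Times_Int_Times)
  have eq2: "relative_homology_group p ?X (topspace F \<times> {1}) = relative_homology_group p ?X (UNIV \<times> {1})"
    using relative_homology_group_restrict[of p ?X "UNIV \<times> {1}"]
    by (simp add: topspace_cyl Times_Int_Times)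
  have 2: "homology_group p (cyl F {1}) \<cong> homology_group p F"
    by (rule homology_cyl_starlike[of 1]) auto
  have A0: "(-{0}) \<inter> ?A = ?A" by (auto simp: slit_plane_def)
  \<comment> \<open>Exact sequence of the triple of punctured plane, slit plane and
    \<open>{1}\<close>: the slit plane relative to \<open>{1}\<close> has no homology, so enlarging
    \<open>{1}\<close> to the slit plane changes nothing.\<close>
  have 3: "hom_induced p ?X (UNIV \<times> {1}) ?X (UNIV \<times> ?A) id
         \<in> iso (relative_homology_group p ?X (UNIV \<times> {1})) (relative_homology_group p ?X (UNIV \<times> ?A))"
  proof (rule very_short_exact_sequence)
    have sub: "UNIV \<times> {1} \<subseteq> UNIV \<times> ?A" by (auto simp: slit_plane_def)
    show "exact_seq
         ([relative_homology_group(p - 1) (subtopology ?X (UNIV \<times> ?A)) (UNIV \<times> {1}), relative_homology_group p ?X (UNIV \<times> ?A), relative_homology_group p ?X (UNIV \<times> {1}), relative_homology_group p (subtopology ?X (UNIV \<times> ?A)) (UNIV \<times> {1})],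
          [hom_relboundary p ?X (UNIV \<times> ?A) (UNIV \<times> {1}), hom_induced p ?X (UNIV \<times> {1}) ?X (UNIV \<times> ?A) id, hom_induced p (subtopology ?X (UNIV \<times> ?A)) (UNIV \<times> {1}) ?X (UNIV \<times> {1}) id])"
      using homology_exactness_triple_1[OF sub, of p ?X] homology_exactness_triple_3[OF sub, of p ?X] by simp
    have "trivial_group (relative_homology_group q (cyl F ?A) (UNIV \<times> {1}))" for q
      by (rule trivial_relative_homology_cyl[of 1]) (use segA in \<open>auto simp: slit_plane_def\<close>)
    then show "trivial_group (relative_homology_group p (subtopology ?X (UNIV \<times> ?A)) (UNIV \<times> {1}))"
      "trivial_group (relative_homology_group (p - 1) (subtopology ?X (UNIV \<times> ?A)) (UNIV \<times> {1}))"
      by (simp_all add: subtopology_cyl A0)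
  qed
  have clA: "closed {z::complex. Im z = 0 \<and> Re z \<le> 0}"
    by (intro closed_Collect_conj closed_Collect_eq closed_Collect_le continuous_intros)
  have opA: "open ?A" unfolding slit_plane_def using clA by (simp add: open_Compl)
  have clK: "closed K" unfolding K_def by (intro closed_Collect_le continuous_intros)
  \<comment> \<open>The right half plane without 0 is closed in the punctured plane and lies in the
    open slit plane. Removing it leaves \<open>L\<close>, with \<open>Lp \<union> Lm\<close> as the
    remainder of the slit plane.\<close>
  have 4: "hom_induced p (subtopology ?X (UNIV - UNIV \<times> K)) (UNIV \<times> ?A - UNIV \<times> K) (subtopology ?X UNIV) (UNIV \<times> ?A) id
    \<in> iso (relative_homology_group p (subtopology ?X (UNIV - UNIV \<times> K)) (UNIV \<times> ?A - UNIV \<times> K))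
          (relative_homology_group p (subtopology ?X UNIV) (UNIV \<times> ?A))"
    by (intro homology_excision_axiom cyl_closure_interior clK opA)
       (auto simp: K_def slit_plane_def complex_eq_iff)
  have d1: "UNIV - UNIV \<times> K = UNIV \<times> L" and d2: "UNIV \<times> ?A - UNIV \<times> K = UNIV \<times> (Lp \<union> Lm)"
    by (auto simp: K_def L_def Lp_def Lm_def slit_plane_def)
  have d3: "(-{0}) \<inter> L = L" by (auto simp: L_def)
  have i4: "relative_homology_group p (cyl F L) (UNIV \<times> (Lp \<union> Lm)) \<cong> relative_homology_group p ?X (UNIV \<times> ?A)"
    using is_isoI[OF 4] unfolding d1 d2 subtopology_cyl d3 by simp
  have m: "Complex (-1) (-1) \<in> Lm" "Complex (-1) 1 \<in> Lp" by (auto simp: Lm_def Lp_def)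
  have sub: "UNIV \<times> Lm \<subseteq> UNIV \<times> (Lp \<union> Lm)" by auto
  have LL: "L \<inter> (Lp \<union> Lm) = Lp \<union> Lm" "Lm \<subseteq> L" by (auto simp: L_def Lp_def Lm_def)
  \<comment> \<open>\<open>L\<close> and \<open>Lm\<close> contract to the same point, so
    \<open>L\<close> relative to \<open>Lm\<close> is trivial and the boundary map of the triple is
    an isomorphism; this is where the degree drops.\<close>
  have 5: "hom_relboundary p (cyl F L) (UNIV \<times> (Lp \<union> Lm)) (UNIV \<times> Lm)
     \<in> iso (relative_homology_group p (cyl F L) (UNIV \<times> (Lp \<union> Lm)))
        (relative_homology_group (p - 1) (subtopology (cyl F L) (UNIV \<times> (Lp \<union> Lm))) (UNIV \<times> Lm))"
  proof (rule very_short_exact_sequence)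
    show "exact_seq
         ([relative_homology_group (p - 1) (cyl F L) (UNIV \<times> Lm), relative_homology_group (p - 1) (subtopology (cyl F L) (UNIV \<times> (Lp \<union> Lm))) (UNIV \<times> Lm), relative_homology_group p (cyl F L) (UNIV \<times> (Lp \<union> Lm)), relative_homology_group p (cyl F L) (UNIV \<times> Lm)],
          [hom_induced (p - 1) (subtopology (cyl F L) (UNIV \<times> (Lp \<union> Lm))) (UNIV \<times> Lm) (cyl F L) (UNIV \<times> Lm) id, hom_relboundary p (cyl F L) (UNIV \<times> (Lp \<union> Lm)) (UNIV \<times> Lm), hom_induced p (cyl F L) (UNIV \<times> Lm) (cyl F L) (UNIV \<times> (Lp \<union> Lm)) id])"
      using homology_exactness_triple_1[OF sub, of p "cyl F L"] homology_exactness_triple_2[OF sub, of p "cyl F L"] by simp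
    have "trivial_group (relative_homology_group q (cyl F L) (UNIV \<times> Lm))" for q
      by (rule trivial_relative_homology_cyl[OF m(1) LL(2) seg[OF cp(2) m(1)] seg[OF half subsetD[OF LL(2) m(1)]]])
    then show "trivial_group (relative_homology_group p (cyl F L) (UNIV \<times> Lm))"
      "trivial_group (relative_homology_group (p - 1) (cyl F L) (UNIV \<times> Lm))" by auto
  qed
  let ?Y = "cyl F (Lp \<union> Lm)"
  \<comment> \<open>The imaginary part has no zero on \<open>Lp \<union> Lm\<close>, so
    \<open>Im z \<le> 0\<close> and \<open>Im z < 0\<close> cut out the same part of it. All of
    \<open>Lm\<close> can therefore be excised, and the relative group becomes the absolute one of
    \<open>Lp\<close>.\<close>
  have 6: "hom_induced (p - 1) (subtopology ?Y (UNIV - UNIV \<times> {z. Im z \<le> 0})) (UNIV \<times> {z. Im z < 0} - UNIV \<times> {z. Im z \<le> 0}) (subtopology ?Y UNIV) (UNIV \<times> {z. Im z < 0}) id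
    \<in> iso (relative_homology_group (p - 1) (subtopology ?Y (UNIV - UNIV \<times> {z. Im z \<le> 0})) (UNIV \<times> {z. Im z < 0} - UNIV \<times> {z. Im z \<le> 0}))
          (relative_homology_group (p - 1) (subtopology ?Y UNIV) (UNIV \<times> {z. Im z < 0}))"
    by (intro homology_excision_axiom cyl_closure_interior)
       (auto simp: Lp_def Lm_def closed_halfspace_Im_le open_halfspace_Im_lt)
  have e1: "UNIV - UNIV \<times> {z. Im z \<le> 0} = UNIV \<times> {z. Im z > 0}"
    and e2: "UNIV \<times> {z. Im z < 0} - UNIV \<times> {z. Im z \<le> 0} = {}" by auto
  have e3: "(Lp \<union> Lm) \<inter> {z. Im z > 0} = Lp" by (auto simp: Lp_def Lm_def)
  have e4: "relative_homology_group (p - 1) ?Y (UNIV \<times> {z. Im z < 0}) = relative_homology_group (p - 1) ?Y (UNIV \<times> Lm)"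
  proof -
    have "topspace ?Y \<inter> (UNIV \<times> {z. Im z < 0}) = topspace ?Y \<inter> (UNIV \<times> Lm)"
      by (auto simp: topspace_cyl Lp_def Lm_def)
    then show ?thesis
      using relative_homology_group_restrict[of "p - 1" ?Y "UNIV \<times> {z. Im z < 0}"]
        relative_homology_group_restrict[of "p - 1" ?Y "UNIV \<times> Lm"] by simp
  qed
  have i6: "homology_group (p - 1) (cyl F Lp) \<cong> relative_homology_group (p - 1) ?Y (UNIV \<times> Lm)"
    using is_isoI[OF 6] unfolding e1 e2 subtopology_cyl e3 by (simp add: e4)
  have 7: "homology_group (p - 1) (cyl F Lp) \<cong> homology_group (p - 1) F"
    by (rule homology_cyl_starlike[OF m(2) seg[OF cp(1) m(2)]])
  have i5: "relative_homology_group p (cyl F L) (UNIV \<times> (Lp \<union> Lm)) \<cong> relative_homology_group (p - 1) ?Y (UNIV \<times> Lm)"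
    using is_isoI[OF 5] unfolding subtopology_cyl LL .
  have "relative_homology_group p ?X (UNIV \<times> {1}) \<cong> homology_group (p - 1) F"
    using iso_trans[OF is_isoI[OF 3] iso_trans[OF group.iso_sym[OF _ i4]
      iso_trans[OF i5 iso_trans[OF group.iso_sym[OF _ i6] 7]]]] by simp
  then have "homology_group p (cyl F {1}) \<times>\<times> relative_homology_group p ?X (UNIV \<times> {1})
      \<cong> homology_group p F \<times>\<times> homology_group (p - 1) F"
    using 2 by (intro group.DirProd_iso_trans) auto
  then show ?thesis
    using 1 unfolding eq1 eq2 by (rule iso_trans[rotated])
qed

section \<open>Rational cohomology as the dual of homology\<close>

lemma module_isomorphicE:
  assumes "module_isomorphic R M N"
  obtains f where "bij_betw f (carrier M) (carrier N)"
    "\<forall>x\<in>carrier M. \<forall>y\<in>carrier M. f (x \<oplus>\<^bsub>M\<^esub> y) = f x \<oplus>\<^bsub>N\<^esub> f y"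
    "\<forall>c\<in>carrier R. \<forall>x\<in>carrier M. f (c \<odot>\<^bsub>M\<^esub> x) = c \<odot>\<^bsub>N\<^esub> f x"
  using assms unfolding module_isomorphic_def by blast

lemma module_isomorphic_trans:
  assumes "module_isomorphic R M N" "module_isomorphic R N P"
  shows "module_isomorphic R M P"
proof -
  obtain f where f: "bij_betw f (carrier M) (carrier N)"
      "\<forall>x\<in>carrier M. \<forall>y\<in>carrier M. f (x \<oplus>\<^bsub>M\<^esub> y) = f x \<oplus>\<^bsub>N\<^esub> f y"
      "\<forall>c\<in>carrier R. \<forall>x\<in>carrier M. f (c \<odot>\<^bsub>M\<^esub> x) = c \<odot>\<^bsub>N\<^esub> f x"
    using assms(1) by (rule module_isomorphicE)
  obtain g where g: "bij_betw g (carrier N) (carrier P)"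
      "\<forall>x\<in>carrier N. \<forall>y\<in>carrier N. g (x \<oplus>\<^bsub>N\<^esub> y) = g x \<oplus>\<^bsub>P\<^esub> g y"
      "\<forall>c\<in>carrier R. \<forall>x\<in>carrier N. g (c \<odot>\<^bsub>N\<^esub> x) = c \<odot>\<^bsub>P\<^esub> g x"
    using assms(2) by (rule module_isomorphicE)
  have fN: "f x \<in> carrier N" if "x \<in> carrier M" for x
    using f(1) that by (rule bij_betw_apply)
  show ?thesis
    unfolding module_isomorphic_def
  proof (intro exI[of _ "g \<circ> f"] conjI ballI)
    show "bij_betw (g \<circ> f) (carrier M) (carrier P)"
      using f(1) g(1) by (rule bij_betw_trans)
  qed (simp_all add: f g fN)
qed

text \<open>\<open>module_isomorphic\<close> presupposes no module axioms. Closure of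
  \<open>M\<close> guarantees that sums and multiples are points at which the inverse undoes
  \<open>f\<close>.\<close>

lemma module_isomorphic_sym:
  assumes closed: "\<And>x y. x \<in> carrier M \<Longrightarrow> y \<in> carrier M \<Longrightarrow> x \<oplus>\<^bsub>M\<^esub> y \<in> carrier M"
      "\<And>c x. c \<in> carrier R \<Longrightarrow> x \<in> carrier M \<Longrightarrow> c \<odot>\<^bsub>M\<^esub> x \<in> carrier M"
    and iso: "module_isomorphic R M N"
  shows "module_isomorphic R N M"
proof -
  obtain f where f: "bij_betw f (carrier M) (carrier N)"
      "\<forall>x\<in>carrier M. \<forall>y\<in>carrier M. f (x \<oplus>\<^bsub>M\<^esub> y) = f x \<oplus>\<^bsub>N\<^esub> f y"
      "\<forall>c\<in>carrier R. \<forall>x\<in>carrier M. f (c \<odot>\<^bsub>M\<^esub> x) = c \<odot>\<^bsub>N\<^esub> f x"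
    using iso by (rule module_isomorphicE)
  let ?g = "inv_into (carrier M) f"
  have inj: "inj_on f (carrier M)" and im: "carrier N = f ` carrier M"
    using f(1) by (auto simp: bij_betw_def)
  have g: "?g (f x) = x" if "x \<in> carrier M" for x
    using inj that by simp
  have "?g (f x \<oplus>\<^bsub>N\<^esub> f y) = x \<oplus>\<^bsub>M\<^esub> y" if "x \<in> carrier M" "y \<in> carrier M" for x y
    using that closed f(2) g[of "x \<oplus>\<^bsub>M\<^esub> y"] by simp
  moreover have "?g (c \<odot>\<^bsub>N\<^esub> f x) = c \<odot>\<^bsub>M\<^esub> x" if "c \<in> carrier R" "x \<in> carrier M" for c x
    using that closed f(3) g[of "c \<odot>\<^bsub>M\<^esub> x"] by simp
  ultimately show ?thesis
    unfolding module_isomorphic_def using bij_betw_inv_into[OF f(1)]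
    by (intro exI[of _ ?g] conjI) (simp_all add: im g)
qed

text \<open>First isomorphism theorem for a linear map into rational-valued functions; it identifies
  both cohomology and tensor products, whose elements are cosets.\<close>

lemma quotient_module_isomorphic:
  fixes M :: "(rat, 'a) module" and L :: "'a \<Rightarrow> 'b \<Rightarrow> rat"
  assumes M: "module rat_field M" and N: "submodule N rat_field M"
    and add: "\<And>x y. x \<in> carrier M \<Longrightarrow> y \<in> carrier M \<Longrightarrow> L (x \<oplus>\<^bsub>M\<^esub> y) = (\<lambda>s. L x s + L y s)"
    and smult: "\<And>c x. x \<in> carrier M \<Longrightarrow> L (c \<odot>\<^bsub>M\<^esub> x) = (\<lambda>s. c * L x s)"
    and im: "L ` carrier M = D"
    and ker: "\<And>x. x \<in> carrier M \<Longrightarrow> L x = (\<lambda>s. 0) \<longleftrightarrow> x \<in> N"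
  shows "module_isomorphic rat_field (quotient_module M N) (pointwise_module D)"
proof -
  interpret M: module rat_field M by (rule M)
  interpret N: submodule N rat_field M by (rule N)
  interpret abelian_subgroup N M
    by (rule abelian_subgroupI3) (auto intro: additive_subgroup.intro N.subgroup_axioms M.abelian_group_axioms)
  let ?Q = "quotient_module M N"
  interpret Q: module rat_field ?Q by (rule module_quotient[OF M N])
  have cQ: "carrier ?Q = {N +>\<^bsub>M\<^esub> x | x. x \<in> carrier M}"
    by (auto simp: quotient_module_def A_RCOSETS_def')
  have Lc: "L a = L x" and ac: "a \<in> carrier M" if x: "x \<in> carrier M" and ax: "a \<in> N +>\<^bsub>M\<^esub> x" for a x
  proof -
    obtain n where n: "n \<in> N" "a = n \<oplus>\<^bsub>M\<^esub> x"
      using ax unfolding a_r_coset_def' by blast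
    then have "n \<in> carrier M" using a_Hcarr by blast
    then have "L n = (\<lambda>s. 0)" using ker[of n] n(1) by blast
    then show "L a = L x" "a \<in> carrier M" using n x add[OF \<open>n \<in> carrier M\<close> x] \<open>n \<in> carrier M\<close> by simp_all
  qed
  \<comment> \<open>An arbitrary member represents the coset; by \<open>Lc\<close> the value of
    \<open>L\<close> does not depend on it.\<close>
  define h where "h A = L (SOME a. a \<in> A)" for A
  have h: "h A = L a" if A: "A \<in> carrier ?Q" and a: "a \<in> A" for A a
  proof -
    obtain x where x: "x \<in> carrier M" "A = N +>\<^bsub>M\<^esub> x" using A cQ by auto
    have "(SOME a. a \<in> A) \<in> A" using a by (rule someI)
    then show ?thesis unfolding h_def using Lc[OF x(1)] x(2) a by simp
  qed
  have ne: "\<exists>a. a \<in> A \<and> a \<in> carrier M" if A: "A \<in> carrier ?Q" for A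
  proof -
    obtain x where "x \<in> carrier M" "A = N +>\<^bsub>M\<^esub> x" using A unfolding cQ by blast
    then show ?thesis using a_rcos_self[of x] by blast
  qed
  have coset: "A = N +>\<^bsub>M\<^esub> a" and cin: "a \<in> carrier M" if A: "A \<in> carrier ?Q" and a: "a \<in> A" for A a
  proof -
    obtain x where x: "x \<in> carrier M" "A = N +>\<^bsub>M\<^esub> x" using A unfolding cQ by blast
    have ax: "a \<in> N +>\<^bsub>M\<^esub> x" using a x by simp
    show "A = N +>\<^bsub>M\<^esub> a" unfolding x(2) by (rule a_repr_independence'[OF ax x(1)])
    show "a \<in> carrier M" by (rule ac[OF x(1) ax])
  qed
  have inj: "inj_on h (carrier ?Q)"
  proof (rule inj_onI)
    fix A B assume A: "A \<in> carrier ?Q" and B: "B \<in> carrier ?Q" and eq: "h A = h B"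
    obtain a b where a: "a \<in> A" "a \<in> carrier M" and b: "b \<in> B" "b \<in> carrier M"
      using ne A B by meson
    have "L a = L b" using eq h[OF A a(1)] h[OF B b(1)] by simp
    \<comment> \<open>Linearity of \<open>L\<close> speaks of sums and scalar multiples, so the
      additive inverse is rewritten as multiplication by \<open>-1\<close>.\<close>
    have neg: "\<ominus>\<^bsub>M\<^esub> b = (-1) \<odot>\<^bsub>M\<^esub> b"
    proof (rule M.minus_equality)
      have r: "c \<in> carrier rat_field" "\<zero>\<^bsub>rat_field\<^esub> = 0" "\<one>\<^bsub>rat_field\<^esub> = 1" for c
        by (auto simp: rat_field_def)
      have "(-1) \<odot>\<^bsub>M\<^esub> b \<oplus>\<^bsub>M\<^esub> 1 \<odot>\<^bsub>M\<^esub> b = (-1 \<oplus>\<^bsub>rat_field\<^esub> 1) \<odot>\<^bsub>M\<^esub> b"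
        using M.smult_l_distr[OF r(1) r(1) b(2)] by simp
      also have "(-1 \<oplus>\<^bsub>rat_field\<^esub> 1) = \<zero>\<^bsub>rat_field\<^esub>" by (simp add: rat_field_def)
      finally show "(-1) \<odot>\<^bsub>M\<^esub> b \<oplus>\<^bsub>M\<^esub> b = \<zero>\<^bsub>M\<^esub>"
        using M.smult_l_null[OF b(2)] M.smult_one[OF b(2)] by (simp add: r)
      show "(-1) \<odot>\<^bsub>M\<^esub> b \<in> carrier M" using b r by auto
    qed (use b in auto)
    have "L (a \<oplus>\<^bsub>M\<^esub> \<ominus>\<^bsub>M\<^esub> b) = (\<lambda>s. 0)"
      using add[of a "\<ominus>\<^bsub>M\<^esub> b"] smult[of b "-1"] a b \<open>L a = L b\<close> by (simp add: neg[symmetric])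
    then have "a \<oplus>\<^bsub>M\<^esub> \<ominus>\<^bsub>M\<^esub> b \<in> N" using ker a b by simp
    then have "a \<in> N +>\<^bsub>M\<^esub> b"
      unfolding a_r_coset_def' using a b
      by (intro UN_I[of "a \<oplus>\<^bsub>M\<^esub> \<ominus>\<^bsub>M\<^esub> b"]) (simp_all add: M.a_assoc M.l_neg)
    then have "N +>\<^bsub>M\<^esub> a = N +>\<^bsub>M\<^esub> b"
      using a_repr_independence'[OF _ b(2)] by simp
    then show "A = B" using coset[OF A a(1)] coset[OF B b(1)] by simp
  qed
  have "h ` carrier ?Q = D"
  proof -
    have "h (N +>\<^bsub>M\<^esub> x) = L x" if "x \<in> carrier M" for x
      using that by (intro h a_rcos_self) (auto simp: cQ)
    moreover have "carrier ?Q = (\<lambda>x. N +>\<^bsub>M\<^esub> x) ` carrier M" unfolding cQ by blast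
    ultimately show ?thesis unfolding im[symmetric] by (simp add: image_image)
  qed
  moreover have "h (A \<oplus>\<^bsub>?Q\<^esub> B) = (\<lambda>s. h A s + h B s)" if A: "A \<in> carrier ?Q" and B: "B \<in> carrier ?Q" for A B
  proof -
    obtain a b where ab: "a \<in> A" "a \<in> carrier M" "b \<in> B" "b \<in> carrier M" using ne A B by meson
    have "a \<oplus>\<^bsub>M\<^esub> b \<in> A \<oplus>\<^bsub>?Q\<^esub> B"
      using ab by (auto simp: quotient_module_def set_add_def')
    then have "h (A \<oplus>\<^bsub>?Q\<^esub> B) = L (a \<oplus>\<^bsub>M\<^esub> b)" using A B by (intro h) auto
    then show ?thesis using h[OF A] h[OF B] ab add by simp
  qed
  moreover have "h (c \<odot>\<^bsub>?Q\<^esub> A) = (\<lambda>s. c * h A s)" if A: "A \<in> carrier ?Q" for A c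
  proof -
    obtain a where a: "a \<in> A" "a \<in> carrier M" using ne A by meson
    have cc: "c \<in> carrier rat_field" by (simp add: rat_field_def)
    have "c \<odot>\<^bsub>M\<^esub> a \<in> c \<odot>\<^bsub>?Q\<^esub> A"
      using a a_rcos_self[of "c \<odot>\<^bsub>M\<^esub> a"] cc by (auto simp: quotient_module_def)
    then have "h (c \<odot>\<^bsub>?Q\<^esub> A) = L (c \<odot>\<^bsub>M\<^esub> a)" using A cc by (intro h) auto
    then show ?thesis using h[OF A] a smult by simp
  qed
  ultimately show ?thesis
    unfolding module_isomorphic_def using inj
    by (intro exI[of _ h]) (auto simp: bij_betw_def pointwise_module_def)
qed

text \<open>Closure under differences already makes \<open>M\<close> a subgroup. It is applied to
  the graph of a partial homomorphism, whence the pairs.\<close>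

lemma frag_cmul_closed:
  assumes "\<And>z w. z \<in> M \<Longrightarrow> w \<in> M \<Longrightarrow> z - w \<in> M" and "(a, r) \<in> M"
  shows "(frag_cmul n a, of_int n * r) \<in> (M :: (('b \<Rightarrow>\<^sub>0 int) \<times> rat) set)"
proof -
  have zero: "0 \<in> M" using assms(1)[OF assms(2) assms(2)] by simp
  have neg: "- z \<in> M" if "z \<in> M" for z using assms(1)[OF zero that] by simp
  have plus: "z + w \<in> M" if "z \<in> M" "w \<in> M" for z w
    using assms(1)[OF that(1) neg[OF that(2)]] by simp
  have nat: "(frag_cmul (int k) a, of_int (int k) * r) \<in> M" for k
  proof (induction k)
    case 0
    then show ?case using zero by (simp add: zero_prod_def)
  next
    case (Suc k)
    have "(frag_cmul (int k) a, of_int (int k) * r) + (a, r) \<in> M"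
      using Suc assms(2) by (rule plus)
    then show ?case by (simp add: frag_cmul_distrib ring_distribs add.commute)
  qed
  show ?thesis
  proof (cases n)
    case (nonneg k) then show ?thesis using nat by simp
  next
    case (neg k)
    then have "(frag_cmul n a, of_int n * r) = - (frag_cmul (int (Suc k)) a, of_int (int (Suc k)) * r)"
      by (simp add: neg del: of_nat_Suc)
    then show ?thesis using \<open>\<And>z. z \<in> M \<Longrightarrow> - z \<in> M\<close>[OF nat[of "Suc k"]] by metis
  qed
qed

text \<open>Divisibility of the rationals makes them an injective abelian group.\<close>

lemma extend_additive_map:
  fixes A :: "('b \<Rightarrow>\<^sub>0 int) set" and \<phi> :: "('b \<Rightarrow>\<^sub>0 int) \<Rightarrow> rat"
  assumes A: "0 \<in> A" "\<And>x y. x \<in> A \<Longrightarrow> y \<in> A \<Longrightarrow> x - y \<in> A"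
    and \<phi>: "\<And>x y. x \<in> A \<Longrightarrow> y \<in> A \<Longrightarrow> \<phi> (x - y) = \<phi> x - \<phi> y"
  obtains \<psi> where "\<And>x y. \<psi> (x - y) = \<psi> x - \<psi> y" "\<And>x. x \<in> A \<Longrightarrow> \<psi> x = \<phi> x"
proof -
  \<comment> \<open>Partial extensions are encoded as graphs: subgroups of the product that contain
    the graph of \<open>\<phi>\<close>. For a subgroup, uniqueness of the value at 0 is uniqueness
    everywhere.\<close>
  define S where "S = {M. (\<lambda>x. (x, \<phi> x)) ` A \<subseteq> M \<and> (\<forall>z\<in>M. \<forall>w\<in>M. z - w \<in> M) \<and> (\<forall>q. (0, q) \<in> M \<longrightarrow> q = 0)}"
  have \<phi>0: "\<phi> 0 = 0" using \<phi>[OF A(1) A(1)] by simp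
  have ne: "(\<lambda>x. (x, \<phi> x)) ` A \<in> S"
    unfolding S_def using A \<phi> \<phi>0 by auto
  have "\<exists>M\<in>S. \<forall>X\<in>S. M \<subseteq> X \<longrightarrow> X = M"
  proof (rule subset_Zorn_nonempty)
    show "S \<noteq> {}" using ne by auto
    fix C assume C: "C \<noteq> {}" "subset.chain S C"
    have CS: "P \<in> S" if "P \<in> C" for P
      using C(2) that by (auto simp: subset_chain_def)
    show "\<Union>C \<in> S"
      unfolding S_def
    proof (intro CollectI conjI ballI allI impI)
      obtain M where "M \<in> C" using C(1) by blast
      then have "(\<lambda>x. (x, \<phi> x)) ` A \<subseteq> M" using CS by (simp add: S_def)
      then show "(\<lambda>x. (x, \<phi> x)) ` A \<subseteq> \<Union>C" using Union_upper[OF \<open>M \<in> C\<close>] by (rule subset_trans)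
    next
      fix z w assume "z \<in> \<Union>C" "w \<in> \<Union>C"
      then obtain M M' where M: "M \<in> C" "M' \<in> C" "z \<in> M" "w \<in> M'" by blast
      then have "M \<subseteq> M' \<or> M' \<subseteq> M" using C(2) by (simp add: subset_chain_def)
      then obtain P where P: "P \<in> C" "z \<in> P" "w \<in> P" using M by blast
      then have "z - w \<in> P" using CS by (simp add: S_def)
      then show "z - w \<in> \<Union>C" using P by blast
    next
      fix q assume "(0, q) \<in> \<Union>C"
      then obtain P where P: "P \<in> C" "(0, q) \<in> P" by blast
      then show "q = 0" using CS by (simp add: S_def)
    qed
  qed
  then obtain M where M: "M \<in> S" and max: "\<And>X. X \<in> S \<Longrightarrow> M \<subseteq> X \<Longrightarrow> X = M" by blast
  have gr: "(\<lambda>x. (x, \<phi> x)) ` A \<subseteq> M" and diff: "\<And>z w. z \<in> M \<Longrightarrow> w \<in> M \<Longrightarrow> z - w \<in> M"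
    and uniq0: "\<And>q. (0, q) \<in> M \<Longrightarrow> q = 0"
    using M by (auto simp: S_def)
  have "(0, \<phi> 0) \<in> M" using gr A(1) by blast
  then have zero: "0 \<in> M" by (simp add: \<phi>0 zero_prod_def)
  have uniq: "r = q" if "(x, r) \<in> M" "(x, q) \<in> M" for x r q
    using diff[OF that] uniq0[of "r - q"] by simp
  have total: "\<exists>q. (x, q) \<in> M" for x
  proof -
    \<comment> \<open>The value at a new element \<open>x\<close>: if some non-zero multiple
      \<open>n x\<close> already has the value \<open>r\<close>, it must be \<open>r / n\<close>,
      and this is where divisibility enters. If none has, any value will do, and 0 is taken.\<close>
    have "\<exists>q. \<forall>n r. (frag_cmul n x, r) \<in> M \<longrightarrow> r = of_int n * q"
    proof (cases "\<exists>n r. n \<noteq> 0 \<and> (frag_cmul n x, r) \<in> M")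
      case True
      then obtain n r where n: "n \<noteq> 0" "(frag_cmul n x, r) \<in> M" by auto
      have "r' = of_int m * (r / of_int n)" if "(frag_cmul m x, r') \<in> M" for m r'
      proof -
        have "(frag_cmul (m * n) x, of_int m * r) \<in> M"
          using frag_cmul_closed[OF diff n(2), of m] by simp
        moreover have "(frag_cmul (m * n) x, of_int n * r') \<in> M"
          using frag_cmul_closed[OF diff that, of n] by (simp add: mult.commute)
        ultimately have "of_int m * r = of_int n * r'" by (rule uniq)
        then show ?thesis using n(1) by (simp add: field_simps)
      qed
      then show ?thesis by blast
    next
      case False
      then have "r = of_int n * 0" if "(frag_cmul n x, r) \<in> M" for n r
        using that uniq0 by (cases "n = 0") auto
      then show ?thesis by blast
    qed
    then obtain q where q: "\<And>n r. (frag_cmul n x, r) \<in> M \<Longrightarrow> r = of_int n * q" by auto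
    define M' where "M' = {z + (frag_cmul n x, of_int n * q) | z n. z \<in> M}"
    have M'I: "z + (frag_cmul n x, of_int n * q) \<in> M'" if "z \<in> M" for z n
      unfolding M'_def using that by blast
    have sub: "M \<subseteq> M'"
    proof
      fix z assume "z \<in> M"
      then show "z \<in> M'" using M'I[of z 0] by (simp flip: zero_prod_def)
    qed
    have "M' \<in> S"
      unfolding S_def
    proof (intro CollectI conjI ballI allI impI)
      show "(\<lambda>x. (x, \<phi> x)) ` A \<subseteq> M'" using gr sub by blast
    next
      fix z w assume "z \<in> M'" "w \<in> M'"
      then obtain a m b n where ab: "a \<in> M" "b \<in> M"
        and zw: "z = a + (frag_cmul m x, of_int m * q)" "w = b + (frag_cmul n x, of_int n * q)"
        unfolding M'_def by blast
      have zw: "z - w = (a - b) + (frag_cmul (m - n) x, of_int (m - n) * q)"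
        unfolding zw by (cases a; cases b) (simp add: frag_cmul_diff_distrib algebra_simps)
      show "z - w \<in> M'" unfolding zw by (rule M'I[OF diff[OF ab]])
    next
      \<comment> \<open>An element of \<open>M'\<close> over 0 puts a multiple of \<open>x\<close>
        into the domain of \<open>M\<close>, where \<open>q\<close> was chosen to be
        compatible.\<close>
      fix r assume "(0, r) \<in> M'"
      then obtain a n where a: "a \<in> M" "(0, r) = a + (frag_cmul n x, of_int n * q)"
        unfolding M'_def by blast
      obtain c d where cd: "a = (c, d)" by (rule prod.exhaust)
      have e: "c + frag_cmul n x = 0" "r = d + of_int n * q"
        using a(2) unfolding cd by simp_all
      have "c = frag_cmul (- n) x" using e(1) minus_unique[of "frag_cmul n x" c] by (simp add: add.commute)
      then have "(frag_cmul (- n) x, d) \<in> M" using a(1) unfolding cd by simp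
      from q[OF this] show "r = 0" using e(2) by simp
    qed
    from max[OF this sub] have "(x, q) \<in> M"
      using M'I[OF zero, of 1] by (metis add_0 frag_cmul_one mult_1 of_int_1)
    then show ?thesis ..
  qed
  define \<psi> where "\<psi> x = (THE q. (x, q) \<in> M)" for x
  have \<psi>: "(x, \<psi> x) \<in> M" for x
  proof -
    obtain q where q: "(x, q) \<in> M" using total by blast
    then have "\<psi> x = q" unfolding \<psi>_def by (rule the_equality) (rule uniq[OF _ q])
    then show ?thesis using q by simp
  qed
  show ?thesis
  proof
    show "\<psi> (x - y) = \<psi> x - \<psi> y" for x y
      by (rule uniq[OF \<psi>[of "x - y"]]) (use diff[OF \<psi>[of x] \<psi>[of y]] in simp)
    show "\<psi> x = \<phi> x" if "x \<in> A" for x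
      by (rule uniq[OF \<psi>[of x]]) (use gr that in blast)
  qed
qed

lemma submodule_coboundaries:
  "submodule (singular_coboundaries p X) rat_field (pointwise_module (singular_cocycles p X))"
proof -
  have "coboundary q X f \<in> singular_cochains (Suc q) X" for q f
    by (simp add: singular_cochains_def coboundary_def)
  then have "singular_coboundaries p X \<subseteq> singular_cocycles p X"
    by (cases p) (auto simp: singular_coboundaries_def singular_cocycles_def singular_cochains_closed
        coboundary_zero coboundary_coboundary)
  then show ?thesis
    using module_coboundaries[of p X]
    by (intro module.module_incl_imp_submodule[OF module_cocycles]) (simp_all add: pointwise_module_def)
qed

text \<open>Homomorphisms to the rationals. The value 0 off the carrier makes homomorphisms that
  agree on the group equal as functions.\<close>

definition rat_dual :: "'g monoid \<Rightarrow> (rat, 'g \<Rightarrow> rat) module" where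
  "rat_dual G = pointwise_module
     {h. (\<forall>x\<in>carrier G. \<forall>y\<in>carrier G. h (x \<otimes>\<^bsub>G\<^esub> y) = h x + h y) \<and> (\<forall>x. x \<notin> carrier G \<longrightarrow> h x = 0)}"

text \<open>Chains are free on simplices, so an additive map is recovered from the cochain of its
  values on simplices. This turns extended homomorphisms into cochains.\<close>

lemma cochain_eval_additive_extension:
  assumes \<psi>: "\<And>x y. \<psi> (x - y) = \<psi> x - (\<psi> y :: rat)" and c: "singular_chain p X c"
  shows "cochain_eval (\<lambda>s. if singular_simplex p X s then \<psi> (frag_of s) else 0) c = \<psi> c"
proof -
  have 0: "\<psi> 0 = 0" using \<psi>[of 0 0] by simp
  have "Poly_Mapping.keys c \<subseteq> singular_simplex_set p X"
    using c by (simp add: singular_chain_def)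
  then show ?thesis
  proof (rule frag_induction, goal_cases)
    case 1
    show ?case by (simp add: cochain_eval_0 0)
  next
    case (2 s)
    then show ?case by (simp add: cochain_eval_frag_of)
  next
    case (3 a b)
    then show ?case by (simp add: cochain_eval_diff \<psi>)
  qed
qed

lemma cochain_eval_coboundary:
  assumes "singular_chain (Suc p) X d"
  shows "cochain_eval (coboundary p X \<phi>) d = cochain_eval \<phi> (chain_boundary (Suc p) d)"
proof -
  have "singular_simplex (Suc p) X s" if "s \<in> Poly_Mapping.keys d" for s
    using assms that by (auto simp: singular_chain_def)
  then have "cochain_eval (coboundary p X \<phi>) d = cochain_eval (\<lambda>s. cochain_eval \<phi> (chain_boundary (Suc p) (frag_of s))) d"
    unfolding cochain_eval_def[of _ d] by (intro sum.cong refl) (simp add: coboundary_def)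
  then show ?thesis using cochain_eval_chain_boundary[of \<phi> "Suc p" d] by simp
qed

lemma cochain_eval_homologous:
  assumes "\<phi> \<in> singular_cocycles p X" "homologous_rel p X {} z w"
  shows "cochain_eval \<phi> z = cochain_eval \<phi> w"
proof -
  obtain d where d: "singular_chain (Suc p) X d" "chain_boundary (Suc p) d = z - w"
    using assms(2) by (auto simp: homologous_rel_def singular_boundary)
  have "coboundary p X \<phi> = (\<lambda>s. 0)" using assms(1) by (simp add: singular_cocycles_def)
  then have "cochain_eval \<phi> (z - w) = 0"
    using cochain_eval_coboundary[OF d(1), of \<phi>] d(2) by (simp add: cochain_eval_def)
  then show ?thesis by (simp add: cochain_eval_diff)
qed

lemma homology_class_add:
  assumes "singular_relcycle p X S a" "singular_relcycle p X S b"
  shows "homologous_rel_set p X S a \<otimes>\<^bsub>relative_homology_group (int p) X S\<^esub> homologous_rel_set p X S b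
    = homologous_rel_set p X S (a + b)"
proof -
  have "(#>\<^bsub>relcycle_group p X S\<^esub>) (singular_relboundary_set p X S)
      \<in> hom (relcycle_group p X S) (relative_homology_group (int p) X S)"
    by (simp add: nontrivial_relative_homology_group normal.r_coset_hom_Mod
        normal_subgroup_singular_relboundary_relcycle)
  from hom_mult[OF this, of a b] show ?thesis
    using assms by (simp add: right_coset_singular_relboundary)
qed

lemma cochain_eval_add_fun: "cochain_eval (\<lambda>s. f s + g s) c = cochain_eval f c + cochain_eval g c"
  by (simp add: cochain_eval_def distrib_left sum.distrib)

lemma cochain_eval_scale_fun: "cochain_eval (\<lambda>s. k * f s) c = k * cochain_eval f c"
  by (simp add: cochain_eval_def sum_distrib_left mult.left_commute)

lemma cochain_eval_add: "cochain_eval \<phi> (a + b) = cochain_eval \<phi> a + cochain_eval \<phi> b"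
  using cochain_eval_diff[of \<phi> "a + b" b] by simp

text \<open>Universal coefficients; there is no Ext term over the rationals.\<close>

lemma rat_cohomology_dual:
  "module_isomorphic rat_field (rat_cohomology p X) (rat_dual (homology_group (int p) X))"
proof -
  let ?H = "homology_group (int p) X"
  let ?cl = "homologous_rel_set p X {}"
  \<comment> \<open>The Kronecker pairing of a cocycle with a homology class; \<open>Lcl\<close>
    removes the choice of the cycle, since cocycles vanish on boundaries.\<close>
  define L where "L \<phi> c = (if c \<in> carrier ?H then cochain_eval \<phi> (SOME z. z \<in> c) else 0)" for \<phi> c
  have car: "carrier ?H = ?cl ` singular_relcycle_set p X {}"
    by (rule carrier_relative_homology_group)
  have Lcl: "L \<phi> (?cl z) = cochain_eval \<phi> z" if z: "singular_relcycle p X {} z" and \<phi>: "\<phi> \<in> singular_cocycles p X" for \<phi> z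
  proof -
    have "z \<in> ?cl z" by (simp add: homologous_rel_refl)
    then have "(SOME w. w \<in> ?cl z) \<in> ?cl z" by (rule someI)
    then have "homologous_rel p X {} z (SOME w. w \<in> ?cl z)" by simp
    from cochain_eval_homologous[OF \<phi> this]
    show ?thesis using z unfolding L_def car by simp
  qed
  have 1: "L (\<lambda>s. f s + g s) = (\<lambda>c. L f c + L g c)" for f g
    by (auto simp: L_def fun_eq_iff cochain_eval_add_fun)
  have 2: "L (\<lambda>s. k * f s) = (\<lambda>c. k * L f c)" for f k
    by (auto simp: L_def fun_eq_iff cochain_eval_scale_fun)
  define D where "D = {h. (\<forall>x\<in>carrier ?H. \<forall>y\<in>carrier ?H. h (x \<otimes>\<^bsub>?H\<^esub> y) = h x + h y) \<and> (\<forall>x. x \<notin> carrier ?H \<longrightarrow> h x = (0::rat))}"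
  have cyc: "singular_relcycle p X {} z \<longleftrightarrow> singular_chain p X z \<and> chain_boundary p z = 0" for z
    by (rule singular_cycle)
  have "L \<phi> \<in> D" if \<phi>: "\<phi> \<in> singular_cocycles p X" for \<phi>
  proof -
    have "L \<phi> (?cl a \<otimes>\<^bsub>?H\<^esub> ?cl b) = L \<phi> (?cl a) + L \<phi> (?cl b)"
      if ab: "singular_relcycle p X {} a" "singular_relcycle p X {} b" for a b
      using homology_class_add[OF ab] Lcl[OF ab(1) \<phi>] Lcl[OF ab(2) \<phi>]
        Lcl[OF singular_relcycle_add[OF ab] \<phi>] by (simp add: cochain_eval_add)
    then show ?thesis
      unfolding D_def by (simp add: car) (simp add: L_def car)
  qed
  \<comment> \<open>Surjectivity: \<open>h\<close>, read on cycles, extends to all chains because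
    the rationals are injective. The resulting cochain is a cocycle because \<open>h\<close>
    vanishes on the class of a boundary.\<close>
  moreover have "\<exists>\<phi>\<in>singular_cocycles p X. L \<phi> = h" if h: "h \<in> D" for h
  proof -
    define A where "A = singular_relcycle_set p X {}"
    have A0: "0 \<in> A" by (simp add: A_def)
    have Ad: "x - y \<in> A" if "x \<in> A" "y \<in> A" for x y
      using that by (simp add: A_def singular_relcycle_diff)
    have hadd: "h (?cl (x + y)) = h (?cl x) + h (?cl y)" if "x \<in> A" "y \<in> A" for x y
      using h that homology_class_add[of p X "{}" x y] unfolding D_def car A_def by force
    have "h (?cl (x - y)) = h (?cl x) - h (?cl y)" if "x \<in> A" "y \<in> A" for x y
      using hadd[OF Ad[OF that] that(2)] by simp
    from extend_additive_map[OF A0 Ad this]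
    obtain \<psi> where \<psi>: "\<And>x y. \<psi> (x - y) = \<psi> x - \<psi> y" and \<psi>A: "\<And>x. x \<in> A \<Longrightarrow> \<psi> x = h (?cl x)"
      by blast
    define \<phi> where "\<phi> s = (if singular_simplex p X s then \<psi> (frag_of s) else 0)" for s
    have ev: "cochain_eval \<phi> c = \<psi> c" if "singular_chain p X c" for c
      unfolding \<phi>_def by (rule cochain_eval_additive_extension[OF \<psi> that])
    have h0: "h (?cl 0) = 0" using hadd[OF A0 A0] by simp
    have "coboundary p X \<phi> s = 0" for s
    proof (cases "singular_simplex (Suc p) X s")
      case True
      define b where "b = chain_boundary (Suc p) (frag_of s)"
      have sc: "singular_chain (Suc p) X (frag_of s)" using True by (simp add: singular_chain_of)
      then have "singular_relboundary p X {} b" by (auto simp: singular_boundary b_def)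
      then have bA: "b \<in> A" and "homologous_rel p X {} b 0"
        by (simp_all add: A_def singular_relboundary_imp_relcycle homologous_rel_def)
      then have "?cl b = ?cl 0" by (simp only: homologous_rel_set_eq)
      have "singular_chain p X b" using bA by (simp add: A_def cyc)
      then have "coboundary p X \<phi> s = \<psi> b" using True ev by (simp add: coboundary_def b_def)
      then show ?thesis using \<psi>A[OF bA] \<open>?cl b = ?cl 0\<close> h0 by simp
    qed (simp add: coboundary_def)
    then have \<phi>: "\<phi> \<in> singular_cocycles p X"
      by (auto simp: singular_cocycles_def singular_cochains_def \<phi>_def)
    have "L \<phi> c = h c" for c
    proof (cases "c \<in> carrier ?H")
      case True
      then obtain z where z: "singular_relcycle p X {} z" "c = ?cl z" by (auto simp: car)
      then show ?thesis using Lcl[OF z(1) \<phi>] ev[of z] \<psi>A[of z] by (simp add: A_def cyc)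
    next
      case False
      then show ?thesis using h by (simp add: L_def D_def)
    qed
    then show ?thesis using \<phi> by blast
  qed
  ultimately have im: "L ` singular_cocycles p X = D" by blast
  have ker: "L \<phi> = (\<lambda>s. 0) \<longleftrightarrow> \<phi> \<in> singular_coboundaries p X" if \<phi>: "\<phi> \<in> singular_cocycles p X" for \<phi>
  proof
    assume \<phi>b: "\<phi> \<in> singular_coboundaries p X"
    have ev0: "cochain_eval \<phi> z = 0" if z: "singular_relcycle p X {} z" for z
    proof (cases p)
      case 0
      then show ?thesis using \<phi>b by (simp add: singular_coboundaries_def cochain_eval_def)
    next
      case (Suc q)
      then obtain \<eta> where "\<phi> = coboundary q X \<eta>" using \<phi>b by (auto simp: singular_coboundaries_def)
      then show ?thesis
        using cochain_eval_coboundary[of q X z \<eta>] z[unfolded cyc] by (simp add: Suc cochain_eval_0)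
    qed
    then have "L \<phi> c = 0" for c
    proof (cases "c \<in> carrier ?H")
      case True
      then obtain z where z: "singular_relcycle p X {} z" "c = ?cl z" by (auto simp: car)
      then show ?thesis using Lcl[OF z(1) \<phi>] ev0[OF z(1)] by simp
    qed (simp add: L_def)
    then show "L \<phi> = (\<lambda>s. 0)" by blast
  next
    assume L0: "L \<phi> = (\<lambda>s. 0)"
    have z0: "cochain_eval \<phi> z = 0" if "singular_relcycle p X {} z" for z
      using Lcl[OF that \<phi>] L0 by simp
    have \<phi>c: "\<phi> \<in> singular_cochains p X" using \<phi> by (simp add: singular_cocycles_def)
    show "\<phi> \<in> singular_coboundaries p X"
    proof (cases p)
      case 0
      \<comment> \<open>In degree 0 every simplex is a cycle, and 0 is the only coboundary.\<close>
      have "\<phi> s = 0" for s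
      proof (rule ccontr)
        assume "\<phi> s \<noteq> 0"
        then have "singular_chain p X (frag_of s)" using \<phi>c by (simp add: singular_cochains_def singular_chain_of)
        moreover have "chain_boundary p (frag_of s) = 0" by (simp add: 0 chain_boundary_def)
        ultimately have "singular_relcycle p X {} (frag_of s)" by (simp only: cyc)
        then show False using z0[of "frag_of s"] \<open>\<phi> s \<noteq> 0\<close> by (simp add: cochain_eval_frag_of)
      qed
      then show ?thesis by (auto simp: 0 singular_coboundaries_def)
    next
      case (Suc q)
      define A where "A = chain_boundary p ` singular_chain_set p X"
      \<comment> \<open>Since \<open>\<phi>\<close> vanishes on cycles, its value on
        \<open>c\<close> depends only on the boundary of \<open>c\<close>. This defines
        \<open>\<theta>\<close> on boundaries; an extension to all chains gives a cochain of degree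
        \<open>q\<close> with coboundary \<open>\<phi>\<close>.\<close>
      define \<theta> where "\<theta> b = cochain_eval \<phi> (SOME c. singular_chain p X c \<and> chain_boundary p c = b)" for b
      have \<theta>: "\<theta> (chain_boundary p c) = cochain_eval \<phi> c" if c: "singular_chain p X c" for c
      proof -
        define d where "d = (SOME d. singular_chain p X d \<and> chain_boundary p d = chain_boundary p c)"
        have "singular_chain p X d \<and> chain_boundary p d = chain_boundary p c"
          unfolding d_def by (rule someI[of _ c]) (simp add: c)
        then have "singular_relcycle p X {} (d - c)"
          using c by (simp add: cyc chain_boundary_diff singular_chain_diff)
        from z0[OF this] show ?thesis by (simp add: \<theta>_def d_def cochain_eval_diff)
      qed
      have A0: "0 \<in> A" unfolding A_def by (rule image_eqI[of _ _ 0]) auto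
      have Ad: "x - y \<in> A" and \<theta>d: "\<theta> (x - y) = \<theta> x - \<theta> y" if x: "x \<in> A" and y: "y \<in> A" for x y
      proof -
        obtain c d where c: "singular_chain p X c" "x = chain_boundary p c"
          and d: "singular_chain p X d" "y = chain_boundary p d" using x y by (auto simp: A_def)
        have cd: "singular_chain p X (c - d)" using c d by (simp add: singular_chain_diff)
        have xy: "x - y = chain_boundary p (c - d)" using c d by (simp add: chain_boundary_diff)
        show "x - y \<in> A" unfolding xy A_def using cd by blast
        show "\<theta> (x - y) = \<theta> x - \<theta> y"
          unfolding xy \<theta>[OF cd] using \<theta>[OF c(1)] \<theta>[OF d(1)] c d by (simp add: cochain_eval_diff)
      qed
      from extend_additive_map[OF A0 Ad \<theta>d]
      obtain \<psi> where \<psi>: "\<And>x y. \<psi> (x - y) = \<psi> x - \<psi> y" and \<psi>A: "\<And>x. x \<in> A \<Longrightarrow> \<psi> x = \<theta> x"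
        by blast
      define \<eta> where "\<eta> s = (if singular_simplex q X s then \<psi> (frag_of s) else 0)" for s
      have ev: "cochain_eval \<eta> c = \<psi> c" if "singular_chain q X c" for c
        unfolding \<eta>_def by (rule cochain_eval_additive_extension[OF \<psi> that])
      have "\<phi> s = coboundary q X \<eta> s" for s
      proof (cases "singular_simplex p X s")
        case True
        define b where "b = chain_boundary p (frag_of s)"
        have sc: "singular_chain p X (frag_of s)" using True by (simp add: singular_chain_of)
        have "singular_chain q X b"
          using singular_chain_boundary[OF sc] by (simp add: b_def Suc)
        then have "coboundary q X \<eta> s = \<psi> b"
          using True ev[of b] by (simp add: coboundary_def b_def Suc)
        also have "\<dots> = \<theta> b" using sc by (intro \<psi>A) (auto simp: A_def b_def)
        also have "\<dots> = \<phi> s" unfolding b_def \<theta>[OF sc] by (simp add: cochain_eval_frag_of)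
        finally show ?thesis by simp
      next
        case False
        then have "\<phi> s = 0" using \<phi>c by (auto simp: singular_cochains_def)
        then show ?thesis using False by (simp add: coboundary_def Suc)
      qed
      then have "\<phi> = coboundary q X \<eta>" by blast
      moreover have "\<eta> \<in> singular_cochains q X" by (simp add: singular_cochains_def \<eta>_def)
      ultimately show ?thesis by (auto simp: singular_coboundaries_def Suc)
    qed
  qed
  show ?thesis
    unfolding rat_cohomology_def rat_dual_def D_def[symmetric]
  proof (rule quotient_module_isomorphic[where L = L])
    show "module rat_field (pointwise_module (singular_cocycles p X))" by (rule module_cocycles)
    show "submodule (singular_coboundaries p X) rat_field (pointwise_module (singular_cocycles p X))"
      by (rule submodule_coboundaries)
  qed (simp_all add: pointwise_module_def 1 2 im ker)
qed

section \<open>Tensor products with lines\<close>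

lemma rat_field_simps [simp]:
  "c \<in> carrier rat_field" "c \<oplus>\<^bsub>rat_field\<^esub> d = c + d" "c \<otimes>\<^bsub>rat_field\<^esub> d = c * d"
  "\<zero>\<^bsub>rat_field\<^esub> = 0" "\<one>\<^bsub>rat_field\<^esub> = 1"
  by (simp_all add: rat_field_def)

lemma free_module_simps:
  "carrier (free_module A) = {f. finite {x. f x \<noteq> 0} \<and> {x. f x \<noteq> 0} \<subseteq> A}"
  "f \<oplus>\<^bsub>free_module A\<^esub> g = (\<lambda>x. f x + g x)" "c \<odot>\<^bsub>free_module A\<^esub> f = (\<lambda>x. c * f x)"
  "\<zero>\<^bsub>free_module A\<^esub> = (\<lambda>x. 0)"
  by (simp_all add: free_module_def pointwise_module_def)

lemma bilinear_relations_carrier: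
  assumes "module rat_field V" "module rat_field W"
  shows "bilinear_relations V W \<subseteq> carrier (free_module (carrier V \<times> carrier W))"
proof -
  interpret V: module rat_field V by fact
  interpret W: module rat_field W by fact
  have fin: "f \<in> carrier (free_module A)"
    if "{x. f x \<noteq> 0} \<subseteq> B" "finite B" "B \<subseteq> A" for f and A B :: "('a \<times> 'b) set"
    using that finite_subset[of "{x. f x \<noteq> 0}" B] by (auto simp: free_module_simps)
  show ?thesis
    unfolding bilinear_relations_def
  proof (safe, goal_cases)
    case (1 _ v v' w)
    then show ?case
      by (intro fin[where B = "{(v \<oplus>\<^bsub>V\<^esub> v', w), (v, w), (v', w)}"]) (auto simp: basis_vec_def)
  next
    case (2 _ v w w')
    then show ?case
      by (intro fin[where B = "{(v, w \<oplus>\<^bsub>W\<^esub> w'), (v, w), (v, w')}"]) (auto simp: basis_vec_def)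
  next
    case (3 _ k v w)
    then show ?case
      by (intro fin[where B = "{(k \<odot>\<^bsub>V\<^esub> v, w), (v, w)}"]) (auto simp: basis_vec_def)
  next
    case (4 _ k v w)
    then show ?case
      by (intro fin[where B = "{(v, k \<odot>\<^bsub>W\<^esub> w), (v, w)}"]) (auto simp: basis_vec_def)
  qed
qed

context
  fixes V :: "(rat, 'a) module" and W :: "(rat, 'b) module"
  assumes V: "module rat_field V" and W: "module rat_field W"
begin

interpretation V: module rat_field V by (rule V)
interpretation W: module rat_field W by (rule W)

abbreviation (input) "tfree \<equiv> free_module (carrier V \<times> carrier W)"
abbreviation (input) "tspan \<equiv> submodule_span rat_field tfree (bilinear_relations V W)"

lemma submodule_tspan: "submodule tspan rat_field tfree"
  by (intro submodule_submodule_span module_free bilinear_relations_carrier V W)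

lemma tspan_add: "f \<in> tspan \<Longrightarrow> g \<in> tspan \<Longrightarrow> (\<lambda>x. f x + g x) \<in> tspan"
  using module.submoduleE(5)[OF module_free submodule_tspan, of f g] by (simp add: free_module_simps)

lemma tspan_scale: "f \<in> tspan \<Longrightarrow> (\<lambda>x. c * f x) \<in> tspan"
  using module.submoduleE(4)[OF module_free submodule_tspan, of c f] by (simp add: free_module_simps)

lemma tspan_relations: "f \<in> bilinear_relations V W \<Longrightarrow> f \<in> tspan"
  by (auto simp: submodule_span_def)

lemma tspan_add_left:
  assumes "v \<in> carrier V" "v' \<in> carrier V" "w \<in> carrier W"
  shows "(\<lambda>x. basis_vec (v \<oplus>\<^bsub>V\<^esub> v', w) x - basis_vec (v, w) x - basis_vec (v', w) x) \<in> tspan"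
  using assms by (intro tspan_relations) (unfold bilinear_relations_def, blast)

lemma tspan_smult_left:
  assumes "v \<in> carrier V" "w \<in> carrier W"
  shows "(\<lambda>x. basis_vec (c \<odot>\<^bsub>V\<^esub> v, w) x - c * basis_vec (v, w) x) \<in> tspan"
  using assms by (intro tspan_relations) (unfold bilinear_relations_def, blast)

lemma tspan_smult_right:
  assumes "v \<in> carrier V" "w \<in> carrier W"
  shows "(\<lambda>x. basis_vec (v, c \<odot>\<^bsub>W\<^esub> w) x - c * basis_vec (v, w) x) \<in> tspan"
  using assms by (intro tspan_relations) (unfold bilinear_relations_def, blast)

lemma tspan_zero: "w \<in> carrier W \<Longrightarrow> basis_vec (\<zero>\<^bsub>V\<^esub>, w) \<in> tspan"
  using tspan_smult_left[of "\<zero>\<^bsub>V\<^esub>" w 0] V.smult_r_null[of 0] by simp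

text \<open>Coefficients and the scalars \<open>\<kappa> w\<close> move into the first factor, so
  that modulo the relations a formal sum collapses to one tensor with second factor
  \<open>w0\<close>. One support point is absorbed at a time.\<close>

lemma tspan_reduce:
  assumes w0: "w0 \<in> carrier W" and \<kappa>: "\<And>w. w \<in> carrier W \<Longrightarrow> w = \<kappa> w \<odot>\<^bsub>W\<^esub> w0"
    and f: "f \<in> carrier tfree"
  shows "\<exists>v\<in>carrier V. (\<lambda>x. f x - basis_vec (v, w0) x) \<in> tspan"
proof -
  have "finite S \<Longrightarrow> S \<subseteq> carrier V \<times> carrier W \<Longrightarrow> {x. f x \<noteq> 0} \<subseteq> S \<Longrightarrow>
      \<exists>v\<in>carrier V. (\<lambda>x. f x - basis_vec (v, w0) x) \<in> tspan" for S and f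
  proof (induction S arbitrary: f rule: finite_induct)
    case empty
    then have "f x = 0" for x by blast
    then show ?case
      using tspan_scale[OF tspan_zero[OF w0], of "-1"] by (intro bexI[of _ "\<zero>\<^bsub>V\<^esub>"]) simp_all
  next
    case (insert z S)
    obtain v w where z: "z = (v, w)" by (rule prod.exhaust)
    have v: "v \<in> carrier V" and w: "w \<in> carrier W" using insert.prems(1) z by auto
    define g where "g = f(z := 0)"
    have "{x. g x \<noteq> 0} \<subseteq> S" using insert.prems(2) by (auto simp: g_def)
    then obtain v' where v': "v' \<in> carrier V" and g: "(\<lambda>x. g x - basis_vec (v', w0) x) \<in> tspan"
      using insert.IH[of g] insert.prems(1) by auto
    define c where "c = f z"
    define u where "u = (c * \<kappa> w) \<odot>\<^bsub>V\<^esub> v"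
    have u: "u \<in> carrier V" using v by (simp add: u_def)
    have 1: "(\<lambda>x. basis_vec (v, w) x - \<kappa> w * basis_vec (v, w0) x) \<in> tspan"
      using tspan_smult_right[OF v w0, of "\<kappa> w"] \<kappa>[OF w] by simp
    have 2: "(\<lambda>x. basis_vec (u, w0) x - (c * \<kappa> w) * basis_vec (v, w0) x) \<in> tspan"
      unfolding u_def by (rule tspan_smult_left[OF v w0])
    have 3: "(\<lambda>x. basis_vec (v' \<oplus>\<^bsub>V\<^esub> u, w0) x - basis_vec (v', w0) x - basis_vec (u, w0) x) \<in> tspan"
      by (rule tspan_add_left[OF v' u w0])
    have fz: "f x = g x + c * basis_vec (v, w) x" for x
      by (simp add: g_def c_def basis_vec_def z)
    have eq: "(\<lambda>x. f x - basis_vec (v' \<oplus>\<^bsub>V\<^esub> u, w0) x) =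
      (\<lambda>x. ((g x - basis_vec (v', w0) x) + c * (basis_vec (v, w) x - \<kappa> w * basis_vec (v, w0) x))
        + (-1) * ((basis_vec (u, w0) x - (c * \<kappa> w) * basis_vec (v, w0) x)
        + (basis_vec (v' \<oplus>\<^bsub>V\<^esub> u, w0) x - basis_vec (v', w0) x - basis_vec (u, w0) x)))"
      by (rule ext) (simp add: fz algebra_simps)
    have "(\<lambda>x. f x - basis_vec (v' \<oplus>\<^bsub>V\<^esub> u, w0) x) \<in> tspan"
      unfolding eq by (intro tspan_add tspan_scale g 1 2 3)
    then show ?case using v' u by (intro bexI[of _ "v' \<oplus>\<^bsub>V\<^esub> u"]) auto
  qed
  then show ?thesis using f by (auto simp: free_module_simps)
qed

lemma tensor_module_trivial:
  assumes "carrier W = {\<zero>\<^bsub>W\<^esub>}"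
  shows "card (carrier (tensor_module V W)) = 1"
proof -
  interpret N: submodule tspan rat_field tfree by (rule submodule_tspan)
  interpret F: module rat_field tfree by (rule module_free)
  interpret abelian_subgroup tspan tfree
    by (rule abelian_subgroupI3) (auto intro: additive_subgroup.intro N.subgroup_axioms F.abelian_group_axioms)
  have w0: "\<zero>\<^bsub>W\<^esub> \<in> carrier W" by simp
  have "f \<in> tspan" if f: "f \<in> carrier tfree" for f
  proof -
    \<comment> \<open>The zero vector generates \<open>W\<close> with all coordinates 0, and tensors
      with it are themselves relations.\<close>
    obtain v where v: "v \<in> carrier V" "(\<lambda>x. f x - basis_vec (v, \<zero>\<^bsub>W\<^esub>) x) \<in> tspan"
      using tspan_reduce[OF w0 _ f, of "\<lambda>_. 0"] assms by auto
    have "basis_vec (v, \<zero>\<^bsub>W\<^esub>) \<in> tspan"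
      using tspan_smult_right[OF v(1) w0, of 0] W.smult_r_null[of 0] by simp
    from tspan_add[OF v(2) this] show ?thesis by simp
  qed
  then have "tspan = carrier tfree" using a_subset by blast
  then have "carrier (tensor_module V W) = {tspan}"
    unfolding tensor_module_def Let_def quotient_module_def
    using a_rcos_const a_rcos_self by (auto simp: A_RCOSETS_def' intro!: bexI[of _ "\<zero>\<^bsub>tfree\<^esub>"])
  then show ?thesis by simp
qed

text \<open>\<open>\<kappa>\<close> is the coordinate on the line spanned by \<open>w0\<close>. The
  isomorphism sends the tensor of \<open>v\<close> and \<open>w\<close> to \<open>\<kappa> w\<close>
  times the image of \<open>v\<close>; by \<open>tspan_reduce\<close> nothing beyond the relations
  is lost.\<close>

lemma tensor_module_line:
  fixes D :: "('c \<Rightarrow> rat) set"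
  assumes iso: "module_isomorphic rat_field V (pointwise_module D)"
    and w0: "w0 \<in> carrier W" and \<kappa>: "\<And>w. w \<in> carrier W \<Longrightarrow> w = \<kappa> w \<odot>\<^bsub>W\<^esub> w0"
    and \<kappa>0: "\<kappa> w0 = 1"
    and \<kappa>add: "\<And>w w'. w \<in> carrier W \<Longrightarrow> w' \<in> carrier W \<Longrightarrow> \<kappa> (w \<oplus>\<^bsub>W\<^esub> w') = \<kappa> w + \<kappa> w'"
    and \<kappa>smult: "\<And>c w. w \<in> carrier W \<Longrightarrow> \<kappa> (c \<odot>\<^bsub>W\<^esub> w) = c * \<kappa> w"
  shows "module_isomorphic rat_field (tensor_module V W) (pointwise_module D)"
proof -
  obtain l where "bij_betw l (carrier V) (carrier (pointwise_module D))"
     "\<forall>x\<in>carrier V. \<forall>y\<in>carrier V. l (x \<oplus>\<^bsub>V\<^esub> y) = l x \<oplus>\<^bsub>pointwise_module D\<^esub> l y"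
     "\<forall>c\<in>carrier rat_field. \<forall>x\<in>carrier V. l (c \<odot>\<^bsub>V\<^esub> x) = c \<odot>\<^bsub>pointwise_module D\<^esub> l x"
    using iso by (rule module_isomorphicE)
  then have l: "bij_betw l (carrier V) D"
    and ladd: "\<And>x y. x \<in> carrier V \<Longrightarrow> y \<in> carrier V \<Longrightarrow> l (x \<oplus>\<^bsub>V\<^esub> y) = (\<lambda>s. l x s + l y s)"
    and lsmult: "\<And>c x. x \<in> carrier V \<Longrightarrow> l (c \<odot>\<^bsub>V\<^esub> x) = (\<lambda>s. c * l x s)"
    by (simp_all add: pointwise_module_def)
  define L where "L f s = (\<Sum>z | f z \<noteq> 0. f z * \<kappa> (snd z) * l (fst z) s)" for f :: "'a \<times> 'b \<Rightarrow> rat" and s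
  have L: "L f s = (\<Sum>z\<in>K. f z * \<kappa> (snd z) * l (fst z) s)" if "finite K" "{z. f z \<noteq> 0} \<subseteq> K" for f s K
    unfolding L_def using that by (intro sum.mono_neutral_left) auto
  have fin: "finite {z. f z \<noteq> 0}" if "f \<in> carrier tfree" for f
    using that by (simp add: free_module_simps)
  have Lsub: "L (\<lambda>x. f x - k * g x) = (\<lambda>s. L f s - k * L g s)" if f: "finite {z. f z \<noteq> 0}" and g: "finite {z. g z \<noteq> 0}" for f g k
  proof
    fix s
    let ?K = "{z. f z \<noteq> 0} \<union> {z. g z \<noteq> 0}"
    have "L (\<lambda>x. f x - k * g x) s = (\<Sum>z\<in>?K. (f z - k * g z) * \<kappa> (snd z) * l (fst z) s)"
      using f g by (intro L) auto
    also have "\<dots> = (\<Sum>z\<in>?K. f z * \<kappa> (snd z) * l (fst z) s) - k * (\<Sum>z\<in>?K. g z * \<kappa> (snd z) * l (fst z) s)"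
      by (simp add: sum_subtractf sum_distrib_left algebra_simps)
    also have "\<dots> = L f s - k * L g s"
      using L[of ?K f s] L[of ?K g s] f g by simp
    finally show "L (\<lambda>x. f x - k * g x) s = L f s - k * L g s" .
  qed
  have finb: "finite {z. basis_vec a z \<noteq> 0}" for a :: "'a \<times> 'b"
    by (rule finite_subset[of _ "{a}"]) (auto simp: basis_vec_def)
  have finb2: "finite {z. basis_vec a z - k * basis_vec b z \<noteq> 0}" for a b :: "'a \<times> 'b" and k
    by (rule finite_subset[of _ "{a, b}"]) (auto simp: basis_vec_def)
  have Lb: "L (basis_vec (v, w)) = (\<lambda>s. \<kappa> w * l v s)" for v w
    using L[of "{(v, w)}" "basis_vec (v, w)"] by (auto simp: basis_vec_def)
  have Lb2: "L (\<lambda>x. basis_vec (v, w) x - k * basis_vec (v', w') x) = (\<lambda>s. \<kappa> w * l v s - k * (\<kappa> w' * l v' s))" for v w v' w' k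
    using Lsub[OF finb[of "(v, w)"] finb[of "(v', w')"], of k] by (simp add: Lb)
  have Lb3: "L (\<lambda>x. basis_vec (v, w) x - basis_vec (v', w') x - basis_vec (v'', w'') x)
      = (\<lambda>s. \<kappa> w * l v s - \<kappa> w' * l v' s - \<kappa> w'' * l v'' s)" for v w v' w' v'' w''
    using Lsub[OF finb2[of "(v, w)" 1 "(v', w')"] finb[of "(v'', w'')"], of 1] Lb2[of v w 1 v' w'] by (simp add: Lb)
  have Lrel: "L f = (\<lambda>s. 0)" if f: "f \<in> bilinear_relations V W" for f
    using f unfolding bilinear_relations_def
    by (elim UnE; clarsimp simp: Lb3 Lb2 ladd lsmult \<kappa>add \<kappa>smult; simp add: algebra_simps)
  have Ladd: "L (\<lambda>x. f x + g x) = (\<lambda>s. L f s + L g s)" if "f \<in> carrier tfree" "g \<in> carrier tfree" for f g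
    using Lsub[OF fin fin, OF that, of "-1"] by simp
  have Lsmult: "L (\<lambda>x. c * f x) = (\<lambda>s. c * L f s)" if "f \<in> carrier tfree" for f c
  proof -
    have L0: "L (\<lambda>x. 0) = (\<lambda>s. 0)" by (simp add: L_def fun_eq_iff)
    show ?thesis
      using Lsub[of "\<lambda>x. 0" f "- c"] fin[OF that] by (simp add: L0)
  qed
  \<comment> \<open>The kernel of \<open>L\<close> is a submodule containing the defining relations,
    hence it contains their span.\<close>
  let ?K = "{f \<in> carrier tfree. L f = (\<lambda>s. 0)}"
  have "submodule ?K rat_field tfree"
  proof (rule module.submoduleI[OF module_free])
    have "L (\<lambda>x. 0) = (\<lambda>s. 0)" by (simp add: L_def fun_eq_iff)
    then show "\<zero>\<^bsub>tfree\<^esub> \<in> ?K" by (simp add: free_module_simps)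
    interpret F: module rat_field tfree by (rule module_free)
    have neg: "\<ominus>\<^bsub>tfree\<^esub> f = (\<lambda>x. (-1) * f x)" if "f \<in> carrier tfree" for f
      by (rule F.minus_equality) (use that in \<open>auto simp: free_module_simps\<close>)
    show "\<ominus>\<^bsub>tfree\<^esub> f \<in> ?K" if "f \<in> ?K" for f
      using that F.a_inv_closed[of f] neg[of f] Lsmult[of f "-1"] by simp
    show "f \<oplus>\<^bsub>tfree\<^esub> g \<in> ?K" if "f \<in> ?K" "g \<in> ?K" for f g
      using that F.add.m_closed[of f g] Ladd[of f g] by (simp add: free_module_simps(2))
    show "c \<odot>\<^bsub>tfree\<^esub> f \<in> ?K" if "c \<in> carrier rat_field" "f \<in> ?K" for c f
      using that F.smult_closed[of c f] Lsmult[of f c] by (simp add: free_module_simps(3))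
  qed auto
  moreover have "bilinear_relations V W \<subseteq> ?K"
    using Lrel bilinear_relations_carrier[OF V W] by blast
  ultimately have sub: "tspan \<subseteq> ?K"
    unfolding submodule_span_def by blast
  \<comment> \<open>Modulo the relations \<open>f\<close> is one tensor of \<open>v\<close> and
    \<open>w0\<close>, and \<open>\<kappa> w0 = 1\<close> turns the vanishing of \<open>L f\<close>
    into that of \<open>l v\<close>.\<close>
  have ker: "f \<in> tspan" if f: "f \<in> carrier tfree" and L0: "L f = (\<lambda>s. 0)" for f
  proof -
    obtain v where v: "v \<in> carrier V" and fv: "(\<lambda>x. f x - basis_vec (v, w0) x) \<in> tspan"
      using tspan_reduce[OF w0 \<kappa> f] by blast
    have "L (\<lambda>x. f x - 1 * basis_vec (v, w0) x) = (\<lambda>s. 0)" using sub fv by auto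
    then have "l v = (\<lambda>s. 0)"
      unfolding Lsub[OF fin[OF f] finb] L0 Lb \<kappa>0 by (simp add: fun_eq_iff)
    moreover have "l \<zero>\<^bsub>V\<^esub> = (\<lambda>s. 0)" using lsmult[of "\<zero>\<^bsub>V\<^esub>" 0] V.smult_r_null[of 0] by simp
    ultimately have "v = \<zero>\<^bsub>V\<^esub>" using l v by (auto simp: bij_betw_def inj_on_def)
    then show ?thesis using tspan_add[OF fv tspan_zero[OF w0]] by simp
  qed
  have im: "L ` carrier tfree = D"
  proof
    show "L ` carrier tfree \<subseteq> D"
    proof
      fix d assume "d \<in> L ` carrier tfree"
      then obtain f where f: "f \<in> carrier tfree" "d = L f" by blast
      obtain v where v: "v \<in> carrier V" and fv: "(\<lambda>x. f x - basis_vec (v, w0) x) \<in> tspan"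
        using tspan_reduce[OF w0 \<kappa> f(1)] by blast
      have "L (\<lambda>x. f x - 1 * basis_vec (v, w0) x) = (\<lambda>s. 0)" using sub fv by auto
      then have "L f = l v"
        unfolding Lsub[OF fin[OF f(1)] finb] Lb \<kappa>0 by (simp add: fun_eq_iff)
      then show "d \<in> D" using l v f by (auto simp: bij_betw_def)
    qed
    show "D \<subseteq> L ` carrier tfree"
    proof
      fix d assume "d \<in> D"
      then obtain v where v: "v \<in> carrier V" "d = l v" using l by (auto simp: bij_betw_def)
      have "basis_vec (v, w0) \<in> carrier tfree"
        using v(1) w0 finb by (auto simp: free_module_simps basis_vec_def)
      moreover have "L (basis_vec (v, w0)) = d" by (simp add: Lb \<kappa>0 v)
      ultimately show "d \<in> L ` carrier tfree" by blast
    qed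
  qed
  show ?thesis
    unfolding tensor_module_def Let_def
  proof (rule quotient_module_isomorphic[where L = L, OF module_free submodule_tspan])
    show "L f = (\<lambda>s. 0) \<longleftrightarrow> f \<in> tspan" if "f \<in> carrier tfree" for f
      using that sub ker by blast
  qed (simp_all add: Ladd Lsmult im free_module_simps(2,3))
qed

end

section \<open>Duals of groups and finite direct sums\<close>

lemma rat_dual_carrier:
  "h \<in> carrier (rat_dual G) \<longleftrightarrow>
    (\<forall>x\<in>carrier G. \<forall>y\<in>carrier G. h (x \<otimes>\<^bsub>G\<^esub> y) = h x + h y) \<and> (\<forall>x. x \<notin> carrier G \<longrightarrow> h x = 0)"
  by (simp add: rat_dual_def pointwise_module_def)

lemma rat_dual_ops:
  "g \<oplus>\<^bsub>rat_dual G\<^esub> h = (\<lambda>x. g x + h x)" "c \<odot>\<^bsub>rat_dual G\<^esub> h = (\<lambda>x. c * h x)"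
  by (simp_all add: rat_dual_def pointwise_module_def)

lemma rat_dual_one:
  assumes "group G" "h \<in> carrier (rat_dual G)"
  shows "h \<one>\<^bsub>G\<^esub> = 0"
proof -
  interpret group G by fact
  have "h (\<one>\<^bsub>G\<^esub> \<otimes>\<^bsub>G\<^esub> \<one>\<^bsub>G\<^esub>) = h \<one>\<^bsub>G\<^esub> + h \<one>\<^bsub>G\<^esub>"
    using assms(2) one_closed unfolding rat_dual_carrier by blast
  then show ?thesis by simp
qed

lemma rat_dual_isomorphic:
  assumes "group G" "group G'" "G \<cong> G'"
  shows "module_isomorphic rat_field (rat_dual G) (rat_dual G')"
proof -
  obtain f where f: "f \<in> iso G G'" using assms(3) by (auto simp: is_iso_def)
  define g where "g = inv_into (carrier G) f"
  have g: "g \<in> iso G' G" unfolding g_def using group.iso_set_sym[OF assms(1) f] .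
  have fm: "f (x \<otimes>\<^bsub>G\<^esub> y) = f x \<otimes>\<^bsub>G'\<^esub> f y" if "x \<in> carrier G" "y \<in> carrier G" for x y
    using f that by (auto simp: iso_def hom_def)
  have fc: "f x \<in> carrier G'" if "x \<in> carrier G" for x
    using f that by (auto simp: iso_def hom_def)
  have gm: "g (x \<otimes>\<^bsub>G'\<^esub> y) = g x \<otimes>\<^bsub>G\<^esub> g y" if "x \<in> carrier G'" "y \<in> carrier G'" for x y
    using g that by (auto simp: iso_def hom_def)
  have gc: "g x \<in> carrier G" if "x \<in> carrier G'" for x
    using g that by (auto simp: iso_def hom_def)
  have fg: "f (g y) = y" if "y \<in> carrier G'" for y
    unfolding g_def using f that by (intro f_inv_into_f) (auto simp: iso_def bij_betw_def)
  have gf: "g (f x) = x" if "x \<in> carrier G" for x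
    unfolding g_def using f that by (intro inv_into_f_f) (auto simp: iso_def bij_betw_def)
  interpret G: group G by fact
  interpret G': group G' by fact
  define T where "T h y = (if y \<in> carrier G' then h (g y) else 0)" for h :: "'a \<Rightarrow> rat" and y
  define T' where "T' h x = (if x \<in> carrier G then h (f x) else 0)" for h :: "'b \<Rightarrow> rat" and x
  have "bij_betw T (carrier (rat_dual G)) (carrier (rat_dual G'))"
  proof (rule bij_betw_byWitness[where f' = T'])
    show "\<forall>h\<in>carrier (rat_dual G). T' (T h) = h"
      by (auto simp: T_def T'_def rat_dual_carrier fun_eq_iff fc gf)
    show "\<forall>h\<in>carrier (rat_dual G'). T (T' h) = h"
      by (auto simp: T_def T'_def rat_dual_carrier fun_eq_iff gc fg)
    show "T ` carrier (rat_dual G) \<subseteq> carrier (rat_dual G')"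
      by (auto simp: T_def rat_dual_carrier gm gc)
    show "T' ` carrier (rat_dual G') \<subseteq> carrier (rat_dual G)"
      by (auto simp: T'_def rat_dual_carrier fm fc)
  qed
  then show ?thesis
    unfolding module_isomorphic_def rat_dual_ops
    by (intro exI[of _ T]) (auto simp: T_def)
qed

lemma rat_dual_trivial:
  assumes "trivial_group G"
  shows "carrier (rat_dual G) = {\<lambda>x. 0}"
proof -
  have G: "group G" "carrier G = {\<one>\<^bsub>G\<^esub>}"
    using assms by (auto simp: trivial_group_def)
  interpret group G by (rule G)
  have "h x = 0" if h: "h \<in> carrier (rat_dual G)" for h x
    using rat_dual_one[OF G(1) h] h G(2) by (cases "x = \<one>\<^bsub>G\<^esub>") (auto simp: rat_dual_carrier)
  then have "carrier (rat_dual G) \<subseteq> {\<lambda>x. 0}" by blast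
  moreover have "(\<lambda>x. 0) \<in> carrier (rat_dual G)" by (simp add: rat_dual_carrier)
  ultimately show ?thesis by blast
qed

lemma additive_int_rat:
  fixes g :: "int \<Rightarrow> rat"
  assumes "\<And>m n. g (m + n) = g m + g n"
  shows "g n = of_int n * g 1"
proof -
  have g0: "g 0 = 0" using assms[of 0 0] by simp
  have neg: "g (- m) = - g m" for m using assms[of m "- m"] g0 by simp
  have nat: "g (int k) = of_nat k * g 1" for k
    by (induction k) (simp_all add: g0 assms algebra_simps)
  show ?thesis
    by (cases n rule: int_cases2) (simp_all add: nat neg)
qed

text \<open>A homomorphism from the integers to the rationals is its value at 1 times the inclusion.
  Hence \<open>W\<close> is a line, with that value as coordinate \<open>\<kappa>\<close> and with
  the preimage \<open>w0\<close> of the inclusion as basis.\<close>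

lemma tensor_rat_dual_integer:
  fixes D :: "('c \<Rightarrow> rat) set"
  assumes V: "module rat_field V" and W: "module rat_field W"
    and VD: "module_isomorphic rat_field V (pointwise_module D)"
    and WZ: "module_isomorphic rat_field W (rat_dual integer_group)"
  shows "module_isomorphic rat_field (tensor_module V W) (pointwise_module D)"
proof -
  interpret W: module rat_field W by (rule W)
  obtain h where h: "bij_betw h (carrier W) (carrier (rat_dual integer_group))"
     and hadd: "\<forall>x\<in>carrier W. \<forall>y\<in>carrier W. h (x \<oplus>\<^bsub>W\<^esub> y) = h x \<oplus>\<^bsub>rat_dual integer_group\<^esub> h y"
     and hsm: "\<forall>c\<in>carrier rat_field. \<forall>x\<in>carrier W. h (c \<odot>\<^bsub>W\<^esub> x) = c \<odot>\<^bsub>rat_dual integer_group\<^esub> h x"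
    using WZ by (rule module_isomorphicE)
  define \<kappa> where "\<kappa> w = h w 1" for w
  have hw: "h w = (\<lambda>n. of_int n * \<kappa> w)" if w: "w \<in> carrier W" for w
  proof
    fix n
    have "h w \<in> carrier (rat_dual integer_group)" using h w by (rule bij_betw_apply)
    then have "h w (m + n) = h w m + h w n" for m n by (simp add: rat_dual_carrier integer_group_def)
    then show "h w n = of_int n * \<kappa> w" unfolding \<kappa>_def by (rule additive_int_rat)
  qed
  have "(\<lambda>n. of_int n) \<in> carrier (rat_dual integer_group)"
    by (simp add: rat_dual_carrier integer_group_def)
  then obtain w0 where w0: "w0 \<in> carrier W" "h w0 = (\<lambda>n. of_int n)"
    using h by (metis bij_betw_imp_surj_on image_iff)
  show ?thesis
  proof (rule tensor_module_line[OF V W VD w0(1), where \<kappa> = \<kappa>])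
    show "w = \<kappa> w \<odot>\<^bsub>W\<^esub> w0" if w: "w \<in> carrier W" for w
    proof -
      have "h w = h (\<kappa> w \<odot>\<^bsub>W\<^esub> w0)"
        using hsm w0 hw[OF w] by (simp add: rat_dual_ops mult.commute)
      then show ?thesis using h w w0 by (auto simp: bij_betw_def inj_on_def)
    qed
    show "\<kappa> w0 = 1" by (simp add: \<kappa>_def w0)
  qed (use hadd hsm in \<open>simp_all add: \<kappa>_def rat_dual_ops\<close>)
qed

lemma finite_direct_sum_singleton:
  "module_isomorphic rat_field (finite_direct_sum {i} M) (M i)"
proof -
  have inj: "inj_on (\<lambda>f. f i) (\<Pi>\<^sub>E j\<in>{i}. carrier (M j))"
    by (rule inj_onI) (metis PiE_ext singletonD)
  have "(\<lambda>f. f i) ` (\<Pi>\<^sub>E j\<in>{i}. carrier (M j)) = carrier (M i)"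
    by (rule image_projection_PiE[THEN trans]) (auto simp: PiE_eq_empty_iff)
  with inj show ?thesis
    unfolding module_isomorphic_def
    by (intro exI[of _ "\<lambda>f. f i"]) (simp add: finite_direct_sum_def bij_betw_def)
qed

text \<open>One-element summands carry no information, and a homomorphism on a product is the sum of
  its restrictions to the two factors.\<close>

lemma finite_direct_sum_two:
  assumes G: "group G1" "group G2"
    and i: "i0 \<in> I" "i1 \<in> I" "i0 \<noteq> i1"
    and triv: "\<And>i. i \<in> I \<Longrightarrow> i \<noteq> i0 \<Longrightarrow> i \<noteq> i1 \<Longrightarrow> card (carrier (M i)) = 1"
    and A: "module_isomorphic rat_field (M i0) (rat_dual G1)"
    and B: "module_isomorphic rat_field (M i1) (rat_dual G2)"
  shows "module_isomorphic rat_field (finite_direct_sum I M) (rat_dual (G1 \<times>\<times> G2))"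
proof -
  interpret G1: group G1 by fact
  interpret G2: group G2 by fact
  obtain a where a: "bij_betw a (carrier (M i0)) (carrier (rat_dual G1))"
     and aadd: "\<forall>x\<in>carrier (M i0). \<forall>y\<in>carrier (M i0). a (x \<oplus>\<^bsub>M i0\<^esub> y) = a x \<oplus>\<^bsub>rat_dual G1\<^esub> a y"
     and asm: "\<forall>c\<in>carrier rat_field. \<forall>x\<in>carrier (M i0). a (c \<odot>\<^bsub>M i0\<^esub> x) = c \<odot>\<^bsub>rat_dual G1\<^esub> a x"
    using A by (rule module_isomorphicE)
  obtain b where b: "bij_betw b (carrier (M i1)) (carrier (rat_dual G2))"
     and badd: "\<forall>x\<in>carrier (M i1). \<forall>y\<in>carrier (M i1). b (x \<oplus>\<^bsub>M i1\<^esub> y) = b x \<oplus>\<^bsub>rat_dual G2\<^esub> b y"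
     and bsm: "\<forall>c\<in>carrier rat_field. \<forall>x\<in>carrier (M i1). b (c \<odot>\<^bsub>M i1\<^esub> x) = c \<odot>\<^bsub>rat_dual G2\<^esub> b x"
    using B by (rule module_isomorphicE)
  let ?S = "finite_direct_sum I M" and ?D = "rat_dual (G1 \<times>\<times> G2)"
  define T where "T f z = (if z \<in> carrier G1 \<times> carrier G2 then a (f i0) (fst z) + b (f i1) (snd z) else 0)" for f z
  have car: "carrier ?S = (\<Pi>\<^sub>E i\<in>I. carrier (M i))" by (simp add: finite_direct_sum_def)
  have aD: "a (f i0) \<in> carrier (rat_dual G1)" and bD: "b (f i1) \<in> carrier (rat_dual G2)" if f: "f \<in> carrier ?S" for f
  proof -
    have "f i0 \<in> carrier (M i0)" "f i1 \<in> carrier (M i1)" using PiE_mem[OF f[unfolded car] i(1)] PiE_mem[OF f[unfolded car] i(2)] by blast+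
    then show "a (f i0) \<in> carrier (rat_dual G1)" "b (f i1) \<in> carrier (rat_dual G2)"
      using bij_betw_apply[OF a] bij_betw_apply[OF b] by blast+
  qed
  have TD: "T f \<in> carrier ?D" if f: "f \<in> carrier ?S" for f
    using aD[OF f] bD[OF f] by (auto simp: rat_dual_carrier T_def)
  \<comment> \<open>Evaluating at pairs with a unit entry recovers the two components.\<close>
  have T1: "T f (x, \<one>\<^bsub>G2\<^esub>) = a (f i0) x" if f: "f \<in> carrier ?S" and x: "x \<in> carrier G1" for f x
    using rat_dual_one[OF G(2) bD[OF f]] x by (simp add: T_def)
  have T2: "T f (\<one>\<^bsub>G1\<^esub>, x) = b (f i1) x" if f: "f \<in> carrier ?S" and x: "x \<in> carrier G2" for f x
    using rat_dual_one[OF G(1) aD[OF f]] x by (simp add: T_def)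
  have inj: "inj_on T (carrier ?S)"
  proof (rule inj_onI)
    fix f g assume f: "f \<in> carrier ?S" and g: "g \<in> carrier ?S" and eq: "T f = T g"
    have "a (f i0) x = a (g i0) x" for x
      using T1[OF f, of x] T1[OF g, of x] eq aD[OF f] aD[OF g] by (cases "x \<in> carrier G1") (auto simp: rat_dual_carrier)
    then have "a (f i0) = a (g i0)" by blast
    then have 0: "f i0 = g i0"
      using inj_onD[OF bij_betw_imp_inj_on[OF a]] PiE_mem[OF f[unfolded car] i(1)] PiE_mem[OF g[unfolded car] i(1)] by blast
    have "b (f i1) x = b (g i1) x" for x
      using T2[OF f, of x] T2[OF g, of x] eq bD[OF f] bD[OF g] by (cases "x \<in> carrier G2") (auto simp: rat_dual_carrier)
    then have "b (f i1) = b (g i1)" by blast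
    then have 1: "f i1 = g i1"
      using inj_onD[OF bij_betw_imp_inj_on[OF b]] PiE_mem[OF f[unfolded car] i(2)] PiE_mem[OF g[unfolded car] i(2)] by blast
    show "f = g"
    proof (rule PiE_ext[OF f[unfolded car] g[unfolded car]])
      fix j assume j: "j \<in> I"
      show "f j = g j"
      proof (cases "j = i0 \<or> j = i1")
        case True then show ?thesis using 0 1 by auto
      next
        case False
        then obtain m where "carrier (M j) = {m}" using triv[OF j] by (metis card_1_singletonE)
        then show ?thesis using PiE_mem[OF f[unfolded car] j] PiE_mem[OF g[unfolded car] j] by simp
      qed
    qed
  qed
  have surj: "h \<in> T ` carrier ?S" if h: "h \<in> carrier ?D" for h
  proof -
    define h1 where "h1 x = (if x \<in> carrier G1 then h (x, \<one>\<^bsub>G2\<^esub>) else 0)" for x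
    define h2 where "h2 x = (if x \<in> carrier G2 then h (\<one>\<^bsub>G1\<^esub>, x) else 0)" for x
    have hm: "h (x \<otimes>\<^bsub>G1\<^esub> x', y \<otimes>\<^bsub>G2\<^esub> y') = h (x, y) + h (x', y')"
      if "x \<in> carrier G1" "x' \<in> carrier G1" "y \<in> carrier G2" "y' \<in> carrier G2" for x x' y y'
    proof -
      have "h ((x, y) \<otimes>\<^bsub>G1 \<times>\<times> G2\<^esub> (x', y')) = h (x, y) + h (x', y')"
        using h that unfolding rat_dual_carrier by (metis DirProd_def mem_Sigma_iff partial_object.select_convs(1))
      then show ?thesis by simp
    qed
    have "h1 (x \<otimes>\<^bsub>G1\<^esub> x') = h1 x + h1 x'" if "x \<in> carrier G1" "x' \<in> carrier G1" for x x'
      using hm[OF that G2.one_closed G2.one_closed] that by (simp add: h1_def)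
    then have h1: "h1 \<in> carrier (rat_dual G1)" by (simp add: rat_dual_carrier h1_def)
    have "h2 (x \<otimes>\<^bsub>G2\<^esub> x') = h2 x + h2 x'" if "x \<in> carrier G2" "x' \<in> carrier G2" for x x'
      using hm[OF G1.one_closed G1.one_closed that] that by (simp add: h2_def)
    then have h2: "h2 \<in> carrier (rat_dual G2)" by (simp add: rat_dual_carrier h2_def)
    obtain x where x: "x \<in> carrier (M i0)" "a x = h1"
      using h1 unfolding bij_betw_imp_surj_on[OF a, symmetric] by blast
    obtain y where y: "y \<in> carrier (M i1)" "b y = h2"
      using h2 unfolding bij_betw_imp_surj_on[OF b, symmetric] by blast
    \<comment> \<open>At the remaining indices the only available element is taken.\<close>
    define f where "f = (\<lambda>j\<in>I. if j = i0 then x else if j = i1 then y else the_elem (carrier (M j)))"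
    have "the_elem (carrier (M j)) \<in> carrier (M j)" if j: "j \<in> I" "j \<noteq> i0" "j \<noteq> i1" for j
    proof -
      obtain m where "carrier (M j) = {m}" using triv[OF j] by (metis card_1_singletonE)
      then show ?thesis by simp
    qed
    then have f: "f \<in> carrier ?S" unfolding car f_def restrict_PiE_iff using x(1) y(1) by simp
    have "T f z = h z" for z
    proof (cases "z \<in> carrier G1 \<times> carrier G2")
      case True
      then obtain u v where z: "z = (u, v)" "u \<in> carrier G1" "v \<in> carrier G2" by auto
      then have "T f z = h1 u + h2 v" using i x y by (simp add: T_def f_def)
      also have "\<dots> = h (u, v)"
        using hm[of u "\<one>\<^bsub>G1\<^esub>" "\<one>\<^bsub>G2\<^esub>" v] z by (simp add: h1_def h2_def)
      finally show ?thesis using z by simp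
    next
      case False
      moreover have "carrier (G1 \<times>\<times> G2) = carrier G1 \<times> carrier G2" by (simp add: DirProd_def)
      ultimately have "h z = 0" using h unfolding rat_dual_carrier by blast
      then show ?thesis using False by (simp only: T_def if_False)
    qed
    then have "T f = h" by blast
    then show ?thesis using f by blast
  qed
  have "bij_betw T (carrier ?S) (carrier ?D)"
    unfolding bij_betw_def using inj TD surj by blast
  moreover have "T (f \<oplus>\<^bsub>?S\<^esub> g) = T f \<oplus>\<^bsub>?D\<^esub> T g" if f: "f \<in> carrier ?S" and g: "g \<in> carrier ?S" for f g
  proof -
    have "f i0 \<in> carrier (M i0)" "f i1 \<in> carrier (M i1)" "g i0 \<in> carrier (M i0)" "g i1 \<in> carrier (M i1)"
      using PiE_mem[OF f[unfolded car] i(1)] PiE_mem[OF f[unfolded car] i(2)]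
        PiE_mem[OF g[unfolded car] i(1)] PiE_mem[OF g[unfolded car] i(2)] by blast+
    then show ?thesis
      using i aadd badd by (simp add: T_def finite_direct_sum_def rat_dual_ops fun_eq_iff)
  qed
  moreover have "T (c \<odot>\<^bsub>?S\<^esub> f) = c \<odot>\<^bsub>?D\<^esub> T f" if f: "f \<in> carrier ?S" for f c
  proof -
    have "f i0 \<in> carrier (M i0)" "f i1 \<in> carrier (M i1)"
      using PiE_mem[OF f[unfolded car] i(1)] PiE_mem[OF f[unfolded car] i(2)] by blast+
    then show ?thesis
      using i asm bsm by (simp add: T_def finite_direct_sum_def rat_dual_ops fun_eq_iff distrib_left)
  qed
  ultimately show ?thesis
    unfolding module_isomorphic_def by (intro exI[of _ T] conjI ballI)
qed

lemma DirProd_trivial_isomorphic: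
  assumes "group G" "trivial_group K"
  shows "G \<times>\<times> K \<cong> G" "K \<times>\<times> G \<cong> G"
proof -
  have K: "carrier K = {\<one>\<^bsub>K\<^esub>}" using assms(2) by (simp add: trivial_group_def)
  have 1: "fst \<in> iso (G \<times>\<times> K) G"
    unfolding iso_def hom_def bij_betw_def inj_on_def by (auto simp: K image_iff)
  show "G \<times>\<times> K \<cong> G" using 1 by (rule is_isoI)
  have 2: "snd \<in> iso (K \<times>\<times> G) G"
    unfolding iso_def hom_def bij_betw_def inj_on_def by (auto simp: K image_iff)
  show "K \<times>\<times> G \<cong> G" using 2 by (rule is_isoI)
qed

text \<open>Kuenneth against a space with the homology of the circle: only \<open>q = 0\<close> and
  \<open>q = 1\<close> contribute in degree \<open>k\<close>, each by tensoring with a line, and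
  both sides become the dual of the same product of homology groups.\<close>

lemma cohomologically_trivial_homology:
  assumes E: "\<And>k. homology_group k E \<cong> homology_group k F \<times>\<times> homology_group (k - 1) F"
    and B: "homology_group 0 B \<cong> integer_group" "homology_group 1 B \<cong> integer_group"
    and B2: "\<And>q. 2 \<le> q \<Longrightarrow> trivial_group (homology_group q B)"
  shows "cohomologically_trivial F E B"
  unfolding cohomologically_trivial_def
proof
  fix k :: nat
  let ?M = "\<lambda>(p, q). tensor_module (rat_cohomology p F) (rat_cohomology q B)"
  let ?I = "{(p, q). p + q = k}"
  have line: "module_isomorphic rat_field (?M (p, q)) (rat_dual (homology_group (int p) F))"
    if "q = 0 \<or> q = 1" for p q :: nat
  proof -
    have iq: "homology_group (int q) B \<cong> integer_group" using B that by auto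
    have "module_isomorphic rat_field (rat_cohomology q B) (rat_dual integer_group)"
      by (rule module_isomorphic_trans[OF rat_cohomology_dual rat_dual_isomorphic[OF _ _ iq]]) simp_all
    from tensor_rat_dual_integer[OF module_rat_cohomology module_rat_cohomology
        rat_cohomology_dual[unfolded rat_dual_def] this, of p F]
    show ?thesis by (simp add: rat_dual_def)
  qed
  have triv: "card (carrier (?M (p, q))) = 1" if "2 \<le> q" for p q :: nat
  proof -
    interpret W: module rat_field "rat_cohomology q B" by (rule module_rat_cohomology)
    have "trivial_group (homology_group (int q) B)" using that by (intro B2) simp
    then have c: "carrier (rat_dual (homology_group (int q) B)) = {\<lambda>x. 0}" by (rule rat_dual_trivial)
    obtain h where "bij_betw h (carrier (rat_cohomology q B)) (carrier (rat_dual (homology_group (int q) B)))"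
      using rat_cohomology_dual[of q B] unfolding module_isomorphic_def by blast
    then have "card (carrier (rat_cohomology q B)) = 1" unfolding c by (simp add: bij_betw_same_card)
    then obtain m where "carrier (rat_cohomology q B) = {m}" by (rule card_1_singletonE)
    then have "carrier (rat_cohomology q B) = {\<zero>\<^bsub>rat_cohomology q B\<^esub>}"
      using W.zero_closed by simp
    then show ?thesis
      using tensor_module_trivial[OF module_rat_cohomology[of p F] module_rat_cohomology[of q B]] by simp
  qed
  have Edual: "module_isomorphic rat_field (rat_cohomology k E)
     (rat_dual (homology_group (int k) F \<times>\<times> homology_group (int k - 1) F))"
    by (rule module_isomorphic_trans[OF rat_cohomology_dual rat_dual_isomorphic[OF _ _ E]])
       (simp_all add: DirProd_group)
  have sum: "module_isomorphic rat_field (finite_direct_sum ?I ?M)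
     (rat_dual (homology_group (int k) F \<times>\<times> homology_group (int k - 1) F))"
  proof (cases k)
    \<comment> \<open>Only the index \<open>(0, 0)\<close> remains; on the other side the factor in
      degree -1 is trivial.\<close>
    case 0
    have I: "?I = {(0, 0)}" using 0 by auto
    have t: "homology_group 0 F \<cong> homology_group 0 F \<times>\<times> homology_group (- 1) F"
      by (rule group.iso_sym[OF _ DirProd_trivial_isomorphic(1)]) (simp_all add: DirProd_group)
    have "module_isomorphic rat_field (?M (0, 0)) (rat_dual (homology_group 0 F))"
      using line[of 0 0] by simp
    from module_isomorphic_trans[OF finite_direct_sum_singleton[of "(0, 0)" ?M]
        module_isomorphic_trans[OF this rat_dual_isomorphic[OF _ _ t]]]
    show ?thesis unfolding I using 0 by (simp add: DirProd_group)
  next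
    case (Suc l)
    show ?thesis
    proof (rule finite_direct_sum_two[of _ _ "(k, 0)" _ "(l, 1)"])
      show "module_isomorphic rat_field (?M (k, 0)) (rat_dual (homology_group (int k) F))"
        by (rule line) simp
      have "int k - 1 = int l" using Suc by simp
      then show "module_isomorphic rat_field (?M (l, 1)) (rat_dual (homology_group (int k - 1) F))"
        using line[of 1 l] by simp
      fix i assume i: "i \<in> ?I" "i \<noteq> (k, 0)" "i \<noteq> (l, 1)"
      obtain p q where pq: "i = (p, q)" by (rule prod.exhaust)
      then have "2 \<le> q" using i Suc by (cases q rule: nat.exhaust; cases "q = 1") auto
      then show "card (carrier (?M i)) = 1" unfolding pq by (rule triv)
    qed (auto simp: Suc)
  qed
  \<comment> \<open>The isomorphism in \<open>sum\<close> starts at the direct sum and has to be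
    inverted, which calls for closure of the operations there.\<close>
  have closed: "x \<oplus>\<^bsub>?M i\<^esub> y \<in> carrier (?M i)" "c \<odot>\<^bsub>?M i\<^esub> x \<in> carrier (?M i)"
    if "x \<in> carrier (?M i)" "y \<in> carrier (?M i)" for i x y c
  proof -
    obtain p q where pq: "i = (p, q)" by (rule prod.exhaust)
    interpret module rat_field "?M i"
      unfolding pq by (simp add: module_tensor module_rat_cohomology)
    show "x \<oplus>\<^bsub>?M i\<^esub> y \<in> carrier (?M i)" "c \<odot>\<^bsub>?M i\<^esub> x \<in> carrier (?M i)"
      using that by simp_all
  qed
  have "module_isomorphic rat_field (rat_dual (homology_group (int k) F \<times>\<times> homology_group (int k - 1) F))
      (finite_direct_sum ?I ?M)"
  proof (rule module_isomorphic_sym[OF _ _ sum])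
    fix x y and c :: rat
    assume "x \<in> carrier (finite_direct_sum ?I ?M)"
    then have x: "x \<in> (\<Pi>\<^sub>E i\<in>?I. carrier (?M i))" by (simp only: finite_direct_sum_def partial_object.simps)
    show "c \<odot>\<^bsub>finite_direct_sum ?I ?M\<^esub> x \<in> carrier (finite_direct_sum ?I ?M)"
      unfolding finite_direct_sum_def module.simps partial_object.simps
      using PiE_mem[OF x] by (intro restrict_PiE_iff[THEN iffD2] ballI closed)
    assume "y \<in> carrier (finite_direct_sum ?I ?M)"
    then have y: "y \<in> (\<Pi>\<^sub>E i\<in>?I. carrier (?M i))" by (simp only: finite_direct_sum_def partial_object.simps)
    show "x \<oplus>\<^bsub>finite_direct_sum ?I ?M\<^esub> y \<in> carrier (finite_direct_sum ?I ?M)"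
      unfolding finite_direct_sum_def ring.simps partial_object.simps
      using PiE_mem[OF x] PiE_mem[OF y] by (intro restrict_PiE_iff[THEN iffD2] ballI closed)
  qed
  with Edual show "module_isomorphic rat_field (rat_cohomology k E) (finite_direct_sum ?I ?M)"
    by (rule module_isomorphic_trans)
qed

section \<open>Invariant derivations on algebraic groups\<close>

no_notation fps_nth (infixl "$" 75)

section \<open>Separation of variables and difference quotients for polynomials\<close>

lemma polynomial_functions_uminus:
  "f \<in> polynomial_functions C \<Longrightarrow> (\<lambda>x. - f x) \<in> polynomial_functions C"
  using polynomial_functions.mult[OF polynomial_functions.const[of "-1"], of f C] by simp

lemma polynomial_functions_diff:
  "f \<in> polynomial_functions C \<Longrightarrow> g \<in> polynomial_functions C \<Longrightarrow> (\<lambda>x. f x - g x) \<in> polynomial_functions C"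
  using polynomial_functions.add[OF _ polynomial_functions_uminus, of f C g] by simp

lemma affine_polynomials_intros:
  "(\<lambda>x. c) \<in> affine_polynomials"
  "(\<lambda>x::complex^'n. x $ i) \<in> affine_polynomials"
  "f \<in> affine_polynomials \<Longrightarrow> g \<in> affine_polynomials \<Longrightarrow> (\<lambda>x. f x + g x) \<in> affine_polynomials"
  "f \<in> affine_polynomials \<Longrightarrow> g \<in> affine_polynomials \<Longrightarrow> (\<lambda>x. f x * g x) \<in> affine_polynomials"
  "f \<in> affine_polynomials \<Longrightarrow> g \<in> affine_polynomials \<Longrightarrow> (\<lambda>x. f x - g x) \<in> affine_polynomials"
  unfolding affine_polynomials_def
  by (auto intro: polynomial_functions.intros polynomial_functions_diff)

lemma affine_polynomials_induct [consumes 1, case_names const coord add mult]: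
  fixes p :: "complex ^ 'n \<Rightarrow> complex" and P :: "(complex ^ 'n \<Rightarrow> complex) \<Rightarrow> bool"
  assumes "p \<in> affine_polynomials" "\<And>c. P (\<lambda>x. c)" "\<And>i. P (\<lambda>x. x $ i)"
    "\<And>f g. f \<in> affine_polynomials \<Longrightarrow> g \<in> affine_polynomials \<Longrightarrow> P f \<Longrightarrow> P g \<Longrightarrow> P (\<lambda>x. f x + g x)"
    "\<And>f g. f \<in> affine_polynomials \<Longrightarrow> g \<in> affine_polynomials \<Longrightarrow> P f \<Longrightarrow> P g \<Longrightarrow> P (\<lambda>x. f x * g x)"
  shows "P p"
  using assms(1) unfolding affine_polynomials_def
proof (induction p rule: polynomial_functions.induct)
  case (coord f)
  then show ?case using assms(3) by auto
qed (use assms in \<open>auto simp: affine_polynomials_def\<close>)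

text \<open>The list holds the pairs of factors of a sum of products \<open>\<Sum> a x * b y\<close>.\<close>

definition separated :: "((complex ^ 'n \<Rightarrow> complex) \<times> (complex ^ 'n \<Rightarrow> complex)) list \<Rightarrow> bool" where
  "separated l \<longleftrightarrow> (\<forall>q\<in>set l. fst q \<in> affine_polynomials \<and> snd q \<in> affine_polynomials)"

definition sep_eval where
  "sep_eval l x y = (\<Sum>q\<leftarrow>l. fst q x * snd q y)"

lemma sep_eval_mult:
  "sep_eval (concat (map (\<lambda>q. map (\<lambda>q'. (\<lambda>x. fst q x * fst q' x, \<lambda>y. snd q y * snd q' y)) l') l)) x y
    = sep_eval l x y * (sep_eval l' x y :: complex)"
proof (induction l)
  case Nil
  then show ?case by (simp add: sep_eval_def)
next
  case (Cons q l)
  have "(\<Sum>q'\<leftarrow>l'. fst q x * fst q' x * (snd q y * snd q' y)) = fst q x * snd q y * sep_eval l' x y"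
    by (simp add: sep_eval_def sum_list_const_mult[symmetric] mult.assoc mult.left_commute)
  then show ?case using Cons by (simp add: sep_eval_def o_def ring_distribs)
qed

lemma separated_add: "separated l \<Longrightarrow> separated l' \<Longrightarrow> separated (l @ l')"
  by (auto simp: separated_def)

lemma sep_eval_append: "sep_eval (l @ l') x y = sep_eval l x y + (sep_eval l' x y :: complex)"
  by (simp add: sep_eval_def)

lemma separated_mult:
  "separated l \<Longrightarrow> separated l' \<Longrightarrow>
    separated (concat (map (\<lambda>q. map (\<lambda>q'. (\<lambda>x. fst q x * fst q' x, \<lambda>y. snd q y * snd q' y)) l') l))"
  by (auto simp: separated_def intro!: affine_polynomials_intros)

text \<open>The polynomial ring in two groups of variables is the tensor product of two polynomial
  rings. Applied to the group multiplication, this separates its two arguments.\<close>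

lemma affine_polynomials2_separated:
  assumes "p \<in> affine_polynomials2"
  shows "\<exists>l. separated l \<and> (\<forall>x y. p (x, y) = sep_eval l x y)"
  using assms unfolding affine_polynomials2_def
proof (induction p rule: polynomial_functions.induct)
  case (const c)
  show ?case
    by (rule exI[of _ "[(\<lambda>x. c, \<lambda>y. 1)]"]) (auto simp: separated_def sep_eval_def intro: affine_polynomials_intros)
next
  case (coord f)
  then consider i where "f = (\<lambda>z. fst z $ i)" | i where "f = (\<lambda>z. snd z $ i)" by auto
  then show ?case
  proof cases
    case 1
    show ?thesis
      by (rule exI[of _ "[(\<lambda>x. x $ i, \<lambda>y. 1)]"]) (auto simp: 1 separated_def sep_eval_def intro: affine_polynomials_intros)
  next
    case 2
    show ?thesis
      by (rule exI[of _ "[(\<lambda>x. 1, \<lambda>y. y $ i)]"]) (auto simp: 2 separated_def sep_eval_def intro: affine_polynomials_intros)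
  qed
next
  case (add f g)
  then obtain l l' where "separated l" "\<forall>x y. f (x, y) = sep_eval l x y" "separated l'" "\<forall>x y. g (x, y) = sep_eval l' x y"
    by blast
  then show ?case by (intro exI[of _ "l @ l'"]) (simp add: separated_add sep_eval_append)
next
  case (mult f g)
  then obtain l l' where l: "separated l" "\<forall>x y. f (x, y) = sep_eval l x y" "separated l'" "\<forall>x y. g (x, y) = sep_eval l' x y"
    by blast
  show ?case
    by (intro exI conjI, rule separated_mult[OF l(1) l(3)]) (simp only: sep_eval_mult l(2,4) simp_thms)
qed

lemma affine_polynomials_continuous: "p \<in> affine_polynomials \<Longrightarrow> continuous_on S p"
  by (induction rule: affine_polynomials_induct) (auto intro!: continuous_intros)

lemma affine_polynomials_differentiable: "p \<in> affine_polynomials \<Longrightarrow> p differentiable (at a)"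
proof (induction rule: affine_polynomials_induct)
  case (coord i)
  have "((\<lambda>x. x $ i) has_derivative (\<lambda>x. x $ i)) (at a)"
    by (rule bounded_linear.has_derivative[OF bounded_linear_vec_nth has_derivative_ident])
  then show ?case by (rule differentiableI)
qed (auto intro: differentiable_add differentiable_mult)

text \<open>Difference quotients in all coordinates at once, continuous up to the diagonal, where
  they are the partial derivatives. This permits limits along secants with both end points
  moving.\<close>

lemma affine_polynomials_difference:
  fixes p :: "complex ^ 'n \<Rightarrow> complex"
  assumes "p \<in> affine_polynomials"
  shows "\<exists>r. (\<forall>i. continuous_on UNIV (\<lambda>z. r i (fst z) (snd z))) \<and>
    (\<forall>x y. p x - p y = (\<Sum>i\<in>UNIV. r i x y * (x $ i - y $ i)))"
  using assms
proof (induction rule: affine_polynomials_induct)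
  case (const c)
  show ?case by (rule exI[of _ "\<lambda>i x y. 0"]) simp
next
  case (coord j)
  show ?case
    by (rule exI[of _ "\<lambda>i x y. if i = j then 1 else 0"]) (auto simp: if_distrib[of "\<lambda>c. c * _"] cong: if_cong)
next
  case (add f g)
  then obtain r s where r: "\<And>i. continuous_on UNIV (\<lambda>z. r i (fst z) (snd z))"
      "\<And>x y. f x - f y = (\<Sum>i\<in>UNIV. r i x y * (x $ i - y $ i))"
    and s: "\<And>i. continuous_on UNIV (\<lambda>z. s i (fst z) (snd z))"
      "\<And>x y. g x - g y = (\<Sum>i\<in>UNIV. s i x y * (x $ i - y $ i))" by blast
  have "f x + g x - (f y + g y) = (\<Sum>i\<in>UNIV. (r i x y + s i x y) * (x $ i - y $ i))" for x y
  proof -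
    have "f x + g x - (f y + g y) = (f x - f y) + (g x - g y)" by simp
    also have "\<dots> = (\<Sum>i\<in>UNIV. (r i x y + s i x y) * (x $ i - y $ i))"
      unfolding r(2) s(2) by (simp add: distrib_right sum.distrib)
    finally show ?thesis .
  qed
  then show ?case
    by (intro exI[of _ "\<lambda>i x y. r i x y + s i x y"]) (auto intro!: continuous_intros r s)
next
  case (mult f g)
  then obtain r s where r: "\<And>i. continuous_on UNIV (\<lambda>z. r i (fst z) (snd z))"
      "\<And>x y. f x - f y = (\<Sum>i\<in>UNIV. r i x y * (x $ i - y $ i))"
    and s: "\<And>i. continuous_on UNIV (\<lambda>z. s i (fst z) (snd z))"
      "\<And>x y. g x - g y = (\<Sum>i\<in>UNIV. s i x y * (x $ i - y $ i))" by blast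
  have eq: "f x * g x - f y * g y = (\<Sum>i\<in>UNIV. (g x * r i x y + f y * s i x y) * (x $ i - y $ i))" for x y
  proof -
    have "f x * g x - f y * g y = g x * (f x - f y) + f y * (g x - g y)" by (simp add: algebra_simps)
    also have "\<dots> = (\<Sum>i\<in>UNIV. (g x * r i x y + f y * s i x y) * (x $ i - y $ i))"
      unfolding r(2) s(2) by (simp add: sum_distrib_left sum.distrib[symmetric] algebra_simps)
    finally show ?thesis .
  qed
  have cont: "continuous_on UNIV (\<lambda>z. g (fst z))" "continuous_on UNIV (\<lambda>z. f (snd z))"
    using continuous_on_compose2[OF affine_polynomials_continuous[OF mult(2), of UNIV] continuous_on_fst[OF continuous_on_id]]
      continuous_on_compose2[OF affine_polynomials_continuous[OF mult(1), of UNIV] continuous_on_snd[OF continuous_on_id]] by auto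
  show ?case
    by (intro exI[of _ "\<lambda>i x y. g x * r i x y + f y * s i x y"] conjI allI eq continuous_intros cont r(1) s(1))
qed

section \<open>Linear dependence and linear recurrences\<close>

lemma linear_dependence:
  fixes m :: "'a \<Rightarrow> 'b \<Rightarrow> complex"
  assumes "finite J" "finite A" "card J < card A"
  shows "\<exists>\<gamma>. (\<exists>k\<in>A. \<gamma> k \<noteq> 0) \<and> (\<forall>j\<in>J. (\<Sum>k\<in>A. \<gamma> k * m k j) = 0)"
  using assms
proof (induction J arbitrary: A m rule: finite_induct)
  case empty
  then obtain k where "k \<in> A" by fastforce
  then show ?case by (intro exI[of _ "\<lambda>_. 1"]) auto
next
  case (insert j0 J)
  show ?case
  proof (cases "\<forall>k\<in>A. m k j0 = 0")
    case True
    have "card J < card A" using insert by simp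
    then obtain \<gamma> where "\<exists>k\<in>A. \<gamma> k \<noteq> 0" "\<forall>j\<in>J. (\<Sum>k\<in>A. \<gamma> k * m k j) = 0"
      using insert.IH[OF insert.prems(1)] by blast
    then show ?thesis using True by (intro exI[of _ \<gamma>]) simp
  next
    case False
    \<comment> \<open>Elimination with pivot \<open>p\<close>: the rows of \<open>B\<close> are
      cleared in column \<open>j0\<close>, and \<open>c\<close> is chosen afterwards to satisfy the
      equation in this column.\<close>
    then obtain p where p: "p \<in> A" "m p j0 \<noteq> 0" by blast
    define B where "B = A - {p}"
    have B: "finite B" "p \<notin> B" "A = insert p B" using insert.prems p by (auto simp: B_def)
    have "card J < card B" using insert B by simp
    then obtain \<gamma> where nz: "\<exists>k\<in>B. \<gamma> k \<noteq> 0"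
      and \<gamma>: "\<forall>j\<in>J. (\<Sum>k\<in>B. \<gamma> k * (m k j - m k j0 / m p j0 * m p j)) = 0"
      using insert.IH[OF B(1), of "\<lambda>k j. m k j - m k j0 / m p j0 * m p j"] by blast
    define c where "c = - (\<Sum>k\<in>B. \<gamma> k * m k j0) / m p j0"
    define \<gamma>' where "\<gamma>' = \<gamma>(p := c)"
    have s: "(\<Sum>k\<in>A. \<gamma>' k * m k j) = c * m p j + (\<Sum>k\<in>B. \<gamma> k * m k j)" for j
    proof -
      have "(\<Sum>k\<in>B. \<gamma>' k * m k j) = (\<Sum>k\<in>B. \<gamma> k * m k j)"
        using B(2) by (intro sum.cong) (auto simp: \<gamma>'_def)
      then show ?thesis using B by (simp add: \<gamma>'_def)
    qed
    have "(\<Sum>k\<in>A. \<gamma>' k * m k j) = 0" if "j \<in> insert j0 J" for j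
    proof (cases "j = j0")
      case True
      then show ?thesis unfolding s using p by (simp add: c_def)
    next
      case False
      then have "(\<Sum>k\<in>B. \<gamma> k * (m k j - m k j0 / m p j0 * m p j)) = 0" using \<gamma> that by blast
      then have "(\<Sum>k\<in>B. \<gamma> k * m k j) = (\<Sum>k\<in>B. \<gamma> k * m k j0) / m p j0 * m p j"
        by (simp add: right_diff_distrib sum_subtractf sum_distrib_right sum_divide_distrib mult.assoc)
      then show ?thesis unfolding s by (simp add: c_def)
    qed
    moreover have "\<exists>k\<in>A. \<gamma>' k \<noteq> 0" using nz B by (auto simp: \<gamma>'_def)
    ultimately show ?thesis by blast
  qed
qed

text \<open>Divided by its last non-zero coefficient, the recurrence expresses every later term
  through the \<open>m\<close> terms before it, which allows geometric growth at most.\<close>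

lemma linear_recurrence_bound:
  fixes u :: "nat \<Rightarrow> complex"
  assumes \<gamma>: "\<exists>k\<in>{..N}. \<gamma> k \<noteq> 0" and rec: "\<And>i. (\<Sum>k\<le>N. \<gamma> k * u (k + i)) = 0"
  shows "\<exists>M K. 0 \<le> M \<and> 0 \<le> K \<and> (\<forall>k. norm (u k) \<le> M * K ^ k)"
proof -
  define m where "m = Max {k. k \<le> N \<and> \<gamma> k \<noteq> 0}"
  have ne: "{k. k \<le> N \<and> \<gamma> k \<noteq> 0} \<noteq> {}" and fin: "finite {k. k \<le> N \<and> \<gamma> k \<noteq> 0}" using \<gamma> by auto
  have m: "m \<le> N" "\<gamma> m \<noteq> 0" using Max_in[OF fin ne] by (auto simp: m_def)
  have max: "\<gamma> k = 0" if "k \<le> N" "m < k" for k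
    using Max_ge[OF fin, of k] that by (fastforce simp: m_def)
  have rec': "u (m + i) = - (\<Sum>k<m. \<gamma> k / \<gamma> m * u (k + i))" for i
  proof -
    have "(\<Sum>k\<le>N. \<gamma> k * u (k + i)) = (\<Sum>k\<le>m. \<gamma> k * u (k + i))"
      using m max by (intro sum.mono_neutral_right) auto
    then have "(\<Sum>k<m. \<gamma> k * u (k + i)) + \<gamma> m * u (m + i) = 0"
      using rec[of i] by (simp add: lessThan_Suc_atMost[symmetric])
    then have "u (m + i) = - (\<Sum>k<m. \<gamma> k * u (k + i)) / \<gamma> m"
      using m(2) by (simp add: field_simps eq_neg_iff_add_eq_0)
    then show ?thesis by (simp add: sum_divide_distrib)
  qed
  \<comment> \<open>\<open>M\<close> bounds the initial terms. The summand 1 in \<open>K\<close>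
    makes the powers of \<open>K\<close> increasing, while the coefficients contribute only
    \<open>K - 1\<close>.\<close>
  define M where "M = (\<Sum>k<m. norm (u k))"
  define K where "K = 1 + (\<Sum>k<m. norm (\<gamma> k / \<gamma> m))"
  have K1: "1 \<le> K" unfolding K_def by (simp add: sum_nonneg)
  have M0: "0 \<le> M" unfolding M_def by (simp add: sum_nonneg)
  have "norm (u k) \<le> M * K ^ k" for k
  proof (induction k rule: less_induct)
    case (less k)
    show ?case
    proof (cases "k < m")
      case True
      then have "norm (u k) \<le> M" unfolding M_def by (intro member_le_sum) auto
      also have "\<dots> \<le> M * K ^ k" using M0 one_le_power[OF K1, of k] by (simp add: mult_le_cancel_left1)
      finally show ?thesis .
    next
      case False
      define i where "i = k - m"
      have k: "k = m + i" using False by (simp add: i_def)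
      show ?thesis
      \<comment> \<open>For \<open>m = 0\<close> the recurrence makes all terms vanish; otherwise
        \<open>k\<close> is positive and \<open>k - 1\<close> is not truncated.\<close>
      proof (cases "m = 0")
        case True
        then show ?thesis using rec'[of i] k M0 K1 by simp
      next
        case False
        have "norm (u k) \<le> (\<Sum>j<m. norm (\<gamma> j / \<gamma> m * u (j + i)))"
          unfolding k rec' norm_minus_cancel by (rule norm_sum)
        also have "\<dots> \<le> (\<Sum>j<m. norm (\<gamma> j / \<gamma> m) * (M * K ^ (k - 1)))"
        proof (rule sum_mono)
          fix j assume j: "j \<in> {..<m}"
          then have "norm (u (j + i)) \<le> M * K ^ (j + i)" using k by (intro less) auto
          also have "\<dots> \<le> M * K ^ (k - 1)"
            using j k K1 M0 by (intro mult_left_mono power_increasing) auto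
          finally show "norm (\<gamma> j / \<gamma> m * u (j + i)) \<le> norm (\<gamma> j / \<gamma> m) * (M * K ^ (k - 1))"
            unfolding norm_mult by (intro mult_left_mono) auto
        qed
        also have "\<dots> = (K - 1) * (M * K ^ (k - 1))"
          by (simp add: K_def sum_distrib_right)
        also have "\<dots> \<le> K * (M * K ^ (k - 1))"
          using M0 K1 by (intro mult_right_mono) auto
        also have "\<dots> = M * K ^ k"
        proof -
          have "k = Suc (k - 1)" using False k by simp
          then have "K ^ k = K * K ^ (k - 1)" by (metis power_Suc)
          then show ?thesis by simp
        qed
        finally show ?thesis .
      qed
    qed
  qed
  then show ?thesis using M0 K1 by (intro exI[of _ M] exI[of _ K]) auto
qed

section \<open>Regular functions, tangent vectors and point derivations\<close>

lemma regular_on_polynomial: "p \<in> affine_polynomials \<Longrightarrow> regular_on V p"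
  unfolding regular_on_def by (rule bexI[of _ p]) simp_all

lemma regular_on_intros:
  "regular_on V (\<lambda>x. c)"
  "regular_on V (\<lambda>x. x $ i)"
  "regular_on V f \<Longrightarrow> regular_on V g \<Longrightarrow> regular_on V (\<lambda>x. f x + g x)"
  "regular_on V f \<Longrightarrow> regular_on V g \<Longrightarrow> regular_on V (\<lambda>x. f x * g x)"
  "regular_on V f \<Longrightarrow> regular_on V g \<Longrightarrow> regular_on V (\<lambda>x. f x - g x)"
proof -
  show "regular_on V (\<lambda>x. c)" by (rule regular_on_polynomial) (rule affine_polynomials_intros)
  show "regular_on V (\<lambda>x. x $ i)" by (rule regular_on_polynomial) (rule affine_polynomials_intros)
  assume "regular_on V f" "regular_on V g"
  then obtain p q where p: "p \<in> affine_polynomials" "\<forall>x\<in>V. f x = p x"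
    and q: "q \<in> affine_polynomials" "\<forall>x\<in>V. g x = q x" unfolding regular_on_def by blast
  show "regular_on V (\<lambda>x. f x + g x)"
    unfolding regular_on_def by (rule bexI[OF _ affine_polynomials_intros(3)[OF p(1) q(1)]]) (use p q in simp)
  show "regular_on V (\<lambda>x. f x * g x)"
    unfolding regular_on_def by (rule bexI[OF _ affine_polynomials_intros(4)[OF p(1) q(1)]]) (use p q in simp)
  show "regular_on V (\<lambda>x. f x - g x)"
    unfolding regular_on_def by (rule bexI[OF _ affine_polynomials_intros(5)[OF p(1) q(1)]]) (use p q in simp)
qed

lemma regular_on_cong: "regular_on V f \<Longrightarrow> (\<And>x. x \<in> V \<Longrightarrow> g x = f x) \<Longrightarrow> regular_on V g"
  unfolding regular_on_def by auto

lemma regular_on_sum_list: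
  "(\<And>q. q \<in> set l \<Longrightarrow> regular_on V (f q)) \<Longrightarrow> regular_on V (\<lambda>x. \<Sum>q\<leftarrow>l. f q x)"
  by (induction l) (auto intro: regular_on_intros)

definition point_deriv :: "(complex ^ 'n) \<Rightarrow> (complex ^ 'n) \<Rightarrow> (complex ^ 'n \<Rightarrow> complex) \<Rightarrow> complex" where
  "point_deriv a v p = frechet_derivative p (at a) v"

lemma point_deriv_has_derivative:
  "p \<in> affine_polynomials \<Longrightarrow> (p has_derivative (\<lambda>v. point_deriv a v p)) (at a)"
  unfolding point_deriv_def
  using affine_polynomials_differentiable[of p a] by (simp add: frechet_derivative_works eta_contract_eq)

lemma point_deriv_eqI: "(p has_derivative p') (at a) \<Longrightarrow> point_deriv a v p = p' v"
  unfolding point_deriv_def by (metis frechet_derivative_at)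

lemma point_deriv_simps:
  "point_deriv a v (\<lambda>x. c) = 0"
  "point_deriv a v (\<lambda>x. x $ i) = v $ i"
  "p \<in> affine_polynomials \<Longrightarrow> q \<in> affine_polynomials \<Longrightarrow> point_deriv a v (\<lambda>x. p x + q x) = point_deriv a v p + point_deriv a v q"
  "p \<in> affine_polynomials \<Longrightarrow> q \<in> affine_polynomials \<Longrightarrow> point_deriv a v (\<lambda>x. p x - q x) = point_deriv a v p - point_deriv a v q"
  "p \<in> affine_polynomials \<Longrightarrow> q \<in> affine_polynomials \<Longrightarrow>
    point_deriv a v (\<lambda>x. p x * q x) = p a * point_deriv a v q + point_deriv a v p * q a"
proof -
  show "point_deriv a v (\<lambda>x. c) = 0" by (rule point_deriv_eqI) (rule has_derivative_const)
  show "point_deriv a v (\<lambda>x. x $ i) = v $ i"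
    by (rule point_deriv_eqI) (rule bounded_linear.has_derivative[OF bounded_linear_vec_nth has_derivative_ident])
  assume p: "p \<in> affine_polynomials" and q: "q \<in> affine_polynomials"
  note d = point_deriv_has_derivative[OF p, of a] point_deriv_has_derivative[OF q, of a]
  show "point_deriv a v (\<lambda>x. p x + q x) = point_deriv a v p + point_deriv a v q"
    by (rule point_deriv_eqI[OF has_derivative_add[OF d]])
  show "point_deriv a v (\<lambda>x. p x - q x) = point_deriv a v p - point_deriv a v q"
    by (rule point_deriv_eqI[OF has_derivative_diff[OF d]])
  show "point_deriv a v (\<lambda>x. p x * q x) = p a * point_deriv a v q + point_deriv a v p * q a"
    by (rule point_deriv_eqI[OF has_derivative_mult[OF d]])
qed

text \<open>The Zariski tangent space, cut out by the differentials of the whole ideal of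
  \<open>V\<close> rather than of chosen equations; this makes \<open>pairing\<close> independent of
  the representing polynomial.\<close>

definition tangent_space :: "(complex ^ 'n) set \<Rightarrow> complex ^ 'n \<Rightarrow> (complex ^ 'n) set" where
  "tangent_space V a = {v. \<forall>p\<in>affine_polynomials. (\<forall>x\<in>V. p x = 0) \<longrightarrow> point_deriv a v p = 0}"

lemma subspace_tangent_space: "subspace (tangent_space V a)"
proof -
  have "linear (\<lambda>v. point_deriv a v p)" if "p \<in> affine_polynomials" for p
    using point_deriv_has_derivative[OF that] has_derivative_linear by blast
  note lin = linear_0[OF this] linear_add[OF this] linear_scale[OF this]
  show ?thesis
    unfolding subspace_def tangent_space_def by (auto simp: lin)
qed

text \<open>For a tangent vector the value does not depend on the chosen polynomial.\<close>

definition pairing :: "(complex ^ 'n) set \<Rightarrow> complex ^ 'n \<Rightarrow> complex ^ 'n \<Rightarrow> (complex ^ 'n \<Rightarrow> complex) \<Rightarrow> complex" where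
  "pairing V a v f = point_deriv a v (SOME p. p \<in> affine_polynomials \<and> (\<forall>x\<in>V. f x = p x))"

lemma pairing_eq:
  assumes v: "v \<in> tangent_space V a" and p: "p \<in> affine_polynomials" "\<And>x. x \<in> V \<Longrightarrow> f x = p x"
  shows "pairing V a v f = point_deriv a v p"
proof -
  define q where "q = (SOME p. p \<in> affine_polynomials \<and> (\<forall>x\<in>V. f x = p x))"
  have "q \<in> affine_polynomials \<and> (\<forall>x\<in>V. f x = q x)"
    unfolding q_def by (rule someI[of _ p]) (use p in blast)
  then have q: "q \<in> affine_polynomials" and 0: "\<forall>x\<in>V. q x - p x = 0" using p(2) by auto
  have "\<forall>p\<in>affine_polynomials. (\<forall>x\<in>V. p x = 0) \<longrightarrow> point_deriv a v p = 0"
    using v by (simp add: tangent_space_def)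
  from bspec[OF this affine_polynomials_intros(5)[OF q p(1)]] 0
  have "point_deriv a v (\<lambda>x. q x - p x) = 0" by (rule mp)
  then show ?thesis using point_deriv_simps(4)[OF q p(1)] by (simp add: pairing_def q_def)
qed

lemma pairing_simps:
  assumes v: "v \<in> tangent_space V a" and a: "a \<in> V"
  shows "pairing V a v (\<lambda>x. c) = 0"
    "pairing V a v (\<lambda>x. x $ i) = v $ i"
    "regular_on V f \<Longrightarrow> regular_on V g \<Longrightarrow> pairing V a v (\<lambda>x. f x + g x) = pairing V a v f + pairing V a v g"
    "regular_on V f \<Longrightarrow> regular_on V g \<Longrightarrow> pairing V a v (\<lambda>x. f x * g x) = f a * pairing V a v g + pairing V a v f * g a"
proof -
  show "pairing V a v (\<lambda>x. c) = 0"
    using pairing_eq[OF v affine_polynomials_intros(1)[of c], of "\<lambda>x. c"] by (simp add: point_deriv_simps(1))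
  show "pairing V a v (\<lambda>x. x $ i) = v $ i"
    using pairing_eq[OF v affine_polynomials_intros(2)[of i], of "\<lambda>x. x $ i"] by (simp add: point_deriv_simps(2))
  assume f: "regular_on V f" and g: "regular_on V g"
  obtain p where p: "p \<in> affine_polynomials" "\<forall>x\<in>V. f x = p x"
    using f unfolding regular_on_def by blast
  obtain q where q: "q \<in> affine_polynomials" "\<forall>x\<in>V. g x = q x"
    using g unfolding regular_on_def by blast
  have fp: "pairing V a v f = point_deriv a v p" and gq: "pairing V a v g = point_deriv a v q"
    using p q by (auto intro!: pairing_eq[OF v])
  have "pairing V a v (\<lambda>x. f x + g x) = point_deriv a v (\<lambda>x. p x + q x)"
    using affine_polynomials_intros(3)[OF p(1) q(1)] by (rule pairing_eq[OF v]) (simp add: p q)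
  then show "pairing V a v (\<lambda>x. f x + g x) = pairing V a v f + pairing V a v g"
    by (simp add: fp gq point_deriv_simps(3)[OF p(1) q(1)])
  have "pairing V a v (\<lambda>x. f x * g x) = point_deriv a v (\<lambda>x. p x * q x)"
    using affine_polynomials_intros(4)[OF p(1) q(1)] by (rule pairing_eq[OF v]) (simp add: p q)
  then show "pairing V a v (\<lambda>x. f x * g x) = f a * pairing V a v g + pairing V a v f * g a"
    using a by (simp add: p(2) q(2) fp gq point_deriv_simps(5)[OF p(1) q(1)])
qed

lemma pairing_cong:
  assumes "\<And>x. x \<in> V \<Longrightarrow> f x = g x"
  shows "pairing V a v f = pairing V a v g"
proof -
  have "(\<lambda>p. p \<in> affine_polynomials \<and> (\<forall>x\<in>V. f x = p x)) = (\<lambda>p. p \<in> affine_polynomials \<and> (\<forall>x\<in>V. g x = p x))"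
    using assms by auto
  then show ?thesis unfolding pairing_def by simp
qed

lemma pairing_scale:
  assumes "v \<in> tangent_space V a" "a \<in> V" "regular_on V f"
  shows "pairing V a v (\<lambda>x. c * f x) = c * pairing V a v f"
  using pairing_simps(4)[OF assms(1,2) regular_on_intros(1)[of V c] assms(3)] pairing_simps(1)[OF assms(1,2)] by simp

lemma pairing_sum_list:
  assumes "v \<in> tangent_space V a" "a \<in> V" "\<And>q. q \<in> set l \<Longrightarrow> regular_on V (f q)"
  shows "pairing V a v (\<lambda>x. \<Sum>q\<leftarrow>l. c q * f q x) = (\<Sum>q\<leftarrow>l. c q * pairing V a v (f q))"
  using assms(3)
proof (induction l)
  case Nil
  then show ?case by (simp add: pairing_simps[OF assms(1,2)])
next
  case (Cons q l)
  have r: "regular_on V (\<lambda>x. c q * f q x)" using Cons.prems by (intro regular_on_intros) auto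
  have "regular_on V (\<lambda>x. \<Sum>q\<leftarrow>l. c q * f q x)"
    using Cons.prems by (intro regular_on_sum_list regular_on_intros) auto
  from pairing_simps(3)[OF assms(1,2) r this] show ?case
    using Cons pairing_scale[OF assms(1,2), of "f q" "c q"] by simp
qed

section \<open>Comultiplication and left invariant derivations\<close>

locale affine_group =
  fixes G :: "(complex ^ 'n) monoid" (structure)
  assumes affine: "affine_algebraic_group G"
begin

sublocale group G
  using affine by (simp add: affine_algebraic_group_def)

lemma zariski: "zariski_closed (carrier G)"
  using affine by (simp add: affine_algebraic_group_def)

text \<open>The comultiplication of the coordinate ring. All translates of \<open>f\<close> lie in
  the span of finitely many functions; the finite dimension behind the growth estimate for
  derivatives comes from here.\<close>

lemma regular_comultiplication:
  assumes "regular_on (carrier G) f"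
  obtains l where "separated l" "\<And>x y. x \<in> carrier G \<Longrightarrow> y \<in> carrier G \<Longrightarrow> f (x \<otimes> y) = sep_eval l x y"
proof -
  obtain p where p: "p \<in> affine_polynomials" "\<forall>x\<in>carrier G. f x = p x"
    using assms unfolding regular_on_def by blast
  have "\<exists>l. separated l \<and> (\<forall>x\<in>carrier G. \<forall>y\<in>carrier G. p (x \<otimes> y) = sep_eval l x y)"
    using p(1)
  proof (induction rule: affine_polynomials_induct)
    case (const c)
    show ?case
      by (rule exI[of _ "[(\<lambda>x. c, \<lambda>y. 1)]"]) (auto simp: separated_def sep_eval_def intro: affine_polynomials_intros)
  next
    case (coord i)
    obtain q where q: "q \<in> affine_polynomials2" "\<forall>x\<in>carrier G. \<forall>y\<in>carrier G. (x \<otimes> y) $ i = q (x, y)"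
      using affine unfolding affine_algebraic_group_def by blast
    obtain l where "separated l" "\<forall>x y. q (x, y) = sep_eval l x y"
      using affine_polynomials2_separated[OF q(1)] by blast
    then show ?case using q(2) by (intro exI[of _ l]) simp
  next
    case (add f g)
    then obtain l l' where l: "separated l" "\<forall>x\<in>carrier G. \<forall>y\<in>carrier G. f (x \<otimes> y) = sep_eval l x y"
      "separated l'" "\<forall>x\<in>carrier G. \<forall>y\<in>carrier G. g (x \<otimes> y) = sep_eval l' x y"
      by blast
    then show ?case by (intro exI[of _ "l @ l'"]) (simp add: separated_add sep_eval_append)
  next
    case (mult f g)
    then obtain l l' where l: "separated l" "\<forall>x\<in>carrier G. \<forall>y\<in>carrier G. f (x \<otimes> y) = sep_eval l x y"
      "separated l'" "\<forall>x\<in>carrier G. \<forall>y\<in>carrier G. g (x \<otimes> y) = sep_eval l' x y"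
      by blast
    show ?case
      by (intro exI conjI, rule separated_mult[OF l(1) l(3)]) (simp add: sep_eval_mult l(2,4))
  qed
  then obtain l where "separated l" "\<forall>x\<in>carrier G. \<forall>y\<in>carrier G. p (x \<otimes> y) = sep_eval l x y" by blast
  then show thesis using p(2) by (intro that[of l]) auto
qed

lemma separated_regular:
  assumes "separated l"
  shows "regular_on V (sep_eval l x)" "regular_on V (\<lambda>x. sep_eval l x y)"
proof -
  have p: "fst q \<in> affine_polynomials" "snd q \<in> affine_polynomials" if "q \<in> set l" for q
    using assms that by (auto simp: separated_def)
  show "regular_on V (sep_eval l x)" unfolding sep_eval_def
    by (rule regular_on_sum_list) (rule regular_on_intros(4)[OF regular_on_intros(1) regular_on_polynomial[OF p(2)]])
  show "regular_on V (\<lambda>x. sep_eval l x y)" unfolding sep_eval_def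
    by (rule regular_on_sum_list) (rule regular_on_intros(4)[OF regular_on_polynomial[OF p(1)] regular_on_intros(1)])
qed

lemma regular_translate:
  assumes "regular_on (carrier G) f" "x \<in> carrier G"
  shows "regular_on (carrier G) (\<lambda>y. f (x \<otimes> y))"
proof -
  obtain l where l: "separated l" "\<And>x y. x \<in> carrier G \<Longrightarrow> y \<in> carrier G \<Longrightarrow> f (x \<otimes> y) = sep_eval l x y"
    using regular_comultiplication[OF assms(1)] by blast
  show ?thesis
    by (rule regular_on_cong[OF separated_regular(1)[OF l(1), of _ x]]) (use l assms in auto)
qed

end

locale tangent_vector = affine_group G for G :: "(complex ^ 'n) monoid" (structure) +
  fixes v :: "complex ^ 'n"
  assumes v: "v \<in> tangent_space (carrier G) \<one>"
begin

text \<open>The left invariant derivation with value \<open>v\<close> at the unit.\<close>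

definition D :: "(complex ^ 'n \<Rightarrow> complex) \<Rightarrow> complex ^ 'n \<Rightarrow> complex" where
  "D f x = pairing (carrier G) \<one> v (\<lambda>y. f (x \<otimes> y))"

lemma D_cong:
  assumes "\<And>x. x \<in> carrier G \<Longrightarrow> f x = g x" "x \<in> carrier G"
  shows "D f x = D g x"
  unfolding D_def by (rule pairing_cong) (use assms in simp)

lemma D_power_cong:
  assumes "\<And>x. x \<in> carrier G \<Longrightarrow> f x = g x" "x \<in> carrier G"
  shows "(D ^^ k) f x = (D ^^ k) g x"
  using assms(2)
proof (induction k arbitrary: x)
  case (Suc k)
  then show ?case by (simp add: D_cong[of "(D ^^ k) f" "(D ^^ k) g"])
qed (use assms(1) in simp)

lemma D_const: "D (\<lambda>x. c) x = 0"
  unfolding D_def by (simp add: pairing_simps[OF v one_closed])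

lemma D_add:
  assumes "regular_on (carrier G) f" "regular_on (carrier G) g" "x \<in> carrier G"
  shows "D (\<lambda>x. f x + g x) x = D f x + D g x"
  unfolding D_def using assms by (intro pairing_simps[OF v one_closed] regular_translate)

lemma D_scale:
  assumes "regular_on (carrier G) f" "x \<in> carrier G"
  shows "D (\<lambda>x. c * f x) x = c * D f x"
  unfolding D_def using assms by (intro pairing_scale[OF v one_closed] regular_translate)

lemma D_mult:
  assumes "regular_on (carrier G) f" "regular_on (carrier G) g" "x \<in> carrier G"
  shows "D (\<lambda>x. f x * g x) x = f x * D g x + D f x * g x"
  using pairing_simps(4)[OF v one_closed regular_translate[OF assms(1,3)] regular_translate[OF assms(2,3)]]
    assms(3) by (simp add: D_def)

lemma D_regular:
  assumes "regular_on (carrier G) f"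
  shows "regular_on (carrier G) (D f)"
proof -
  obtain l where l: "separated l" "\<And>x y. x \<in> carrier G \<Longrightarrow> y \<in> carrier G \<Longrightarrow> f (x \<otimes> y) = sep_eval l x y"
    using regular_comultiplication[OF assms] by blast
  have r: "regular_on (carrier G) (snd q)" "regular_on (carrier G) (fst q)" if "q \<in> set l" for q
    using l(1) that by (auto simp: separated_def intro: regular_on_polynomial)
  have "D f x = (\<Sum>q\<leftarrow>l. fst q x * pairing (carrier G) \<one> v (snd q))" if x: "x \<in> carrier G" for x
  proof -
    have "D f x = pairing (carrier G) \<one> v (\<lambda>y. \<Sum>q\<leftarrow>l. fst q x * snd q y)"
      unfolding D_def by (rule pairing_cong) (use l(2)[OF x] in \<open>simp add: sep_eval_def\<close>)
    also have "\<dots> = (\<Sum>q\<leftarrow>l. fst q x * pairing (carrier G) \<one> v (snd q))"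
      by (rule pairing_sum_list[OF v one_closed]) (rule r)
    finally show ?thesis .
  qed
  moreover have "regular_on (carrier G) (\<lambda>x. \<Sum>q\<leftarrow>l. fst q x * pairing (carrier G) \<one> v (snd q))"
    by (intro regular_on_sum_list regular_on_intros r)
  ultimately show ?thesis using regular_on_cong by blast
qed

lemma D_power_regular: "regular_on (carrier G) f \<Longrightarrow> regular_on (carrier G) ((D ^^ k) f)"
  by (induction k) (auto intro: D_regular)

text \<open>Left invariance: differentiation in the second variable leaves the factors in
  \<open>x\<close> untouched.\<close>

lemma D_power_translate:
  assumes l: "separated l" "\<And>x y. x \<in> carrier G \<Longrightarrow> y \<in> carrier G \<Longrightarrow> f (x \<otimes> y) = sep_eval l x y"
    and x: "x \<in> carrier G" and y: "y \<in> carrier G"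
  shows "(D ^^ k) f (x \<otimes> y) = (\<Sum>q\<leftarrow>l. fst q x * (D ^^ k) (snd q) y)"
  using y
proof (induction k arbitrary: y)
  case 0
  then show ?case using l(2)[OF x] by (simp add: sep_eval_def)
next
  case (Suc k)
  have r: "regular_on (carrier G) (snd q)" if "q \<in> set l" for q
    using l(1) that by (auto simp: separated_def intro: regular_on_polynomial)
  have "(D ^^ Suc k) f (x \<otimes> y) = pairing (carrier G) \<one> v (\<lambda>z. (D ^^ k) f (x \<otimes> y \<otimes> z))"
    by (simp add: D_def)
  also have "\<dots> = pairing (carrier G) \<one> v (\<lambda>z. \<Sum>q\<leftarrow>l. fst q x * (D ^^ k) (snd q) (y \<otimes> z))"
    by (rule pairing_cong) (use Suc x in \<open>simp add: m_assoc\<close>)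
  also have "\<dots> = (\<Sum>q\<leftarrow>l. fst q x * pairing (carrier G) \<one> v (\<lambda>z. (D ^^ k) (snd q) (y \<otimes> z)))"
    by (rule pairing_sum_list[OF v one_closed]) (intro regular_translate D_power_regular r Suc.prems)
  also have "\<dots> = (\<Sum>q\<leftarrow>l. fst q x * (D ^^ Suc k) (snd q) y)"
    by (simp add: D_def)
  finally show ?case .
qed

lemma D_power_scale_add:
  assumes f: "regular_on (carrier G) f" and g: "regular_on (carrier G) g" and x: "x \<in> carrier G"
  shows "(D ^^ i) (\<lambda>x. c * f x + g x) x = c * (D ^^ i) f x + (D ^^ i) g x"
  using x
proof (induction i arbitrary: x)
  case (Suc i)
  have fi: "regular_on (carrier G) ((D ^^ i) f)" by (rule D_power_regular[OF f])
  have "(D ^^ Suc i) (\<lambda>x. c * f x + g x) x = D (\<lambda>x. c * (D ^^ i) f x + (D ^^ i) g x) x"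
    using D_cong[OF Suc.IH Suc.prems] by simp
  also have "\<dots> = D (\<lambda>x. c * (D ^^ i) f x) x + D ((D ^^ i) g) x"
    by (intro D_add regular_on_intros fi D_power_regular g Suc.prems)
  finally show ?case using D_scale[OF fi Suc.prems] by simp
qed simp

lemma D_power_zero: "(D ^^ k) (\<lambda>x. 0) = (\<lambda>x. 0)"
  by (induction k) (auto simp: D_const)

lemma D_power_linear:
  assumes "\<And>j. j \<in> J \<Longrightarrow> regular_on (carrier G) (f j)" "finite J" "x \<in> carrier G"
  shows "regular_on (carrier G) (\<lambda>x. \<Sum>j\<in>J. c j * f j x) \<and>
    (D ^^ i) (\<lambda>x. \<Sum>j\<in>J. c j * f j x) x = (\<Sum>j\<in>J. c j * (D ^^ i) (f j) x)"
  using assms(2,1)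
proof (induction J rule: finite_induct)
  case empty
  then show ?case by (simp add: D_power_zero regular_on_intros)
next
  case (insert j J)
  then have f: "regular_on (carrier G) (f j)" and g: "regular_on (carrier G) (\<lambda>x. \<Sum>j\<in>J. c j * f j x)"
    and IH: "(D ^^ i) (\<lambda>x. \<Sum>j\<in>J. c j * f j x) x = (\<Sum>j\<in>J. c j * (D ^^ i) (f j) x)"
    by simp_all
  show ?case
    using insert.hyps D_power_scale_add[OF f g assms(3), of i "c j"] IH
    by (simp add: regular_on_intros f g)
qed

text \<open>With the unit as \<open>y\<close> in \<open>D_power_translate\<close>, all
  \<open>(D ^^ k) f\<close> are combinations of the same \<open>N\<close> functions. A linear
  relation among the first \<open>N + 1\<close> of them, differentiated \<open>i\<close> times and
  evaluated at the unit, is a recurrence with constant coefficients.\<close>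

lemma D_power_bound:
  assumes "regular_on (carrier G) f"
  shows "\<exists>M K. 0 \<le> M \<and> 0 \<le> K \<and> (\<forall>k. norm ((D ^^ k) f \<one>) \<le> M * K ^ k)"
proof -
  obtain l where l: "separated l" "\<And>x y. x \<in> carrier G \<Longrightarrow> y \<in> carrier G \<Longrightarrow> f (x \<otimes> y) = sep_eval l x y"
    using regular_comultiplication[OF assms] by blast
  define N where "N = length l"
  have nth: "(\<Sum>q\<leftarrow>l. h q) = (\<Sum>j<N. h (l ! j))" for h :: "_ \<Rightarrow> complex"
    by (simp add: sum_list_sum_nth N_def atLeast0LessThan)
  \<comment> \<open>The \<open>N + 1\<close> coefficient vectors have only \<open>N\<close> entries
    each.\<close>
  have "\<exists>\<gamma>. (\<exists>k\<in>{..N}. \<gamma> k \<noteq> 0) \<and> (\<forall>j\<in>{..<N}. (\<Sum>k\<le>N. \<gamma> k * (D ^^ k) (snd (l ! j)) \<one>) = 0)"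
    by (rule linear_dependence) auto
  then obtain \<gamma> where \<gamma>: "\<exists>k\<in>{..N}. \<gamma> k \<noteq> 0"
    and dep: "\<And>j. j < N \<Longrightarrow> (\<Sum>k\<le>N. \<gamma> k * (D ^^ k) (snd (l ! j)) \<one>) = 0" by auto
  have zero: "(\<Sum>k\<le>N. \<gamma> k * (D ^^ k) f x) = 0" if x: "x \<in> carrier G" for x
  proof -
    have "(\<Sum>k\<le>N. \<gamma> k * (D ^^ k) f x) = (\<Sum>k\<le>N. \<gamma> k * (\<Sum>j<N. fst (l ! j) x * (D ^^ k) (snd (l ! j)) \<one>))"
      using D_power_translate[OF l x one_closed] x by (simp add: nth)
    also have "\<dots> = (\<Sum>j<N. fst (l ! j) x * (\<Sum>k\<le>N. \<gamma> k * (D ^^ k) (snd (l ! j)) \<one>))"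
      by (simp add: sum_distrib_left mult.left_commute) (rule sum.swap)
    also have "\<dots> = 0" by (simp add: dep)
    finally show ?thesis .
  qed
  show ?thesis
  proof (rule linear_recurrence_bound[OF \<gamma>])
    fix i
    have "(\<Sum>k\<le>N. \<gamma> k * (D ^^ (k + i)) f \<one>) = (\<Sum>k\<le>N. \<gamma> k * (D ^^ i) ((D ^^ k) f) \<one>)"
    proof -
      have "(D ^^ (k + i)) f = (D ^^ i) ((D ^^ k) f)" for k
        by (subst add.commute) (simp add: funpow_add)
      then show ?thesis by simp
    qed
    also have "\<dots> = (D ^^ i) (\<lambda>x. \<Sum>k\<le>N. \<gamma> k * (D ^^ k) f x) \<one>"
      by (rule D_power_linear[THEN conjunct2, symmetric]) (auto intro: D_power_regular assms)
    also have "\<dots> = (D ^^ i) (\<lambda>x. 0) \<one>"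
      by (rule D_power_cong) (auto simp: zero)
    also have "\<dots> = 0" by (simp add: D_power_zero)
    finally show "(\<Sum>k\<le>N. \<gamma> k * (D ^^ (k + i)) f \<one>) = 0" .
  qed
qed

end

section \<open>Entire curves in algebraic groups\<close>

text \<open>Entire functions of exponential type: a class closed under sums and products, yet so
  small that its members without zeros are exponentials of affine functions.\<close>

definition entire_exp :: "(complex \<Rightarrow> complex) \<Rightarrow> bool" where
  "entire_exp g \<longleftrightarrow> g holomorphic_on UNIV \<and> (\<exists>M K. \<forall>z. norm (g z) \<le> M * exp (K * norm z))"

lemma entire_expE:
  assumes "entire_exp g"
  obtains M K where "0 \<le> M" "0 \<le> K" "\<And>z. norm (g z) \<le> M * exp (K * norm z)"
proof -
  obtain M K where b: "\<And>z. norm (g z) \<le> M * exp (K * norm z)"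
    using assms unfolding entire_exp_def by blast
  have "norm (g z) \<le> \<bar>M\<bar> * exp (\<bar>K\<bar> * norm z)" for z
  proof -
    have "M * exp (K * norm z) \<le> \<bar>M\<bar> * exp (\<bar>K\<bar> * norm z)"
      by (intro mult_mono) (auto intro: mult_right_mono)
    then show ?thesis using b[of z] by linarith
  qed
  then show thesis by (intro that[of "\<bar>M\<bar>" "\<bar>K\<bar>"]) auto
qed

lemma entire_exp_const: "entire_exp (\<lambda>z. c)"
  unfolding entire_exp_def
  by (intro conjI holomorphic_on_const, rule exI[of _ "norm c"], rule exI[of _ 0]) simp

lemma entire_exp_add:
  assumes f: "entire_exp f" and g: "entire_exp g"
  shows "entire_exp (\<lambda>z. f z + g z)"
proof -
  obtain M K where 1: "0 \<le> M" "0 \<le> K" "\<And>z. norm (f z) \<le> M * exp (K * norm z)" using f by (rule entire_expE) blast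
  obtain M' K' where 2: "0 \<le> M'" "0 \<le> K'" "\<And>z. norm (g z) \<le> M' * exp (K' * norm z)" using g by (rule entire_expE) blast
  have "norm (f z + g z) \<le> (M + M') * exp ((K + K') * norm z)" for z
  proof -
    have "M * exp (K * norm z) \<le> M * exp ((K + K') * norm z)" "M' * exp (K' * norm z) \<le> M' * exp ((K + K') * norm z)"
      using 1 2 by (auto intro!: mult_left_mono mult_right_mono)
    then show ?thesis
      using norm_triangle_ineq[of "f z" "g z"] 1(3)[of z] 2(3)[of z] by (simp add: distrib_right)
  qed
  then show ?thesis using f g unfolding entire_exp_def by (blast intro: holomorphic_on_add)
qed

lemma entire_exp_mult:
  assumes f: "entire_exp f" and g: "entire_exp g"
  shows "entire_exp (\<lambda>z. f z * g z)"
proof -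
  obtain M K where 1: "0 \<le> M" "0 \<le> K" "\<And>z. norm (f z) \<le> M * exp (K * norm z)" using f by (rule entire_expE) blast
  obtain M' K' where 2: "0 \<le> M'" "0 \<le> K'" "\<And>z. norm (g z) \<le> M' * exp (K' * norm z)" using g by (rule entire_expE) blast
  have "norm (f z * g z) \<le> (M * M') * exp ((K + K') * norm z)" for z
  proof -
    have "norm (f z * g z) \<le> (M * exp (K * norm z)) * (M' * exp (K' * norm z))"
      unfolding norm_mult using 1 2 by (intro mult_mono) auto
    also have "\<dots> = (M * M') * exp ((K + K') * norm z)" by (simp add: distrib_right exp_add)
    finally show ?thesis .
  qed
  then show ?thesis using f g unfolding entire_exp_def by (blast intro: holomorphic_on_mult)
qed

lemma entire_exp_scale:
  assumes f: "entire_exp f"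
  shows "entire_exp (\<lambda>z. f (s * z))"
proof -
  obtain M K where 1: "0 \<le> M" "0 \<le> K" "\<And>z. norm (f z) \<le> M * exp (K * norm z)" using f by (rule entire_expE) blast
  have "norm (f (s * z)) \<le> M * exp ((K * norm s) * norm z)" for z
    using 1(3)[of "s * z"] by (simp add: norm_mult mult.assoc)
  moreover have "f \<circ> (\<lambda>z. s * z) holomorphic_on UNIV"
    using f unfolding entire_exp_def
    by (intro holomorphic_on_compose_gen[where t = UNIV]) (auto intro!: holomorphic_intros)
  ultimately show ?thesis unfolding entire_exp_def o_def by blast
qed

lemma entire_exp_sum_list:
  "(\<And>q. q \<in> set l \<Longrightarrow> entire_exp (f q)) \<Longrightarrow> entire_exp (\<lambda>z. \<Sum>q\<leftarrow>l. f q z)"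
  by (induction l) (simp_all add: entire_exp_const entire_exp_add)

lemma entire_exp_polynomial:
  assumes "p \<in> affine_polynomials" "\<And>i. entire_exp (\<lambda>z. c z $ i)"
  shows "entire_exp (\<lambda>z. p (c z))"
  using assms by (induction rule: affine_polynomials_induct) (simp_all add: entire_exp_const entire_exp_add entire_exp_mult)

text \<open>Comparison term by term with the series of \<open>M * exp (K * norm z)\<close>.\<close>

lemma entire_exp_power_series:
  fixes a :: "nat \<Rightarrow> complex"
  assumes "0 \<le> M" "0 \<le> K" and a: "\<And>k. norm (a k) \<le> M * K ^ k / fact k"
  shows "summable (\<lambda>k. norm (a k * z ^ k))" "entire_exp (\<lambda>z. suminf (\<lambda>k. a k * z ^ k))"
    "((\<lambda>z. suminf (\<lambda>k. a k * z ^ k)) has_field_derivative a 1) (at 0)"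
proof -
  have le: "norm (a k * z ^ k) \<le> M * (inverse (fact k) * (K * norm z) ^ k)" for k z
    using mult_right_mono[OF a[of k], of "norm z ^ k"] by (simp add: norm_mult norm_power power_mult_distrib field_simps)
  have s: "summable (\<lambda>k. M * (inverse (fact k) * (K * norm z) ^ k))" for z :: complex
    by (intro summable_mult summable_exp)
  show sn: "summable (\<lambda>k. norm (a k * z ^ k))" for z
    by (rule summable_comparison_test'[OF s[of z], of 0]) (use le[of _ z] in simp)
  then have sa: "summable (\<lambda>k. a k * z ^ k)" for z by (rule summable_norm_cancel)
  have deriv: "((\<lambda>z. suminf (\<lambda>k. a k * z ^ k)) has_field_derivative (suminf (\<lambda>k. diffs a k * z ^ k))) (at z)" for z
    by (rule termdiffs_strong_converges_everywhere) (rule sa)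
  then have hol: "(\<lambda>z. suminf (\<lambda>k. a k * z ^ k)) holomorphic_on UNIV"
    unfolding holomorphic_on_open[OF open_UNIV] by blast
  have "norm (suminf (\<lambda>k. a k * z ^ k)) \<le> M * exp (K * norm z)" for z
  proof -
    have "norm (suminf (\<lambda>k. a k * z ^ k)) \<le> (suminf (\<lambda>k. M * (inverse (fact k) * (K * norm z) ^ k)))"
      by (rule norm_suminf_le[OF le s])
    also have "\<dots> = M * exp (K * norm z)"
      by (subst suminf_mult[OF summable_exp]) (simp add: exp_def scaleR_conv_of_real)
    finally show ?thesis .
  qed
  then show "entire_exp (\<lambda>z. suminf (\<lambda>k. a k * z ^ k))" using hol unfolding entire_exp_def by blast
  have "(suminf (\<lambda>k. diffs a k * 0 ^ k)) = a 1" by (simp add: diffs_def)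
  then show "((\<lambda>z. suminf (\<lambda>k. a k * z ^ k)) has_field_derivative a 1) (at 0)" using deriv[of 0] by simp
qed

lemma has_derivative_vec:
  fixes f :: "'a::real_normed_vector \<Rightarrow> 'b::euclidean_space ^ 'n"
  assumes "\<And>i. ((\<lambda>t. f t $ i) has_derivative (\<lambda>h. f' h $ i)) (at a)"
  shows "(f has_derivative f') (at a)"
  by (subst has_derivative_componentwise_within)
     (auto simp: Basis_vec_def inner_axis intro!: has_derivative_inner_left assms)

context affine_group
begin

text \<open>These curves replace the one-parameter subgroups; unlike those they are closed under
  multiplication.\<close>

definition curves :: "(complex \<Rightarrow> complex ^ 'n) set" where
  "curves = {c. (\<forall>z. c z \<in> carrier G) \<and> c 0 = \<one> \<and> (\<forall>i. entire_exp (\<lambda>z. c z $ i))}"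

lemma regular_coordinate_mult:
  obtains l where "separated l" "\<And>x y. x \<in> carrier G \<Longrightarrow> y \<in> carrier G \<Longrightarrow> (x \<otimes> y) $ i = sep_eval l x y"
  using regular_comultiplication[OF regular_on_intros(2)[of "carrier G" i]] that by blast

lemma curves_regular:
  assumes "c \<in> curves" "regular_on (carrier G) f"
  shows "entire_exp (\<lambda>z. f (c z))"
proof -
  obtain p where p: "p \<in> affine_polynomials" "\<forall>x\<in>carrier G. f x = p x"
    using assms(2) unfolding regular_on_def by blast
  have "(\<lambda>z. f (c z)) = (\<lambda>z. p (c z))" using assms(1) p(2) by (auto simp: curves_def)
  then show ?thesis using entire_exp_polynomial[OF p(1), of c] assms(1) by (simp add: curves_def)
qed

lemma curves_mult:
  assumes c: "c \<in> curves" and d: "d \<in> curves"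
  shows "(\<lambda>z. c z \<otimes> d z) \<in> curves"
proof -
  have G: "c z \<in> carrier G" "d z \<in> carrier G" for z using c d by (auto simp: curves_def)
  have "entire_exp (\<lambda>z. (c z \<otimes> d z) $ i)" for i
  proof -
    obtain l where l: "separated l" "\<And>x y. x \<in> carrier G \<Longrightarrow> y \<in> carrier G \<Longrightarrow> (x \<otimes> y) $ i = sep_eval l x y"
      using regular_coordinate_mult[of i] by blast
    have p: "fst q \<in> affine_polynomials" "snd q \<in> affine_polynomials" if "q \<in> set l" for q
      using l(1) that by (auto simp: separated_def)
    have "entire_exp (\<lambda>z. fst q (c z) * snd q (d z))" if "q \<in> set l" for q
      using entire_exp_polynomial[OF p(1)[OF that], of c] entire_exp_polynomial[OF p(2)[OF that], of d] c d
      by (auto intro: entire_exp_mult simp: curves_def)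
    then show ?thesis by (simp add: l(2) G sep_eval_def entire_exp_sum_list)
  qed
  then show ?thesis using c d G by (auto simp: curves_def)
qed

lemma curves_inv:
  assumes c: "c \<in> curves"
  shows "(\<lambda>z. inv (c z)) \<in> curves"
proof -
  have G: "c z \<in> carrier G" for z using c by (auto simp: curves_def)
  have "entire_exp (\<lambda>z. (inv (c z)) $ i)" for i
  proof (rule curves_regular[OF c])
    show "regular_on (carrier G) (\<lambda>x. (inv x) $ i)"
      using affine unfolding affine_algebraic_group_def regular_on_def by blast
  qed
  then show ?thesis using c G by (auto simp: curves_def)
qed

lemma curves_scale: "c \<in> curves \<Longrightarrow> (\<lambda>z. c (s * z)) \<in> curves"
  using entire_exp_scale by (auto simp: curves_def)

lemma curves_one: "(\<lambda>z. \<one>) \<in> curves"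
  by (simp add: curves_def entire_exp_const)

text \<open>Separated variables write \<open>f (x \<otimes> y)\<close> as a sum of products. At 0
  both arguments are the unit, so each half of the product rule is the derivative of
  \<open>f\<close> along one of them alone.\<close>

lemma regular_product_derivative:
  fixes x y :: "'b::real_normed_vector \<Rightarrow> complex ^ 'n"
  assumes f: "regular_on (carrier G) f"
    and x: "\<And>t. x t \<in> carrier G" "x 0 = \<one>" "\<exists>X. (x has_derivative X) (at 0)" "((\<lambda>t. f (x t)) has_derivative X') (at 0)"
    and y: "\<And>t. y t \<in> carrier G" "y 0 = \<one>" "\<exists>Y. (y has_derivative Y) (at 0)" "((\<lambda>t. f (y t)) has_derivative Y') (at 0)"
  shows "((\<lambda>t. f (x t \<otimes> y t)) has_derivative (\<lambda>h. X' h + Y' h)) (at 0)"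
proof -
  obtain l where l: "separated l" "\<And>x y. x \<in> carrier G \<Longrightarrow> y \<in> carrier G \<Longrightarrow> f (x \<otimes> y) = sep_eval l x y"
    using regular_comultiplication[OF f] by blast
  have chain: "\<exists>P. ((\<lambda>t. p (u t)) has_derivative P) (at 0)"
    if p: "p \<in> affine_polynomials" and u: "\<exists>U. (u has_derivative U) (at 0)" for p and u :: "'b \<Rightarrow> complex ^ 'n"
  proof -
    obtain U where "(u has_derivative U) (at 0)" using u ..
    from has_derivative_compose[OF this point_deriv_has_derivative[OF p]]
    show ?thesis by (intro exI[of _ "\<lambda>x. point_deriv (u 0) (U x) p"])
  qed
  have "\<forall>q\<in>set l. \<exists>A. ((\<lambda>t. fst q (x t)) has_derivative A) (at 0)"
    using l(1) by (auto simp: separated_def intro!: chain x(3))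
  from bchoice[OF this] obtain A where A: "\<And>q. q \<in> set l \<Longrightarrow> ((\<lambda>t. fst q (x t)) has_derivative A q) (at 0)"
    by auto
  have "\<forall>q\<in>set l. \<exists>B. ((\<lambda>t. snd q (y t)) has_derivative B) (at 0)"
    using l(1) by (auto simp: separated_def intro!: chain y(3))
  from bchoice[OF this] obtain B where B: "\<And>q. q \<in> set l \<Longrightarrow> ((\<lambda>t. snd q (y t)) has_derivative B q) (at 0)"
    by auto
  have sum: "((\<lambda>t. \<Sum>q\<leftarrow>m. g q t) has_derivative (\<lambda>h. \<Sum>q\<leftarrow>m. g' q h)) (at 0)"
    if "\<And>q. q \<in> set m \<Longrightarrow> (g q has_derivative g' q) (at 0)" for m and g g' :: "_ \<Rightarrow> 'b \<Rightarrow> complex"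
    using that by (induction m) (auto intro!: derivative_eq_intros)
  \<comment> \<open>Freezing the other argument at the unit identifies \<open>X'\<close>, and then
    \<open>Y'\<close>, with one half of the product rule.\<close>
  have "((\<lambda>t. \<Sum>q\<leftarrow>l. fst q (x t) * snd q \<one>) has_derivative (\<lambda>h. \<Sum>q\<leftarrow>l. A q h * snd q \<one>)) (at 0)"
    by (intro sum has_derivative_mult_left A)
  moreover have "(\<lambda>t. \<Sum>q\<leftarrow>l. fst q (x t) * snd q \<one>) = (\<lambda>t. f (x t))"
    using l(2)[OF x(1) one_closed] x(1) by (simp add: sep_eval_def)
  ultimately have "((\<lambda>t. f (x t)) has_derivative (\<lambda>h. \<Sum>q\<leftarrow>l. A q h * snd q \<one>)) (at 0)" by simp
  from has_derivative_unique[OF x(4) this] have X: "X' = (\<lambda>h. \<Sum>q\<leftarrow>l. A q h * snd q \<one>)" .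
  have "((\<lambda>t. \<Sum>q\<leftarrow>l. fst q \<one> * snd q (y t)) has_derivative (\<lambda>h. \<Sum>q\<leftarrow>l. fst q \<one> * B q h)) (at 0)"
    by (intro sum has_derivative_mult_right B)
  moreover have "(\<lambda>t. \<Sum>q\<leftarrow>l. fst q \<one> * snd q (y t)) = (\<lambda>t. f (y t))"
    using l(2)[OF one_closed y(1)] y(1) by (simp add: sep_eval_def)
  ultimately have "((\<lambda>t. f (y t)) has_derivative (\<lambda>h. \<Sum>q\<leftarrow>l. fst q \<one> * B q h)) (at 0)" by simp
  from has_derivative_unique[OF y(4) this] have Y: "Y' = (\<lambda>h. \<Sum>q\<leftarrow>l. fst q \<one> * B q h)" .
  have "((\<lambda>t. \<Sum>q\<leftarrow>l. fst q (x t) * snd q (y t)) has_derivative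
      (\<lambda>h. \<Sum>q\<leftarrow>l. fst q (x 0) * B q h + A q h * snd q (y 0))) (at 0)"
    by (intro sum has_derivative_mult A B)
  moreover have "(\<lambda>t. \<Sum>q\<leftarrow>l. fst q (x t) * snd q (y t)) = (\<lambda>t. f (x t \<otimes> y t))"
    using l(2)[OF x(1) y(1)] by (simp add: sep_eval_def)
  moreover have "(\<lambda>h. \<Sum>q\<leftarrow>l. fst q (x 0) * B q h + A q h * snd q (y 0)) = (\<lambda>h. X' h + Y' h)"
    unfolding X Y x(2) y(2) by (simp add: sum_list_addf add.commute)
  ultimately show ?thesis by simp
qed

lemma continuous_mult:
  fixes x y :: "'b::topological_space \<Rightarrow> complex ^ 'n"
  assumes x: "continuous_on T x" "\<And>t. t \<in> T \<Longrightarrow> x t \<in> carrier G"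
    and y: "continuous_on T y" "\<And>t. t \<in> T \<Longrightarrow> y t \<in> carrier G"
  shows "continuous_on T (\<lambda>t. x t \<otimes> y t)"
proof -
  have "continuous_on T (\<lambda>t. (x t \<otimes> y t) $ i)" for i
  proof -
    obtain l where l: "separated l" "\<And>x y. x \<in> carrier G \<Longrightarrow> y \<in> carrier G \<Longrightarrow> (x \<otimes> y) $ i = sep_eval l x y"
      using regular_coordinate_mult[of i] by blast
    have "continuous_on T (\<lambda>t. \<Sum>q\<leftarrow>m. fst q (x t) * snd q (y t))" if "set m \<subseteq> set l" for m
      using that
    proof (induction m)
      case (Cons q m)
      then have "fst q \<in> affine_polynomials" "snd q \<in> affine_polynomials" using l(1) by (auto simp: separated_def)
      then have "continuous_on T (\<lambda>t. fst q (x t))" "continuous_on T (\<lambda>t. snd q (y t))"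
        using continuous_on_compose2[OF affine_polynomials_continuous x(1), of "fst q" UNIV]
          continuous_on_compose2[OF affine_polynomials_continuous y(1), of "snd q" UNIV] by auto
      then show ?case using Cons by (auto intro!: continuous_intros)
    qed simp
    from this[OF subset_refl] show ?thesis
      by (rule continuous_on_eq) (simp add: l(2) x(2) y(2) sep_eval_def)
  qed
  then have "continuous_on T (\<lambda>t. \<chi> i. (x t \<otimes> y t) $ i)" by (rule continuous_on_vec_lambda)
  then show ?thesis by simp
qed

lemma continuous_inv:
  fixes x :: "'b::topological_space \<Rightarrow> complex ^ 'n"
  assumes x: "continuous_on T x" "\<And>t. t \<in> T \<Longrightarrow> x t \<in> carrier G"
  shows "continuous_on T (\<lambda>t. inv (x t))"
proof -
  have "continuous_on T (\<lambda>t. (inv (x t)) $ i)" for i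
  proof -
    obtain p where p: "p \<in> affine_polynomials" "\<forall>x\<in>carrier G. (inv x) $ i = p x"
      using affine unfolding affine_algebraic_group_def by blast
    have "continuous_on T (\<lambda>t. p (x t))"
      using continuous_on_compose2[OF affine_polynomials_continuous[OF p(1), of UNIV] x(1)] by simp
    then show ?thesis by (rule continuous_on_eq) (simp add: p(2) x(2))
  qed
  then have "continuous_on T (\<lambda>t. \<chi> i. (inv (x t)) $ i)" by (rule continuous_on_vec_lambda)
  then show ?thesis by simp
qed

end

section \<open>Exponential curves\<close>

context tangent_vector
begin

text \<open>The exponential \<open>exp (z D)\<close>, evaluated at the unit, is an algebra homomorphism by the Leibniz
  rule, hence the evaluation at a point of the group.\<close>

definition taylor :: "(complex ^ 'n \<Rightarrow> complex) \<Rightarrow> nat \<Rightarrow> complex" where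
  "taylor f k = (D ^^ k) f \<one> / fact k"

definition flow :: "(complex ^ 'n \<Rightarrow> complex) \<Rightarrow> complex \<Rightarrow> complex" where
  "flow f z = (suminf (\<lambda>k. taylor f k * z ^ k))"

lemma flow_props:
  assumes "regular_on (carrier G) f"
  shows "summable (\<lambda>k. norm (taylor f k * z ^ k))" "entire_exp (flow f)"
    "(flow f has_field_derivative D f \<one>) (at 0)" "flow f 0 = f \<one>"
proof -
  obtain M K where MK: "0 \<le> M" "0 \<le> K" "\<And>k. norm ((D ^^ k) f \<one>) \<le> M * K ^ k"
    using D_power_bound[OF assms] by blast
  have "norm (taylor f k) \<le> M * K ^ k / fact k" for k
    using MK(3)[of k] by (simp add: taylor_def norm_divide divide_right_mono)
  note ps = entire_exp_power_series[OF MK(1,2) this]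
  show "summable (\<lambda>k. norm (taylor f k * z ^ k))" by (rule ps(1))
  have eta: "flow f = (\<lambda>z. suminf (\<lambda>k. taylor f k * z ^ k))" by (rule ext) (rule flow_def)
  show "entire_exp (flow f)" unfolding eta by (rule ps(2))
  have "taylor f 1 = D f \<one>" by (simp add: taylor_def)
  then show "(flow f has_field_derivative D f \<one>) (at 0)" unfolding eta using ps(3) by simp
  show "flow f 0 = f \<one>" 
    unfolding flow_def powser_zero by (simp add: taylor_def)
qed

text \<open>The Leibniz rule with divided powers, the shape in which it matches the Cauchy product
  of Taylor series.\<close>

lemma D_power_mult:
  assumes f: "regular_on (carrier G) f" and g: "regular_on (carrier G) g" and x: "x \<in> carrier G"
  shows "(D ^^ k) (\<lambda>x. f x * g x) x = fact k * (\<Sum>i\<le>k. ((D ^^ i) f x / fact i) * ((D ^^ (k - i)) g x / fact (k - i)))"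
  using x
proof (induction k arbitrary: x)
  case (Suc k)
  define A where "A i x = (D ^^ i) f x / fact i" for i x
  define B where "B i x = (D ^^ i) g x / fact i" for i x
  have rA: "regular_on (carrier G) (A i)" and rB: "regular_on (carrier G) (B i)" for i
  proof -
    have "regular_on (carrier G) (\<lambda>x. (1 / fact i) * (D ^^ i) f x)" "regular_on (carrier G) (\<lambda>x. (1 / fact i) * (D ^^ i) g x)"
      by (intro regular_on_intros D_power_regular f g)+
    then show "regular_on (carrier G) (A i)" "regular_on (carrier G) (B i)"
      by (simp_all add: A_def[abs_def] B_def[abs_def])
  qed
  have DA: "D (A i) x = of_nat (Suc i) * A (Suc i) x" and DB: "D (B i) x = of_nat (Suc i) * B (Suc i) x" for i
  proof -
    have "D (\<lambda>x. (1 / fact i) * (D ^^ i) f x) x = (1 / fact i) * D ((D ^^ i) f) x"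
      "D (\<lambda>x. (1 / fact i) * (D ^^ i) g x) x = (1 / fact i) * D ((D ^^ i) g) x"
      by (intro D_scale D_power_regular f g Suc.prems)+
    then show "D (A i) x = of_nat (Suc i) * A (Suc i) x" "D (B i) x = of_nat (Suc i) * B (Suc i) x"
      by (simp_all add: A_def[abs_def] B_def[abs_def] field_simps del: of_nat_Suc)
  qed
  let ?S = "\<Sum>i\<le>Suc k. A i x * B (Suc k - i) x"
  have "(D ^^ Suc k) (\<lambda>x. f x * g x) x = D (\<lambda>x. \<Sum>i\<le>k. fact k * (A i x * B (k - i) x)) x"
    using D_cong[OF Suc.IH Suc.prems] by (simp add: A_def B_def sum_distrib_left)
  also have "\<dots> = (\<Sum>i\<le>k. fact k * D (\<lambda>x. A i x * B (k - i) x) x)"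
    using D_power_linear[of "{..k}" "\<lambda>i x. A i x * B (k - i) x" x "\<lambda>_. fact k" 1] Suc.prems
    by (simp add: regular_on_intros rA rB)
  also have "\<dots> = fact k * ((\<Sum>i\<le>k. of_nat (Suc k - i) * (A i x * B (Suc k - i) x)) + (\<Sum>i\<le>k. of_nat (Suc i) * (A (Suc i) x * B (k - i) x)))"
    unfolding sum_distrib_left sum.distrib[symmetric]
  proof (intro sum.cong refl)
    fix i assume "i \<in> {..k}"
    then have "Suc k - i = Suc (k - i)" by (simp add: Suc_diff_le)
    then show "fact k * D (\<lambda>x. A i x * B (k - i) x) x = fact k * (of_nat (Suc k - i) * (A i x * B (Suc k - i) x) + of_nat (Suc i) * (A (Suc i) x * B (k - i) x))"
      unfolding D_mult[OF rA rB Suc.prems] DA DB by (simp add: algebra_simps del: of_nat_Suc)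
  qed
  \<comment> \<open>Both sums are brought to the range \<open>i \<le> Suc k\<close> by a term of
    weight 0; the weights \<open>Suc k - i\<close> and \<open>i\<close> then add up to
    \<open>Suc k\<close>.\<close>
  also have "(\<Sum>i\<le>k. of_nat (Suc k - i) * (A i x * B (Suc k - i) x)) = (\<Sum>i\<le>Suc k. of_nat (Suc k - i) * (A i x * B (Suc k - i) x))"
    by simp
  also have "(\<Sum>i\<le>k. of_nat (Suc i) * (A (Suc i) x * B (k - i) x)) = (\<Sum>i\<le>Suc k. of_nat i * (A i x * B (Suc k - i) x))"
    by (subst sum.atMost_Suc_shift) simp
  also have "(\<Sum>i\<le>Suc k. of_nat (Suc k - i) * (A i x * B (Suc k - i) x)) + (\<Sum>i\<le>Suc k. of_nat i * (A i x * B (Suc k - i) x))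
      = of_nat (Suc k) * ?S"
    unfolding sum_distrib_left sum.distrib[symmetric]
  proof (intro sum.cong refl)
    fix i assume "i \<in> {..Suc k}"
    then have "of_nat (Suc k - i) + of_nat i = (of_nat (Suc k) :: complex)"
      by (metis atMost_iff le_add_diff_inverse2 of_nat_add)
    then show "of_nat (Suc k - i) * (A i x * B (Suc k - i) x) + of_nat i * (A i x * B (Suc k - i) x) = of_nat (Suc k) * (A i x * B (Suc k - i) x)"
      by (metis distrib_right)
  qed
  also have "fact k * (of_nat (Suc k) * ?S) = fact (Suc k) * ?S" by (simp add: algebra_simps)
  finally show ?case by (simp only: A_def B_def)
qed simp

lemma flow_add:
  assumes f: "regular_on (carrier G) f" and g: "regular_on (carrier G) g"
  shows "flow (\<lambda>x. f x + g x) z = flow f z + flow g z"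
proof -
  have "taylor (\<lambda>x. f x + g x) k = taylor f k + taylor g k" for k
    using D_power_scale_add[OF f g one_closed, of k 1] by (simp add: taylor_def add_divide_distrib)
  then show ?thesis
    unfolding flow_def
    using suminf_add[OF summable_norm_cancel[OF flow_props(1)[OF f]] summable_norm_cancel[OF flow_props(1)[OF g]], of z z]
    by (simp add: distrib_right)
qed

lemma flow_mult:
  assumes f: "regular_on (carrier G) f" and g: "regular_on (carrier G) g"
  shows "flow (\<lambda>x. f x * g x) z = flow f z * flow g z"
proof -
  have "taylor (\<lambda>x. f x * g x) k * z ^ k = (\<Sum>i\<le>k. (taylor f i * z ^ i) * (taylor g (k - i) * z ^ (k - i)))" for k
  proof -
    have "taylor (\<lambda>x. f x * g x) k = (\<Sum>i\<le>k. taylor f i * taylor g (k - i))"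
      using D_power_mult[OF f g one_closed, of k] by (simp add: taylor_def)
    moreover have "z ^ k = z ^ i * z ^ (k - i)" if "i \<in> {..k}" for i
      using that by (simp add: power_add[symmetric])
    ultimately show ?thesis by (simp add: sum_distrib_right) (intro sum.cong refl, simp add: mult_ac)
  qed
  then show ?thesis
    unfolding flow_def using Cauchy_product[OF flow_props(1)[OF f, of z] flow_props(1)[OF g, of z]] by simp
qed

lemma flow_const: "flow (\<lambda>x. c) z = c"
proof -
  have "(D ^^ k) (\<lambda>x. c) = (if k = 0 then (\<lambda>x. c) else (\<lambda>x. 0))" for k
    by (induction k) (auto simp: D_const)
  then have "taylor (\<lambda>x. c) k * z ^ k = (if k = 0 then c else 0)" for k
    by (simp add: taylor_def)
  then show ?thesis
    unfolding flow_def using suminf_finite[of "{0}" "\<lambda>k::nat. if k = 0 then c else 0"] by simp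
qed

definition expc :: "complex \<Rightarrow> complex ^ 'n" where
  "expc z = (\<chi> i. flow (\<lambda>x. x $ i) z)"

lemma flow_polynomial: "p \<in> affine_polynomials \<Longrightarrow> flow p z = p (expc z)"
proof (induction rule: affine_polynomials_induct)
  case (add f g)
  then show ?case using flow_add[OF regular_on_polynomial regular_on_polynomial] by simp
next
  case (mult f g)
  then show ?case using flow_mult[OF regular_on_polynomial regular_on_polynomial] by simp
qed (simp_all add: flow_const expc_def)

text \<open>\<open>D\<close> sees only values on the group, so a defining equation has zero Taylor
  series, and its value at \<open>expc z\<close> is the sum of that series.\<close>

lemma expc_in_carrier: "expc z \<in> carrier G"
proof -
  obtain P where P: "P \<subseteq> affine_polynomials" "carrier G = {x. \<forall>p\<in>P. p x = 0}"
    using zariski unfolding zariski_closed_def by blast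
  have "p (expc z) = 0" if p: "p \<in> P" for p
  proof -
    have p0: "p x = 0" if "x \<in> carrier G" for x using that p unfolding P(2) by blast
    have "taylor p k = 0" for k
      using D_power_cong[where k = k, OF p0 one_closed] by (simp add: taylor_def D_power_zero)
    then have "flow p z = 0" by (simp add: flow_def)
    then show ?thesis using flow_polynomial[of p z] p P(1) by auto
  qed
  then show ?thesis unfolding P(2) by blast
qed

lemma expc_curve: "expc \<in> curves"
proof -
  have "expc 0 = \<one>" by (simp add: expc_def flow_props(4)[OF regular_on_intros(2)])
  then show ?thesis
    using flow_props(2)[OF regular_on_intros(2)] expc_in_carrier by (simp add: curves_def expc_def)
qed

lemma expc_derivative: "((\<lambda>z. expc z $ i) has_field_derivative v $ i) (at 0)"
proof -
  have "D (\<lambda>x. x $ i) \<one> = pairing (carrier G) \<one> v (\<lambda>y. y $ i)"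
    unfolding D_def by (rule pairing_cong) simp
  then have "D (\<lambda>x. x $ i) \<one> = v $ i" by (simp add: pairing_simps[OF v one_closed])
  moreover have "(\<lambda>z. expc z $ i) = flow (\<lambda>x. x $ i)" by (simp add: expc_def)
  ultimately show ?thesis using flow_props(3)[OF regular_on_intros(2), of i] by simp
qed

end

section \<open>Covering a connected group by curves\<close>

lemma point_deriv_difference:
  fixes p :: "complex ^ 'n \<Rightarrow> complex"
  assumes qc: "\<And>i. continuous_on UNIV (\<lambda>z. q i (fst z) (snd z))"
    and q: "\<And>x y. p x - p y = (\<Sum>i\<in>UNIV. q i x y * (x $ i - y $ i))"
  shows "point_deriv a v p = (\<Sum>i\<in>UNIV. q i a a * v $ i)"
proof (rule point_deriv_eqI)
  let ?L = "\<lambda>v. \<Sum>i\<in>UNIV. q i a a * v $ i"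
  show "(p has_derivative ?L) (at a)"
    unfolding has_derivative_at_within
  proof
    show "bounded_linear ?L"
      by (intro bounded_linear_sum bounded_linear_compose[OF bounded_linear_mult_right bounded_linear_vec_nth])
    \<comment> \<open>The error of the linearisation is controlled by the variation of the
      difference quotients near the diagonal.\<close>
    have "((\<lambda>y. \<Sum>i\<in>UNIV. norm (q i y a - q i a a)) \<longlongrightarrow> (\<Sum>i\<in>(UNIV :: 'n set). norm (q i a a - q i a a))) (at a)"
    proof (intro tendsto_sum tendsto_norm tendsto_diff tendsto_const)
      fix i
      have "isCont (\<lambda>z. q i (fst z) (snd z)) (a, a)"
        using qc[of i] by (simp add: continuous_on_eq_continuous_at)
      from isCont_tendsto_compose[OF this tendsto_Pair[OF tendsto_ident_at tendsto_const]]
      show "((\<lambda>y. q i y a) \<longlongrightarrow> q i a a) (at a)" by simp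
    qed
    then have lim: "((\<lambda>y. \<Sum>i\<in>UNIV. norm (q i y a - q i a a)) \<longlongrightarrow> 0) (at a)" by simp
    have "norm ((p y - p a - ?L (y - a)) /\<^sub>R norm (y - a)) \<le> (\<Sum>i\<in>UNIV. norm (q i y a - q i a a))" for y
    proof -
      have "p y - p a - ?L (y - a) = (\<Sum>i\<in>UNIV. (q i y a - q i a a) * (y - a) $ i)"
        unfolding q by (simp add: sum_subtractf left_diff_distrib)
      also have "norm \<dots> \<le> (\<Sum>i\<in>UNIV. norm (q i y a - q i a a) * norm (y - a))"
        by (rule order_trans[OF norm_sum sum_mono])
           (simp only: norm_mult, intro mult_left_mono Finite_Cartesian_Product.norm_nth_le norm_ge_zero)
      finally have "norm (p y - p a - ?L (y - a)) \<le> (\<Sum>i\<in>UNIV. norm (q i y a - q i a a)) * norm (y - a)"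
        by (simp add: sum_distrib_right)
      then show ?thesis
        by (cases "y = a") (auto simp: divide_simps sum_nonneg mult.commute)
    qed
    then show "((\<lambda>y. (p y - p a - ?L (y - a)) /\<^sub>R norm (y - a)) \<longlongrightarrow> 0) (at a)"
      by (intro Lim_null_comparison[OF always_eventually lim] allI)
  qed
qed

text \<open>Otherwise pairs of distinct points of \<open>V\<close> tend to \<open>a\<close> with
  unit secants orthogonal to the tangent space. A limit of these secants is orthogonal as well, but
  also tangent, because a polynomial vanishing on \<open>V\<close> has difference 0 along each
  secant; a unit vector cannot be both. This takes the place of an implicit function
  theorem.\<close>

lemma tangent_injective:
  fixes V :: "(complex ^ 'n) set"
  assumes a: "a \<in> V"
  obtains \<delta> where "0 < \<delta>"
    "\<And>x y. x \<in> V \<Longrightarrow> y \<in> V \<Longrightarrow> dist x a < \<delta> \<Longrightarrow> dist y a < \<delta> \<Longrightarrow>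
      (\<And>w. w \<in> tangent_space V a \<Longrightarrow> (x - y) \<bullet> w = 0) \<Longrightarrow> x = y"
proof -
  let ?T = "tangent_space V a"
  have "\<exists>\<delta>>0. \<forall>x\<in>V. \<forall>y\<in>V. dist x a < \<delta> \<longrightarrow> dist y a < \<delta> \<longrightarrow> (\<forall>w\<in>?T. (x - y) \<bullet> w = 0) \<longrightarrow> x = y"
  proof (rule ccontr)
    assume contra: "\<not> ?thesis"
    have "\<forall>n::nat. \<exists>x y. x \<in> V \<and> y \<in> V \<and> dist x a < inverse (of_nat (Suc n)) \<and> dist y a < inverse (of_nat (Suc n))
        \<and> (\<forall>w\<in>?T. (x - y) \<bullet> w = 0) \<and> x \<noteq> y"
    proof
      fix n
      have "inverse (of_nat (Suc n)) > (0::real)" by simp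
      then show "\<exists>x y. x \<in> V \<and> y \<in> V \<and> dist x a < inverse (of_nat (Suc n)) \<and> dist y a < inverse (of_nat (Suc n))
        \<and> (\<forall>w\<in>?T. (x - y) \<bullet> w = 0) \<and> x \<noteq> y" using contra by blast
    qed
    from choice[OF this] obtain x where
      "\<forall>n. \<exists>y. x n \<in> V \<and> y \<in> V \<and> dist (x n) a < inverse (of_nat (Suc n)) \<and> dist y a < inverse (of_nat (Suc n))
        \<and> (\<forall>w\<in>?T. (x n - y) \<bullet> w = 0) \<and> x n \<noteq> y" by blast
    from choice[OF this] obtain y where
      "\<forall>n. x n \<in> V \<and> y n \<in> V \<and> dist (x n) a < inverse (of_nat (Suc n)) \<and> dist (y n) a < inverse (of_nat (Suc n))
        \<and> (\<forall>w\<in>?T. (x n - y n) \<bullet> w = 0) \<and> x n \<noteq> y n" by blast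
    then have xy: "\<And>n. x n \<in> V" "\<And>n. y n \<in> V"
      "\<And>n. dist (x n) a < inverse (of_nat (Suc n))" "\<And>n. dist (y n) a < inverse (of_nat (Suc n))"
      "\<And>n w. w \<in> ?T \<Longrightarrow> (x n - y n) \<bullet> w = 0" "\<And>n. x n \<noteq> y n"
      by simp_all
    have lim: "z \<longlonglongrightarrow> a" if z: "\<And>n. dist (z n) a < inverse (of_nat (Suc n))" for z :: "nat \<Rightarrow> complex ^ 'n"
    proof -
      have "(\<lambda>n. dist (z n) a) \<longlonglongrightarrow> 0"
      proof (rule tendsto_sandwich[OF _ _ tendsto_const LIMSEQ_inverse_real_of_nat])
        show "\<forall>\<^sub>F n in sequentially. dist (z n) a \<le> inverse (real (Suc n))"
          by (intro always_eventually allI less_imp_le[OF z])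
      qed simp
      then show ?thesis by (subst tendsto_dist_iff)
    qed
    have lx: "x \<longlonglongrightarrow> a" using xy(3) by (rule lim)
    have ly: "y \<longlonglongrightarrow> a" using xy(4) by (rule lim)
    define u where "u n = (x n - y n) /\<^sub>R norm (x n - y n)" for n
    have us: "\<forall>n. u n \<in> sphere 0 1" using xy(6) by (simp add: u_def)
    have "\<forall>f. (\<forall>n::nat. f n \<in> sphere (0::complex ^ 'n) 1) \<longrightarrow> (\<exists>l\<in>sphere 0 1. \<exists>r :: nat \<Rightarrow> nat. strict_mono r \<and> (f \<circ> r) \<longlonglongrightarrow> l)"
      using compact_sphere[of "0::complex ^ 'n" 1] by (simp only: compact_def)
    from mp[OF spec[OF this] us]
    obtain l r where l: "l \<in> sphere 0 1" and r: "strict_mono r" and ul: "(u \<circ> r) \<longlonglongrightarrow> l"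
      by blast
    have perp: "l \<bullet> w = 0" if w: "w \<in> ?T" for w
    proof -
      have "(\<lambda>n. (u \<circ> r) n \<bullet> w) \<longlonglongrightarrow> l \<bullet> w" by (intro tendsto_inner ul tendsto_const)
      moreover have "(u \<circ> r) n \<bullet> w = 0" for n using xy(5)[OF w] by (simp add: u_def)
      ultimately show ?thesis by (simp add: LIMSEQ_const_iff)
    qed
    have "l \<in> ?T"
      unfolding tangent_space_def
    proof (intro CollectI ballI impI)
      fix p :: "complex ^ 'n \<Rightarrow> complex"
      assume p: "p \<in> affine_polynomials" and p0: "\<forall>x\<in>V. p x = 0"
      obtain q where qc: "\<And>i. continuous_on UNIV (\<lambda>z. q i (fst z) (snd z))"
        and q: "\<And>x y. p x - p y = (\<Sum>i\<in>UNIV. q i x y * (x $ i - y $ i))"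
        using affine_polynomials_difference[OF p] by blast
      have qlim: "(\<lambda>n. q i (f n) (g n)) \<longlonglongrightarrow> q i a a" if "f \<longlonglongrightarrow> a" "g \<longlonglongrightarrow> a" for f g i
      proof -
        have "isCont (\<lambda>z. q i (fst z) (snd z)) (a, a)"
          using qc[of i] by (simp add: continuous_on_eq_continuous_at)
        from isCont_tendsto_compose[OF this tendsto_Pair[OF that]] show ?thesis by simp
      qed
      have "(\<lambda>n. \<Sum>i\<in>UNIV. q i (x (r n)) (y (r n)) * ((u \<circ> r) n $ i)) \<longlonglongrightarrow> (\<Sum>i\<in>UNIV. q i a a * l $ i)"
        by (intro tendsto_sum tendsto_mult qlim tendsto_vec_nth ul
              LIMSEQ_subseq_LIMSEQ[OF lx r, unfolded o_def] LIMSEQ_subseq_LIMSEQ[OF ly r, unfolded o_def])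
      moreover have "(\<Sum>i\<in>UNIV. q i (x m) (y m) * (u m $ i)) = 0" for m
      proof -
        have "(\<Sum>i\<in>UNIV. q i (x m) (y m) * (u m $ i)) = (p (x m) - p (y m)) /\<^sub>R norm (x m - y m)"
          unfolding q scaleR_sum_right by (intro sum.cong refl) (simp add: u_def)
        then show ?thesis using p0 xy(1,2) by simp
      qed
      ultimately have s0: "(\<Sum>i\<in>UNIV. q i a a * l $ i) = 0" by (simp add: LIMSEQ_const_iff)
      then show "point_deriv a l p = 0" using point_deriv_difference[OF qc q, of a l] by simp
    qed
    then have "l \<bullet> l = 0" by (rule perp)
    then show False using l by simp
  qed
  then show thesis using that by blast
qed

context tangent_vector
begin

lemma continuous_expc: "continuous_on UNIV (\<lambda>t :: complex ^ 'n. expc (of_real (t \<bullet> v)))"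
proof -
  have "continuous_on UNIV (\<lambda>z. expc z $ i)" for i
    using expc_curve unfolding curves_def entire_exp_def by (auto intro: holomorphic_on_imp_continuous_on)
  then have "continuous_on UNIV (\<lambda>t :: complex ^ 'n. expc (of_real (t \<bullet> v)) $ i)" for i
    by (rule continuous_on_compose2) (auto intro!: continuous_intros)
  then have "continuous_on UNIV (\<lambda>t :: complex ^ 'n. \<chi> i. expc (of_real (t \<bullet> v)) $ i)"
    by (rule continuous_on_vec_lambda)
  then show ?thesis by simp
qed

lemma has_derivative_expc:
  "((\<lambda>t :: complex ^ 'n. expc (of_real (t \<bullet> v))) has_derivative (\<lambda>h. (h \<bullet> v) *\<^sub>R v)) (at 0)"
proof (rule has_derivative_vec)
  fix i
  have 1: "((\<lambda>t :: complex ^ 'n. complex_of_real (t \<bullet> v)) has_derivative (\<lambda>h. of_real (h \<bullet> v))) (at 0)"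
    by (intro bounded_linear.has_derivative[OF bounded_linear_of_real] bounded_linear.has_derivative[OF bounded_linear_inner_left] has_derivative_ident)
  have 2: "((\<lambda>z. expc z $ i) has_derivative (*) (v $ i)) (at (complex_of_real (0 \<bullet> v)))"
    using expc_derivative[of i] by (simp add: has_field_derivative_def)
  from has_derivative_compose[OF 1 2]
  show "((\<lambda>t. expc (of_real (t \<bullet> v)) $ i) has_derivative (\<lambda>h. ((h \<bullet> v) *\<^sub>R v) $ i)) (at 0)"
    by (simp add: scaleR_conv_of_real[where 'a = complex] mult.commute)
qed

end

context affine_group
begin

text \<open>The coordinate \<open>t \<bullet> v\<close> sets the speed of the exponential curve in
  direction \<open>v\<close>, so that \<open>\<Psi> t\<close> is the point at time 1 of a product of
  curves. For orthonormal vectors the derivative is the orthogonal projection onto their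
  span.\<close>

lemma product_map:
  assumes "set vs \<subseteq> tangent_space (carrier G) \<one>"
  obtains \<Psi> :: "complex ^ 'n \<Rightarrow> complex ^ 'n" where "\<And>t. \<exists>c\<in>curves. c 1 = \<Psi> t" "continuous_on UNIV \<Psi>"
    "\<Psi> 0 = \<one>" "(\<Psi> has_derivative (\<lambda>h. \<Sum>v\<leftarrow>vs. (h \<bullet> v) *\<^sub>R v)) (at 0)"
proof -
  have "\<exists>\<Psi> :: complex ^ 'n \<Rightarrow> complex ^ 'n. (\<forall>t. \<exists>c\<in>curves. c 1 = \<Psi> t) \<and> continuous_on UNIV \<Psi> \<and>
    \<Psi> 0 = \<one> \<and> (\<Psi> has_derivative (\<lambda>h. \<Sum>v\<leftarrow>vs. (h \<bullet> v) *\<^sub>R v)) (at 0)"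
    using assms
  proof (induction vs)
    case Nil
    show ?case by (intro exI[of _ "\<lambda>t. \<one>"]) (auto intro: bexI[OF _ curves_one])
  next
    case (Cons v vs)
    then obtain \<Psi> :: "complex ^ 'n \<Rightarrow> complex ^ 'n" where \<Psi>: "\<forall>t. \<exists>c\<in>curves. c 1 = \<Psi> t" "continuous_on UNIV \<Psi>"
      "\<Psi> 0 = \<one>" "(\<Psi> has_derivative (\<lambda>h. \<Sum>v\<leftarrow>vs. (h \<bullet> v) *\<^sub>R v)) (at 0)" by auto
    have \<Psi>G: "\<Psi> t \<in> carrier G" for t
    proof -
      obtain c where c: "c \<in> curves" "c 1 = \<Psi> t" using \<Psi>(1) by blast
      have "c 1 \<in> carrier G" using c(1) by (simp add: curves_def)
      then show ?thesis unfolding c(2) .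
    qed
    interpret tv: tangent_vector G v using Cons.prems by unfold_locales simp
    define x where "x t = tv.expc (of_real (t \<bullet> v))" for t
    have x: "continuous_on UNIV x" "(x has_derivative (\<lambda>h. (h \<bullet> v) *\<^sub>R v)) (at 0)"
      using tv.continuous_expc tv.has_derivative_expc by (simp_all add: x_def[abs_def])
    have xG: "x t \<in> carrier G" for t by (simp add: x_def tv.expc_in_carrier)
    have x0: "x 0 = \<one>" using tv.expc_curve by (simp add: x_def curves_def)
    show ?case
    proof (intro exI[of _ "\<lambda>t. x t \<otimes> \<Psi> t"] conjI allI)
      fix t
      obtain c where c: "c \<in> curves" "c 1 = \<Psi> t" using \<Psi>(1) by blast
      have "(\<lambda>z. tv.expc (of_real (t \<bullet> v) * z) \<otimes> c z) \<in> curves"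
        by (intro curves_mult curves_scale tv.expc_curve c)
      then show "\<exists>c\<in>curves. c 1 = x t \<otimes> \<Psi> t" by (rule bexI[rotated]) (simp add: x_def c)
    next
      show "continuous_on UNIV (\<lambda>t. x t \<otimes> \<Psi> t)" by (intro continuous_mult x \<Psi> xG \<Psi>G)
      show "x 0 \<otimes> \<Psi> 0 = \<one>" by (simp add: x0 \<Psi>(3))
      show "((\<lambda>t. x t \<otimes> \<Psi> t) has_derivative (\<lambda>h. \<Sum>v\<leftarrow>v # vs. (h \<bullet> v) *\<^sub>R v)) (at 0)"
      proof (rule has_derivative_vec)
        fix i
        have comp: "((\<lambda>t. f t $ i) has_derivative (\<lambda>h. f' h $ i)) (at 0)" if "(f has_derivative f') (at 0)"
          for f f' :: "complex ^ 'n \<Rightarrow> complex ^ 'n"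
          using bounded_linear.has_derivative[OF bounded_linear_vec_nth that] .
        have "((\<lambda>t. (x t \<otimes> \<Psi> t) $ i) has_derivative
           (\<lambda>h. ((h \<bullet> v) *\<^sub>R v) $ i + (\<Sum>v\<leftarrow>vs. (h \<bullet> v) *\<^sub>R v) $ i)) (at 0)"
        proof (rule regular_product_derivative[OF regular_on_intros(2) xG x0 _ comp[OF x(2)] \<Psi>G \<Psi>(3) _ comp[OF \<Psi>(4)]])
          show "\<exists>X. (x has_derivative X) (at 0)" using x(2) by blast
          show "\<exists>X. (\<Psi> has_derivative X) (at 0)" using \<Psi>(4) by blast
        qed
        then show "((\<lambda>t. (x t \<otimes> \<Psi> t) $ i) has_derivative (\<lambda>h. (\<Sum>v\<leftarrow>v # vs. (h \<bullet> v) *\<^sub>R v) $ i)) (at 0)"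
          by simp
      qed
    qed
  qed
  then show thesis using that by blast
qed

text \<open>By Brouwer's theorem the products of the exponential curves attain all small tangential
  coordinates, and near the unit a point of the group is determined by its tangential coordinates.\<close>

lemma curves_cover_near_one:
  "\<exists>\<rho>>0. \<forall>g\<in>carrier G. dist g \<one> < \<rho> \<longrightarrow> (\<exists>c\<in>curves. c 1 = g)"
proof -
  let ?T = "tangent_space (carrier G) \<one>"
  obtain B where B: "B \<subseteq> ?T" "pairwise orthogonal B" "\<And>x. x \<in> B \<Longrightarrow> norm x = 1" "independent B" "span B = ?T"
    using orthonormal_basis_subspace[OF subspace_tangent_space] by metis
  have finB: "finite B" using B(4) by (rule independent_imp_finite)
  obtain vs where vs: "set vs = B" "distinct vs" using finite_distinct_list[OF finB] by blast
  \<comment> \<open>\<open>B\<close> is orthonormal, so this is the orthogonal projection onto the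
    tangent space; it is also the derivative of \<open>\<Psi>\<close> at 0.\<close>
  define P where "P h = (\<Sum>v\<in>B. (h \<bullet> v) *\<^sub>R v)" for h :: "complex ^ 'n"
  have vsum: "(\<Sum>v\<leftarrow>vs. (h \<bullet> v) *\<^sub>R v) = P h" for h :: "complex ^ 'n"
    using sum_list_distinct_conv_sum_set[OF vs(2)] by (simp add: P_def vs(1))
  obtain \<Psi> where \<Psi>: "\<And>t. \<exists>c\<in>curves. c 1 = \<Psi> t" "continuous_on UNIV \<Psi>"
    "\<Psi> 0 = \<one>" "(\<Psi> has_derivative P) (at 0)"
    using product_map[of vs, unfolded vsum vs(1), OF B(1)] by blast
  have \<Psi>G: "\<Psi> t \<in> carrier G" for t
  proof -
    obtain c where c: "c \<in> curves" "c 1 = \<Psi> t" using \<Psi>(1) by blast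
    have "c 1 \<in> carrier G" using c(1) by (simp add: curves_def)
    then show ?thesis unfolding c(2) .
  qed
  have linP: "linear P" using \<Psi>(4) has_derivative_linear by blast
  have PT: "P h \<in> ?T" for h
    unfolding P_def by (intro subspace_sum subspace_scale subspace_tangent_space) (use B(1) in auto)
  have orthB: "(h - P h) \<bullet> b = 0" if b: "b \<in> B" for h b
  proof -
    have "P h \<bullet> b = (\<Sum>v\<in>B. (h \<bullet> v) * (v \<bullet> b))" by (simp add: P_def inner_sum_left)
    also have "\<dots> = (\<Sum>v\<in>B. if v = b then h \<bullet> b else 0)"
    proof (intro sum.cong refl)
      fix v assume v: "v \<in> B"
      have "b \<bullet> b = 1" using B(3)[OF b] by (simp add: dot_square_norm)
      moreover have "v \<bullet> b = 0" if "v \<noteq> b"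
        using B(2) v b that by (auto simp: pairwise_def orthogonal_def)
      ultimately show "(h \<bullet> v) * (v \<bullet> b) = (if v = b then h \<bullet> b else 0)" by auto
    qed
    also have "\<dots> = h \<bullet> b" using finB b by simp
    finally show ?thesis by (simp add: inner_diff_left)
  qed
  have orth: "(h - P h) \<bullet> w = 0" if w: "w \<in> ?T" for h w
  proof -
    have "orthogonal (h - P h) w"
      by (rule orthogonal_to_span[of w B]) (use w B(5) orthB in \<open>auto simp: orthogonal_def\<close>)
    then show ?thesis by (simp add: orthogonal_def)
  qed
  have normP: "norm (P h) \<le> norm h" for h
  proof -
    have "orthogonal (h - P h) (P h)" using orth[OF PT] by (simp add: orthogonal_def)
    from norm_add_Pythagorean[OF this] have "(norm h)\<^sup>2 = (norm (h - P h))\<^sup>2 + (norm (P h))\<^sup>2" by simp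
    then have "(norm (P h))\<^sup>2 \<le> (norm h)\<^sup>2" by simp
    then show ?thesis by (rule power2_le_imp_le) simp
  qed
  have PidT: "P t = t" if t: "t \<in> ?T" for t
  proof -
    have "t - P t \<in> ?T" by (intro subspace_diff subspace_tangent_space t PT)
    then have "(t - P t) \<bullet> (t - P t) = 0" by (rule orth)
    then show ?thesis by simp
  qed
  obtain \<delta> where \<delta>: "0 < \<delta>"
    "\<And>x y. x \<in> carrier G \<Longrightarrow> y \<in> carrier G \<Longrightarrow> dist x \<one> < \<delta> \<Longrightarrow> dist y \<one> < \<delta> \<Longrightarrow>
      (\<And>w. w \<in> ?T \<Longrightarrow> (x - y) \<bullet> w = 0) \<Longrightarrow> x = y"
    using tangent_injective[OF one_closed] by blast
  \<comment> \<open>The constant 1/2 leaves the other half of the radius \<open>r\<close> for the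
    displacement of \<open>g\<close>.\<close>
  obtain d1 where d1: "0 < d1" "\<And>t. norm t < d1 \<Longrightarrow> norm (\<Psi> t - \<one> - P t) \<le> 1 / 2 * norm t"
    using \<Psi>(4) unfolding has_derivative_at_alt by (auto simp: \<Psi>(3) dest!: spec[of _ "1 / 2"])
  have "isCont \<Psi> 0" using \<Psi>(2) by (simp add: continuous_on_eq_continuous_at)
  then obtain d2 where d2: "0 < d2" "\<And>t. norm t < d2 \<Longrightarrow> dist (\<Psi> t) \<one> < \<delta>"
    using \<delta>(1) unfolding continuous_at_eps_delta by (auto simp: \<Psi>(3))
  define r where "r = min d1 d2 / 2"
  have r: "0 < r" "r < d1" "r < d2" using d1(1) d2(1) by (auto simp: r_def)
  show ?thesis
  proof (intro exI[of _ "min \<delta> (r / 2)"] conjI ballI impI)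
    show "0 < min \<delta> (r / 2)" using \<delta>(1) r(1) by simp
    fix g assume g: "g \<in> carrier G" "dist g \<one> < min \<delta> (r / 2)"
    \<comment> \<open>A fixed point solves \<open>P (\<Psi> t - \<one>) = P (g - \<one>)\<close>. On
      tangent vectors \<open>t - P (\<Psi> t - \<one>)\<close> is a linearisation error of norm at
      most \<open>r / 2\<close>, and \<open>g\<close> contributes at most \<open>r / 2\<close>, so
      the ball is mapped into itself.\<close>
    define \<phi> where "\<phi> t = t - P (\<Psi> t - \<one>) + P (g - \<one>)" for t
    obtain t where t: "t \<in> cball 0 r \<inter> ?T" "\<phi> t = t"
    proof (rule brouwer[of "cball 0 r \<inter> ?T" \<phi>])
      show "compact (cball 0 r \<inter> ?T)"
        by (intro compact_Int_closed compact_cball closed_subspace subspace_tangent_space)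
      show "convex (cball 0 r \<inter> ?T)"
        by (intro convex_Int convex_cball subspace_imp_convex subspace_tangent_space)
      show "cball 0 r \<inter> ?T \<noteq> {}"
        using r(1) subspace_0[OF subspace_tangent_space[of "carrier G" \<one>]] by force
      have cP: "continuous_on UNIV P" using linP by (simp add: linear_continuous_on linear_conv_bounded_linear)
      have "continuous_on UNIV (\<lambda>t. P (\<Psi> t - \<one>))"
        by (rule continuous_on_compose2[OF cP]) (auto intro!: continuous_intros \<Psi>(2))
      then have "continuous_on UNIV \<phi>" unfolding \<phi>_def by (intro continuous_intros)
      then show "continuous_on (cball 0 r \<inter> ?T) \<phi>" by (rule continuous_on_subset) simp
      show "\<phi> \<in> cball 0 r \<inter> ?T \<rightarrow> cball 0 r \<inter> ?T"
      proof
        fix t assume t: "t \<in> cball 0 r \<inter> ?T"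
        have "\<phi> t \<in> ?T" unfolding \<phi>_def
          using t by (intro subspace_add subspace_diff subspace_tangent_space PT) auto
        have "P (\<Psi> t - \<one> - P t) = P (\<Psi> t - \<one>) - t"
          using t PidT by (simp add: linear_diff[OF linP])
        then have "norm (P (\<Psi> t - \<one>) - t) \<le> norm (\<Psi> t - \<one> - P t)" using normP by metis
        also have "\<dots> \<le> 1 / 2 * norm t" using t r by (intro d1(2)) auto
        also have "\<dots> \<le> r / 2" using t by auto
        finally have "norm (P (\<Psi> t - \<one>) - t) \<le> r / 2" .
        moreover have "norm (P (g - \<one>)) \<le> r / 2"
          using normP[of "g - \<one>"] g(2) by (simp add: dist_norm)
        moreover have "\<phi> t = P (g - \<one>) - (P (\<Psi> t - \<one>) - t)" by (simp add: \<phi>_def)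
        ultimately have "norm (\<phi> t) \<le> r"
          using norm_triangle_ineq4[of "P (g - \<one>)" "P (\<Psi> t - \<one>) - t"] by simp
        then show "\<phi> t \<in> cball 0 r \<inter> ?T" using \<open>\<phi> t \<in> ?T\<close> by simp
      qed
    qed blast
    \<comment> \<open>Both \<open>\<Psi> t\<close> and \<open>g\<close> are closer to the unit than
      \<open>\<delta>\<close> and have equal tangential coordinates, hence they coincide.\<close>
    have "P (\<Psi> t - \<one>) = P (g - \<one>)" using t(2) by (simp add: \<phi>_def)
    then have "P (\<Psi> t - g) = 0" using linear_diff[OF linP, of "\<Psi> t - \<one>" "g - \<one>"] by simp
    then have "(\<Psi> t - g) \<bullet> w = 0" if "w \<in> ?T" for w using orth[OF that, of "\<Psi> t - g"] by simp
    then have "\<Psi> t = g" using t r g by (intro \<delta>(2) \<Psi>G d2(2)) auto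
    then show "\<exists>c\<in>curves. c 1 = g" using \<Psi>(1)[of t] by simp
  qed
qed

text \<open>The end points of curves form a subgroup containing a neighbourhood of the unit; such a
  subgroup is open and closed.\<close>

lemma curves_cover:
  assumes conn: "connected (carrier G)" and g: "g \<in> carrier G"
  shows "\<exists>c\<in>curves. c 1 = g"
proof -
  define C where "C = {x \<in> carrier G. \<exists>c\<in>curves. c 1 = x}"
  have mult: "x \<otimes> y \<in> C" if x: "x \<in> C" and y: "y \<in> C" for x y
  proof -
    obtain c d where c: "c \<in> curves" "c 1 = x" "x \<in> carrier G" and d: "d \<in> curves" "d 1 = y" "y \<in> carrier G"
      using x y unfolding C_def by blast
    show ?thesis unfolding C_def using c d by (auto intro!: bexI[OF _ curves_mult[OF c(1) d(1)]])
  qed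
  have inv: "inv x \<in> C" if x: "x \<in> C" for x
  proof -
    obtain c where c: "c \<in> curves" "c 1 = x" "x \<in> carrier G" using x unfolding C_def by blast
    show ?thesis unfolding C_def using c by (auto intro!: bexI[OF _ curves_inv[OF c(1)]])
  qed
  obtain \<rho> where \<rho>: "0 < \<rho>" "\<And>x. x \<in> carrier G \<Longrightarrow> dist x \<one> < \<rho> \<Longrightarrow> x \<in> C"
    using curves_cover_near_one unfolding C_def by auto
  define N where "N x = {y \<in> carrier G. inv x \<otimes> y \<in> ball \<one> \<rho>}" for x
  have openN: "openin (top_of_set (carrier G)) (N x)" if x: "x \<in> carrier G" for x
  proof -
    have "continuous_on (carrier G) (\<lambda>y. inv x \<otimes> y)"
      using x by (intro continuous_mult continuous_on_const continuous_on_id) auto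
    then have "openin (top_of_set (carrier G)) (carrier G \<inter> (\<lambda>y. inv x \<otimes> y) -` ball \<one> \<rho>)"
      by (rule continuous_openin_preimage_gen) simp
    moreover have "carrier G \<inter> (\<lambda>y. inv x \<otimes> y) -` ball \<one> \<rho> = N x" by (auto simp: N_def)
    ultimately show ?thesis by simp
  qed
  have selfN: "x \<in> N x" if "x \<in> carrier G" for x
    using that \<rho>(1) by (simp add: N_def)
  have CN: "inv x \<otimes> y \<in> C" if "x \<in> carrier G" "y \<in> N x" for x y
    using that by (intro \<rho>(2)) (auto simp: N_def dist_commute)
  have "openin (top_of_set (carrier G)) C"
  proof (subst openin_subopen, intro ballI)
    fix x assume x: "x \<in> C"
    then have xG: "x \<in> carrier G" by (simp add: C_def)
    have "N x \<subseteq> C"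
    proof
      fix y assume y: "y \<in> N x"
      then have yG: "y \<in> carrier G" by (simp add: N_def)
      have "x \<otimes> (inv x \<otimes> y) \<in> C" by (intro mult x CN xG y)
      then show "y \<in> C" using xG yG by (simp add: m_assoc[symmetric])
    qed
    then show "\<exists>T. openin (top_of_set (carrier G)) T \<and> x \<in> T \<and> T \<subseteq> C"
      using openN[OF xG] selfN[OF xG] by blast
  qed
  moreover have "openin (top_of_set (carrier G)) (carrier G - C)"
  proof (subst openin_subopen, intro ballI)
    fix x assume x: "x \<in> carrier G - C"
    then have xG: "x \<in> carrier G" by simp
    have "y \<notin> C" if y: "y \<in> N x" for y
    proof
      assume yC: "y \<in> C"
      then have yG: "y \<in> carrier G" by (simp add: C_def)
      \<comment> \<open>\<open>x\<close> is recovered from the covered point \<open>y\<close> and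
        the covered small element \<open>inv x \<otimes> y\<close>.\<close>
      have "y \<otimes> inv (inv x \<otimes> y) \<in> C" by (intro mult yC inv CN xG y)
      moreover have "y \<otimes> inv (inv x \<otimes> y) = x"
        using xG yG by (simp add: inv_mult_group m_assoc[symmetric])
      ultimately show False using x by simp
    qed
    then have "N x \<subseteq> carrier G - C" by (auto simp: N_def)
    then show "\<exists>T. openin (top_of_set (carrier G)) T \<and> x \<in> T \<and> T \<subseteq> carrier G - C"
      using openN[OF xG] selfN[OF xG] by blast
  qed
  then have "closedin (top_of_set (carrier G)) C"
    by (auto simp: closedin_def C_def)
  moreover have "C \<noteq> {}" using \<rho>(2)[OF one_closed] \<rho>(1) by auto
  ultimately have "C = carrier G" using conn unfolding connected_clopen by blast
  then show ?thesis using g unfolding C_def by blast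
qed

end

section \<open>Entire functions of exponential type without zeros\<close>

text \<open>Borel--Caratheodory: the Schwarz lemma for \<open>h / (2 * A - h)\<close> on a disc where \<open>Re h < A\<close>.\<close>

lemma linear_growth_of_Re:
  assumes h: "h holomorphic_on UNIV" "h 0 = 0" and K: "0 \<le> a" "0 \<le> K" "\<And>z. Re (h z) \<le> a + K * norm z"
  shows "norm (h z) \<le> 2 * (a + 1) + 4 * K * norm z"
proof (cases "z = 0")
  case True
  then show ?thesis using h(2) K(1) by simp
next
  case False
  \<comment> \<open>The radius is twice \<open>norm z\<close>, so that \<open>z\<close> corresponds
    to a point \<open>w\<close> of norm 1/2 in the unit disc.\<close>
  define R where "R = 2 * norm z"
  \<comment> \<open>The summand 1 makes the bound on the real part strict and \<open>A\<close>
    positive.\<close>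
  define A where "A = a + K * R + 1"
  have R: "0 < R" using False by (simp add: R_def)
  have A: "0 < A" using K R by (auto simp: A_def intro: add_nonneg_pos)
  have less: "Re (h (of_real R * w)) < A" if "norm w < 1" for w
  proof -
    have "norm (of_real R * w) \<le> R" using that R by (simp add: norm_mult)
    then have "K * norm (of_real R * w) \<le> K * R" using K(2) by (rule mult_left_mono)
    then show ?thesis using K(3)[of "of_real R * w"] unfolding A_def by linarith
  qed
  define \<phi> where "\<phi> w = h (of_real R * w) / (of_real (2 * A) - h (of_real R * w))" for w
  have nz: "of_real (2 * A) - h (of_real R * w) \<noteq> 0" if "norm w < 1" for w
  proof
    assume "of_real (2 * A) - h (of_real R * w) = 0"
    then have "Re (of_real (2 * A) - h (of_real R * w)) = 0" by simp
    then show False using less[OF that] A by simp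
  qed
  have "h \<circ> (\<lambda>w. of_real R * w) holomorphic_on ball 0 1"
    by (rule holomorphic_on_compose_gen[where t = UNIV]) (auto intro!: holomorphic_intros h)
  then have hol: "(\<lambda>w. h (of_real R * w)) holomorphic_on ball 0 1" by (simp add: o_def)
  have 1: "\<phi> holomorphic_on ball 0 1"
    unfolding \<phi>_def by (intro holomorphic_intros hol) (use nz in auto)
  have 2: "\<phi> 0 = 0" by (simp add: \<phi>_def h(2))
  have 3: "norm (\<phi> w) < 1" if "norm w < 1" for w
  proof -
    let ?x = "h (of_real R * w)"
    \<comment> \<open>A real part below \<open>A\<close> means being nearer to 0 than to
      \<open>2 * A\<close>; the imaginary parts of the two differences have equal squares.\<close>
    have "(Re ?x)\<^sup>2 < (2 * A - Re ?x)\<^sup>2"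
    proof -
      have "0 < 4 * A * (A - Re ?x)" using A less[OF that] by simp
      then show ?thesis by (simp add: power2_eq_square algebra_simps)
    qed
    then have "norm ?x < norm (of_real (2 * A) - ?x)"
      unfolding cmod_def by (intro real_sqrt_less_mono) simp
    then show ?thesis by (simp add: \<phi>_def norm_divide divide_less_eq)
  qed
  define w where "w = z / of_real R"
  have w: "norm w = 1 / 2" "of_real R * w = z" using False R by (auto simp: w_def R_def norm_divide)
  have "norm (\<phi> w) \<le> norm w" by (rule Schwarz_Lemma(1)[OF 1 2 3]) (use w in auto)
  moreover have "norm (of_real (2 * A) - h z) > 0" using nz[of w] w by simp
  ultimately have "norm (h z) \<le> 1 / 2 * norm (of_real (2 * A) - h z)"
    using w by (simp add: \<phi>_def norm_divide divide_le_eq)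
  \<comment> \<open>Half of \<open>norm (h z)\<close> is absorbed into the left-hand side.\<close>
  also have "norm (of_real (2 * A) - h z) \<le> 2 * A + norm (h z)"
    using norm_triangle_ineq4[of "of_real (2 * A)" "h z"] A by simp
  finally have "norm (h z) \<le> 2 * A" by simp
  then show ?thesis by (simp add: A_def R_def algebra_simps)
qed

text \<open>The growth of \<open>F\<close> bounds the real part of a logarithm linearly, hence the
  logarithm itself, which is then a polynomial of degree at most one; normalised, it vanishes at
  0.\<close>

lemma entire_exp_nonvanishing:
  assumes F: "entire_exp F" "\<And>z. F z \<noteq> 0" "F 0 = 1"
  obtains l where "\<And>z. F z = exp (l * z)"
proof -
  obtain M K where MK: "0 \<le> M" "0 \<le> K" "\<And>z. norm (F z) \<le> M * exp (K * norm z)"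
    using F(1) by (rule entire_expE) blast
  have M1: "1 \<le> M" using MK(3)[of 0] F(3) by simp
  obtain g where g: "g holomorphic_on UNIV" "\<And>z. z \<in> UNIV \<Longrightarrow> exp (g z) = F z"
    using holomorphic_logarithm_exists[of UNIV F 0] F(1,2) unfolding entire_exp_def by auto
  define h where "h z = g z - g 0" for z
  have h: "h holomorphic_on UNIV" "h 0 = 0" unfolding h_def by (auto intro!: holomorphic_intros g)
  have eh: "exp (h z) = F z" for z using g(2)[of z] g(2)[of 0] F(3) by (simp add: h_def exp_diff)
  have Re: "Re (h z) \<le> ln M + K * norm z" for z
  proof -
    have "exp (Re (h z)) \<le> M * exp (K * norm z)" using MK(3)[of z] by (simp add: eh[symmetric])
    also have "\<dots> = exp (ln M + K * norm z)" using M1 by (simp add: exp_add)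
    finally show ?thesis by simp
  qed
  have lnM: "0 \<le> ln M" using M1 by simp
  have growth: "norm (h z) \<le> 2 * (ln M + 1) + 4 * K * norm z" for z
    by (rule linear_growth_of_Re[OF h lnM MK(2) Re])
  \<comment> \<open>Liouville's theorem takes a pure power as bound; for
    \<open>1 \<le> norm z\<close> the constant term is absorbed in the linear one.\<close>
  have bound: "norm (h z) \<le> (2 * (ln M + 1) + 4 * K) * norm z ^ 1" if "1 \<le> norm z" for z
  proof -
    have "2 * (ln M + 1) * 1 \<le> 2 * (ln M + 1) * norm z" using that lnM by (intro mult_left_mono) auto
    then show ?thesis using growth[of z] by (simp add: algebra_simps)
  qed
  have "h z = deriv h 0 * z" for z
    using Liouville_polynomial[OF h(1) bound, where \<xi> = z] h(2) by simp
  then show thesis using eh by (intro that[of "deriv h 0"]) simp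
qed

context affine_group
begin

lemma curves_differentiable:
  assumes "c \<in> curves"
  shows "\<exists>X. (c has_derivative X) (at 0)"
proof -
  have "((\<lambda>z. c z $ i) has_field_derivative deriv (\<lambda>z. c z $ i) 0) (at 0)" for i
    using assms unfolding curves_def entire_exp_def by (auto intro: holomorphic_derivI)
  then have "(c has_derivative (\<lambda>h. \<chi> i. deriv (\<lambda>z. c z $ i) 0 * h)) (at 0)"
    by (intro has_derivative_vec) (simp add: has_field_derivative_def)
  then show ?thesis by blast
qed

lemma curves_continuous:
  assumes "c \<in> curves"
  shows "continuous_on A c"
proof -
  have "continuous_on A (\<lambda>z. c z $ i)" for i
    using assms unfolding curves_def entire_exp_def
    by (auto intro: holomorphic_on_imp_continuous_on holomorphic_on_subset)
  then have "continuous_on A (\<lambda>z. \<chi> i. c z $ i)" by (rule continuous_on_vec_lambda)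
  then show ?thesis by simp
qed

end

section \<open>The character and its continuous section\<close>

locale affine_unit = affine_group G for G :: "(complex ^ 'n) monoid" (structure) +
  fixes f :: "complex ^ 'n \<Rightarrow> complex"
  assumes conn: "connected (carrier G)"
    and regular: "regular_on (carrier G) f"
    and nonzero: "\<And>x. x \<in> carrier G \<Longrightarrow> f x \<noteq> 0"
    and unit: "f \<one> = 1"
begin

lemma on_curve:
  assumes "c \<in> curves"
  obtains l where "\<And>z. f (c z) = exp (l * z)"
proof (rule entire_exp_nonvanishing[OF curves_regular[OF assms regular]])
  show "f (c z) \<noteq> 0" for z using assms nonzero by (auto simp: curves_def)
  show "f (c 0) = 1" using assms unit by (simp add: curves_def)
qed (rule that)

text \<open>Rosenlicht's theorem: \<open>f\<close> is \<open>exp (l * z)\<close> on a curve, and \<open>l\<close> is additive because it is the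
  derivative at the unit.\<close>

lemma mult:
  assumes x: "x \<in> carrier G" and y: "y \<in> carrier G"
  shows "f (x \<otimes> y) = f x * f y"
proof -
  obtain c where c: "c \<in> curves" "c 1 = x" using curves_cover[OF conn x] by blast
  obtain d where d: "d \<in> curves" "d 1 = y" using curves_cover[OF conn y] by blast
  have cd: "(\<lambda>z. c z \<otimes> d z) \<in> curves" by (rule curves_mult[OF c(1) d(1)])
  obtain l where l: "\<And>z. f (c z) = exp (l * z)" using on_curve[OF c(1)] by blast
  obtain m where m: "\<And>z. f (d z) = exp (m * z)" using on_curve[OF d(1)] by blast
  obtain n where n: "\<And>z. f (c z \<otimes> d z) = exp (n * z)" using on_curve[OF cd] by blast
  have e: "((\<lambda>z. exp (k * z)) has_derivative (\<lambda>h. k * h)) (at 0)" for k :: complex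
  proof -
    have "((\<lambda>z. exp (k * z)) has_field_derivative k) (at 0)" by (auto intro!: derivative_eq_intros)
    then show ?thesis by (simp add: has_field_derivative_def)
  qed
  have "((\<lambda>z. f (c z \<otimes> d z)) has_derivative (\<lambda>h. l * h + m * h)) (at 0)"
    by (rule regular_product_derivative[OF regular _ _ curves_differentiable[OF c(1)] _ _ _ curves_differentiable[OF d(1)]])
       (use c(1) d(1) in \<open>auto simp: curves_def l m e\<close>)
  then have "((\<lambda>z. exp (n * z)) has_derivative (\<lambda>h. l * h + m * h)) (at 0)" by (simp add: n)
  from has_derivative_unique[OF e this] have "(\<lambda>h. n * h) = (\<lambda>h. l * h + m * h)" .
  then have "n = l + m" by (metis mult.right_neutral)
  then have "exp (n * 1) = exp (l * 1) * exp (m * 1)" by (simp add: exp_add)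
  then show ?thesis using l[of 1] m[of 1] n[of 1] c(2) d(2) by simp
qed

lemma f_inv: "x \<in> carrier G \<Longrightarrow> f (inv x) = inverse (f x)"
  using mult[of "inv x" x] unit nonzero[of x] by (simp add: field_simps)

definition S where "S = {x \<in> carrier G. f x = 1}"

lemma S_kernel: "S = kernel G Cstar f"
  by (simp add: S_def kernel_def Cstar_def)

lemma subgroup_S: "subgroup S G"
  by (rule subgroupI) (auto simp: S_def mult f_inv unit)

text \<open>The kernel is cut out by one more equation. Being an affine group itself, it is covered
  by its own entire curves as soon as it is connected.\<close>

lemma affine_group_S: "affine_group (G\<lparr>carrier := S\<rparr>)"
proof
  let ?S = "G\<lparr>carrier := S\<rparr>"
  obtain P where P: "P \<subseteq> affine_polynomials" "carrier G = {x. \<forall>p\<in>P. p x = 0}"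
    using zariski unfolding zariski_closed_def by blast
  obtain q where q: "q \<in> affine_polynomials" "\<forall>x\<in>carrier G. f x = q x"
    using regular unfolding regular_on_def by blast
  have "zariski_closed S"
    unfolding zariski_closed_def
  proof (intro exI[of _ "insert (\<lambda>x. q x - 1) P"] conjI)
    show "insert (\<lambda>x. q x - 1) P \<subseteq> affine_polynomials"
      using P(1) affine_polynomials_intros(5)[OF q(1) affine_polynomials_intros(1)[of 1]] by simp
    show "S = {x. \<forall>p\<in>insert (\<lambda>x. q x - 1) P. p x = 0}"
      using q(2) unfolding S_def P(2) by auto
  qed
  moreover have "group ?S" by (rule subgroup_imp_group[OF subgroup_S])
  moreover have "\<exists>p\<in>affine_polynomials2. \<forall>x\<in>S. \<forall>y\<in>S. (x \<otimes> y) $ i = p (x, y)" for i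
  proof -
    obtain p where "p \<in> affine_polynomials2" "\<forall>x\<in>carrier G. \<forall>y\<in>carrier G. (x \<otimes> y) $ i = p (x, y)"
      using affine unfolding affine_algebraic_group_def by blast
    then show ?thesis by (intro bexI[of _ p]) (auto simp: S_def)
  qed
  moreover have "\<exists>p\<in>affine_polynomials. \<forall>x\<in>S. (inv\<^bsub>?S\<^esub> x) $ i = p x" for i
  proof -
    obtain p where "p \<in> affine_polynomials" "\<forall>x\<in>carrier G. (inv x) $ i = p x"
      using affine unfolding affine_algebraic_group_def by blast
    then show ?thesis by (intro bexI[of _ p]) (auto simp: m_inv_consistent[OF subgroup_S], auto simp: S_def)
  qed
  ultimately show "affine_algebraic_group ?S"
    unfolding affine_algebraic_group_def by simp
qed

text \<open>In polar coordinates, the radius is lifted along a curve \<open>c\<close> with \<open>f (c z) = exp z\<close>; so is the angle,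
  and the end point \<open>c (2 * pi * i)\<close> of that path is moved back to the unit by a path in \<open>S\<close>.\<close>

lemma section_exists:
  assumes S: "connected S" and nonconst: "\<exists>x\<in>carrier G. f x \<noteq> 1"
  obtains \<sigma> where "continuous_on (- {0}) \<sigma>" "\<And>z. z \<noteq> 0 \<Longrightarrow> \<sigma> z \<in> carrier G" "\<And>z. z \<noteq> 0 \<Longrightarrow> f (\<sigma> z) = z"
proof -
  interpret S: affine_group "G\<lparr>carrier := S\<rparr>" by (rule affine_group_S)
  obtain x where x: "x \<in> carrier G" "f x \<noteq> 1" using nonconst by blast
  obtain c0 where c0: "c0 \<in> curves" "c0 1 = x" using curves_cover[OF conn x(1)] by blast
  obtain l where l: "\<And>z. f (c0 z) = exp (l * z)" using on_curve[OF c0(1)] by blast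
  have "l \<noteq> 0" using l[of 1] x c0(2) by auto
  \<comment> \<open>\<open>l\<close> is non-zero because \<open>f x \<noteq> 1\<close>; after
    rescaling, \<open>f (c z) = exp z\<close>.\<close>
  define c where "c z = c0 (inverse l * z)" for z
  have c: "c \<in> curves" unfolding c_def using curves_scale[OF c0(1)] .
  have fc: "f (c z) = exp z" for z using \<open>l \<noteq> 0\<close> by (simp add: c_def l mult.assoc[symmetric])
  have cG: "c z \<in> carrier G" for z using c by (simp add: curves_def)
  \<comment> \<open>Since \<open>exp (2 * pi * i) = 1\<close>, the end of the lifted circle lies in
    \<open>S\<close>, and \<open>d\<close> will be a curve in \<open>S\<close> from the unit to its
    inverse \<open>s\<close>.\<close>
  define s where "s = inv (c (2 * of_real pi * \<i>))"
  have "f s = 1" unfolding s_def f_inv[OF cG] fc by simp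
  then have s: "s \<in> S" using cG by (simp add: S_def s_def)
  obtain d where d: "d \<in> S.curves" "d 1 = s"
    using S.curves_cover[of s] S s by auto
  have dS: "d z \<in> S" for z using d(1) by (simp add: S.curves_def)
  have dG: "d z \<in> carrier G" "f (d z) = 1" for z using dS[of z] by (auto simp: S_def)
  \<comment> \<open>Multiplication by \<open>d\<close> closes the lifted circle without changing its
    image under \<open>f\<close>.\<close>
  define q where "q t = c (2 * of_real pi * \<i> * of_real t) \<otimes> d (of_real t)" for t :: real
  have q: "path q" unfolding path_def q_def
    by (intro continuous_mult cG dG continuous_on_compose2[OF curves_continuous[OF c, of UNIV]]
        continuous_on_compose2[OF S.curves_continuous[OF d(1), of UNIV]] continuous_intros) auto
  have qG: "q t \<in> carrier G" for t by (simp add: q_def cG dG)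
  have fq: "f (q t) = exp (2 * of_real pi * \<i> * of_real t)" for t
    unfolding q_def by (subst mult) (simp_all add: cG dG fc)
  have "c 0 = \<one>" "d 0 = \<one>" using c d(1) by (simp_all add: curves_def S.curves_def)
  then have loop: "pathfinish q = pathstart q"
    using cG by (simp add: pathfinish_def pathstart_def q_def d(2)) (simp add: s_def)
  define g where "g = q \<circ> (\<lambda>z. Arg2pi z / (2 * pi))"
  \<comment> \<open>The loop is homotopic to itself; read as a homotopy of maps on the circle, this
    gives continuity of \<open>g\<close> across the jump of \<open>Arg2pi\<close>.\<close>
  have "homotopic_loops (carrier G) q q"
    unfolding homotopic_loops_refl using q loop qG by (auto simp: path_image_def)
  from homotopic_loops_imp_homotopic_circlemaps[OF this]
  have g: "continuous_on (sphere 0 1) g"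
    unfolding g_def by (auto dest: homotopic_with_imp_continuous_maps)
  have gG: "g z \<in> carrier G" for z by (simp add: g_def qG)
  define \<sigma> where "\<sigma> z = c (of_real (ln (norm z))) \<otimes> g (z / of_real (norm z))" for z
  show thesis
  proof
    have "continuous_on (- {0}) (\<lambda>z. z / of_real (norm z) :: complex)"
      by (intro continuous_intros) auto
    then have "continuous_on (- {0}) (\<lambda>z. g (z / of_real (norm z)))"
      by (rule continuous_on_compose2[OF g]) (auto simp: norm_divide split: if_splits)
    moreover have "continuous_on (- {0}) (\<lambda>z :: complex. c (of_real (ln (norm z))))"
      by (rule continuous_on_compose2[OF curves_continuous[OF c, of UNIV]]) (auto intro!: continuous_intros)
    ultimately show "continuous_on (- {0}) \<sigma>"
      unfolding \<sigma>_def by (intro continuous_mult cG gG)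
    fix z :: complex assume z: "z \<noteq> 0"
    show "\<sigma> z \<in> carrier G" by (simp add: \<sigma>_def cG gG)
    define w where "w = z / of_real (norm z)"
    have nw: "norm w = 1" using z by (simp add: w_def norm_divide)
    have "f (g w) = exp (\<i> * of_real (Arg2pi w))"
      by (simp add: g_def fq mult_ac)
    also have "\<dots> = w"
      using Arg2pi_eq[of w] unfolding nw by simp
    finally have "f (g w) = w" .
    then have "f (\<sigma> z) = exp (of_real (ln (norm z))) * (z / of_real (norm z))"
      unfolding \<sigma>_def by (simp add: mult cG gG fc w_def)
    also have "exp (complex_of_real (ln (norm z))) = of_real (norm z)"
      using z by (simp add: exp_of_real)
    finally show "f (\<sigma> z) = z" using z by simp
  qed
qed

end

section \<open>The fibration over the punctured plane\<close>

text \<open>The product of a quotient map with an identity may fail to be a quotient map, but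
  openness survives products. This is why coset projections are treated as open maps.\<close>

lemma open_map_prod_id:
  assumes f: "open_map X X' f"
  shows "open_map (prod_topology X Y) (prod_topology X' Y) (\<lambda>w. (f (fst w), snd w))"
  unfolding open_map_def
proof (intro allI impI)
  fix W assume W: "openin (prod_topology X Y) W"
  show "openin (prod_topology X' Y) ((\<lambda>w. (f (fst w), snd w)) ` W)"
    unfolding openin_prod_topology_alt
  proof (intro allI impI)
    fix x' y assume "(x', y) \<in> (\<lambda>w. (f (fst w), snd w)) ` W"
    then obtain x where x: "(x, y) \<in> W" "x' = f x" by auto
    then obtain U V where U: "openin X U" "openin Y V" "x \<in> U" "y \<in> V" "U \<times> V \<subseteq> W"
      using W unfolding openin_prod_topology_alt by metis
    have "openin X' (f ` U)" using f U(1) by (simp add: open_map_def)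
    moreover have "f ` U \<times> V \<subseteq> (\<lambda>w. (f (fst w), snd w)) ` W" using U(5) by force
    ultimately show "\<exists>U V. openin X' U \<and> openin Y V \<and> x' \<in> U \<and> y \<in> V \<and> U \<times> V \<subseteq> (\<lambda>w. (f (fst w), snd w)) ` W"
      using U x(2) by blast
  qed
qed

context affine_group
begin

lemma quotient_map_coset_proj:
  "quotient_map (top_of_set (carrier G)) (coset_space G H) (coset_proj G H)"
  unfolding coset_space_def by (rule quotient_map_quotient_topology)

text \<open>The saturation of \<open>U\<close> is the union over \<open>H\<close> of preimages of
  \<open>U\<close> under right translations, and these are continuous.\<close>

lemma open_map_coset_proj:
  assumes H: "subgroup H G"
  shows "open_map (top_of_set (carrier G)) (coset_space G H) (coset_proj G H)"
  unfolding open_map_def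
proof (intro allI impI)
  fix U assume U: "openin (top_of_set (carrier G)) U"
  then have UG: "U \<subseteq> carrier G" using openin_imp_subset by blast
  have HG: "H \<subseteq> carrier G" using H by (rule subgroup.subset)
  have eq: "{x \<in> carrier G. coset_proj G H x \<in> coset_proj G H ` U} = (\<Union>h\<in>H. carrier G \<inter> (\<lambda>x. x \<otimes> h) -` U)"
  proof (intro equalityI subsetI)
    fix x assume "x \<in> {x \<in> carrier G. coset_proj G H x \<in> coset_proj G H ` U}"
    then obtain u where x: "x \<in> carrier G" and u: "u \<in> U" "x <# H = u <# H" by (auto simp: coset_proj_def)
    have "u \<in> u <# H" using u(1) UG by (intro lcos_self H) auto
    then have "u \<in> x <# H" using u(2) by simp
    then obtain h where "h \<in> H" "u = x \<otimes> h" by (auto simp: l_coset_def)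
    then show "x \<in> (\<Union>h\<in>H. carrier G \<inter> (\<lambda>x. x \<otimes> h) -` U)" using x u(1) by auto
  next
    fix x assume "x \<in> (\<Union>h\<in>H. carrier G \<inter> (\<lambda>x. x \<otimes> h) -` U)"
    then obtain h where h: "h \<in> H" "x \<in> carrier G" "x \<otimes> h \<in> U" by auto
    have "x \<otimes> h \<in> x <# H" using h(1) by (auto simp: l_coset_def)
    then have "x <# H = (x \<otimes> h) <# H" using h(2) H by (rule l_repr_independence)
    then show "x \<in> {x \<in> carrier G. coset_proj G H x \<in> coset_proj G H ` U}"
      using h by (auto simp: coset_proj_def)
  qed
  have op: "openin (top_of_set (carrier G)) (carrier G \<inter> (\<lambda>x. x \<otimes> h) -` U)" if h: "h \<in> H" for h
  proof (rule continuous_openin_preimage[OF _ _ U])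
    show "continuous_on (carrier G) (\<lambda>x. x \<otimes> h)"
      using h HG by (intro continuous_mult continuous_on_const continuous_on_id) auto
    show "(\<lambda>x. x \<otimes> h) \<in> carrier G \<rightarrow> carrier G" using h HG by auto
  qed
  have "openin (top_of_set (carrier G)) {x \<in> carrier G. coset_proj G H x \<in> coset_proj G H ` U}"
    unfolding eq
  proof (rule openin_Union)
    fix T assume "T \<in> (\<lambda>h. carrier G \<inter> (\<lambda>x. x \<otimes> h) -` U) ` H"
    then show "openin (top_of_set (carrier G)) T" using op by blast
  qed
  then show "openin (coset_space G H) (coset_proj G H ` U)"
    unfolding coset_space_def openin_quotient_topology using UG by auto
qed

end

context affine_unit
begin

text \<open>A coset over \<open>z\<close> is moved by \<open>inv (\<sigma> z)\<close> into the fibre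
  over 1, which consists of the cosets in \<open>S\<close>. Both maps are continuous because their
  composites with quotient maps are: one is tested on \<open>G\<close>, the other on the product of
  \<open>S\<close> with the punctured plane.\<close>

lemma coset_space_homeomorphic:
  assumes H: "subgroup H G" "H \<subseteq> S" and S: "connected S" and nonconst: "\<exists>x\<in>carrier G. f x \<noteq> 1"
    and X: "\<And>g. g \<in> carrier G \<Longrightarrow> X (coset_proj G H g) = f g"
  shows "coset_space G H homeomorphic_space cyl (coset_space (G\<lparr>carrier := S\<rparr>) H) (- {0})"
proof -
  let ?S = "G\<lparr>carrier := S\<rparr>"
  let ?E = "coset_space G H" and ?F = "coset_space ?S H"
  let ?C = "- {0::complex}"
  define p where "p = coset_proj G H"
  interpret S: affine_group ?S by (rule affine_group_S)
  have HG: "H \<subseteq> carrier G" using H(1) by (rule subgroup.subset)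
  have SG: "s \<in> carrier G" "f s = 1" if "s \<in> S" for s using that by (auto simp: S_def)
  \<comment> \<open>A coset of \<open>H\<close> is the same set in \<open>S\<close> and in
    \<open>G\<close>, so one projection \<open>p\<close> serves both.\<close>
  have pS: "coset_proj ?S H = p" by (simp add: p_def coset_proj_def l_coset_def)
  have HS: "subgroup H ?S" using subgroup_incl[OF H(1) subgroup_S H(2)] .
  have qE: "quotient_map (top_of_set (carrier G)) ?E p"
    unfolding p_def by (rule quotient_map_coset_proj)
  have qF: "quotient_map (top_of_set S) ?F p"
    using S.quotient_map_coset_proj[of H] by (simp add: pS)
  have oF: "open_map (top_of_set S) ?F p"
    using S.open_map_coset_proj[OF HS] by (simp add: pS)
  have topE: "topspace ?E = p ` carrier G" and topF: "topspace ?F = p ` S"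
    using quotient_imp_surjective_map[OF qE] quotient_imp_surjective_map[OF qF] by simp_all
  have cE: "continuous_map (top_of_set (carrier G)) ?E p" and cF: "continuous_map (top_of_set S) ?F p"
    using qE qF by (auto intro: quotient_imp_continuous_map)
  have pmult: "x <# p y = p (x \<otimes> y)" if "x \<in> carrier G" "y \<in> carrier G" for x y
    unfolding p_def coset_proj_def using that HG by (simp add: lcos_m_assoc)
  have Xp: "X (p g) = f g" if "g \<in> carrier G" for g using X that by (simp add: p_def)
  obtain \<sigma> where \<sigma>: "continuous_on ?C \<sigma>" "\<And>z. z \<noteq> 0 \<Longrightarrow> \<sigma> z \<in> carrier G" "\<And>z. z \<noteq> 0 \<Longrightarrow> f (\<sigma> z) = z"
    using section_exists[OF S nonconst] by blast
  define \<Phi> where "\<Phi> A = (inv (\<sigma> (X A)) <# A, X A)" for A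
  define \<Theta> where "\<Theta> w = \<sigma> (snd w) <# fst w" for w
  have \<Phi>p: "\<Phi> (p g) = (p (inv (\<sigma> (f g)) \<otimes> g), f g)" if "g \<in> carrier G" for g
    using that nonzero \<sigma>(2) by (simp add: \<Phi>_def Xp pmult)
  have \<Theta>p: "\<Theta> (p s, z) = p (\<sigma> z \<otimes> s)" if "s \<in> S" "z \<noteq> 0" for s z
    using that \<sigma>(2) SG by (simp add: \<Theta>_def pmult)
  have inS: "inv (\<sigma> (f g)) \<otimes> g \<in> S" if g: "g \<in> carrier G" for g
    using g nonzero[OF g] \<sigma>(2)[of "f g"] \<sigma>(3)[of "f g"] by (simp add: S_def mult f_inv)
  have contf: "continuous_on (carrier G) f"
  proof -
    obtain q where q: "q \<in> affine_polynomials" "\<forall>x\<in>carrier G. f x = q x"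
      using regular unfolding regular_on_def by blast
    show ?thesis
      by (rule continuous_on_eq[OF affine_polynomials_continuous[OF q(1)]]) (simp add: q(2))
  qed
  have \<sigma>f: "continuous_on (carrier G) (\<lambda>g. \<sigma> (f g))"
    by (rule continuous_on_compose2[OF \<sigma>(1) contf]) (use nonzero in auto)
  have "continuous_on (carrier G) (\<lambda>g. inv (\<sigma> (f g)) \<otimes> g)"
    using \<sigma>(2) nonzero by (intro continuous_mult continuous_inv \<sigma>f continuous_on_id) auto
  then have "continuous_map (top_of_set (carrier G)) (top_of_set S) (\<lambda>g. inv (\<sigma> (f g)) \<otimes> g)"
    using inS by simp
  from continuous_map_compose[OF this cF]
  have c1: "continuous_map (top_of_set (carrier G)) ?F (\<lambda>g. p (inv (\<sigma> (f g)) \<otimes> g))" by (simp add: o_def)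
  have c2: "continuous_map (top_of_set (carrier G)) (top_of_set ?C) f"
    using contf nonzero by simp
  have "continuous_map (top_of_set (carrier G)) (cyl ?F ?C) (\<lambda>g. (p (inv (\<sigma> (f g)) \<otimes> g), f g))"
    unfolding cyl_def continuous_map_pairwise using c1 c2 by (simp add: o_def)
  then have "continuous_map (top_of_set (carrier G)) (cyl ?F ?C) (\<Phi> \<circ> p)"
    by (rule continuous_map_eq) (simp add: \<Phi>p)
  then have \<Phi>: "continuous_map ?E (cyl ?F ?C) \<Phi>"
    by (rule continuous_compose_quotient_map[OF qE])
  let ?P = "prod_topology (top_of_set S) (top_of_set ?C)"
  let ?q = "\<lambda>w. (p (fst w), snd w)"
  \<comment> \<open>The projection of \<open>S\<close> is open, so its product with the identity is
    still a quotient map.\<close>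
  have qP: "quotient_map ?P (cyl ?F ?C) ?q"
  proof (rule continuous_open_imp_quotient_map)
    have "continuous_map ?P ?F (p \<circ> fst)"
      by (rule continuous_map_compose[OF continuous_map_fst cF])
    then show "continuous_map ?P (cyl ?F ?C) ?q"
      unfolding cyl_def continuous_map_pairwise by (simp add: o_def continuous_map_snd del: prod_topology_subtopology_eu)
    show "open_map ?P (cyl ?F ?C) ?q" unfolding cyl_def by (rule open_map_prod_id[OF oF])
    show "?q ` topspace ?P = topspace (cyl ?F ?C)" by (force simp: cyl_def topF)
  qed
  have "continuous_on (S \<times> ?C) (\<lambda>w. \<sigma> (snd w) \<otimes> fst w)"
  proof (intro continuous_mult)
    show "continuous_on (S \<times> ?C) (\<lambda>w. \<sigma> (snd w))"
      by (rule continuous_on_compose2[OF \<sigma>(1) continuous_on_snd[OF continuous_on_id]]) auto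
    show "continuous_on (S \<times> ?C) fst" by (intro continuous_intros)
    fix w assume w: "w \<in> S \<times> ?C"
    show "\<sigma> (snd w) \<in> carrier G" using w by (intro \<sigma>(2)) auto
    show "fst w \<in> carrier G" using w by (intro SG(1)) auto
  qed
  moreover have "(\<lambda>w. \<sigma> (snd w) \<otimes> fst w) \<in> S \<times> ?C \<rightarrow> carrier G"
  proof
    fix w assume w: "w \<in> S \<times> ?C"
    show "\<sigma> (snd w) \<otimes> fst w \<in> carrier G" using w by (intro m_closed \<sigma>(2) SG(1)) auto
  qed
  ultimately have "continuous_map ?P (top_of_set (carrier G)) (\<lambda>w. \<sigma> (snd w) \<otimes> fst w)"
    unfolding prod_topology_subtopology_eu continuous_map_subtopology_eu ..
  from continuous_map_compose[OF this cE]
  have "continuous_map ?P ?E (\<Theta> \<circ> ?q)"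
    by (rule continuous_map_eq) (auto simp: \<Theta>p)
  then have \<Theta>: "continuous_map (cyl ?F ?C) ?E \<Theta>"
    by (rule continuous_compose_quotient_map[OF qP])
  have "\<Theta> (\<Phi> A) = A" if "A \<in> topspace ?E" for A
  proof -
    obtain g where g: "g \<in> carrier G" "A = p g" using \<open>A \<in> topspace ?E\<close> topE by auto
    have "\<sigma> (f g) \<otimes> (inv (\<sigma> (f g)) \<otimes> g) = g"
      using g(1) \<sigma>(2)[OF nonzero[OF g(1)]] by (simp add: m_assoc[symmetric])
    then show ?thesis using g by (simp add: \<Phi>p \<Theta>p inS nonzero)
  qed
  moreover have "\<Phi> (\<Theta> w) = w" if "w \<in> topspace (cyl ?F ?C)" for w
  proof -
    obtain s z where s: "s \<in> S" "z \<noteq> 0" "w = (p s, z)" using \<open>w \<in> _\<close> by (auto simp: topspace_cyl topF)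
    have "f (\<sigma> z \<otimes> s) = z" using s \<sigma>(2,3) SG by (simp add: mult)
    moreover have "inv (\<sigma> z) \<otimes> (\<sigma> z \<otimes> s) = s"
      using s \<sigma>(2)[OF s(2)] SG by (simp add: m_assoc[symmetric])
    ultimately show ?thesis using s \<sigma>(2) SG by (simp add: \<Theta>p \<Phi>p)
  qed
  ultimately have "homeomorphic_maps ?E (cyl ?F ?C) \<Phi> \<Theta>"
    unfolding homeomorphic_maps_def using \<Phi> \<Theta> by blast
  then show ?thesis unfolding homeomorphic_space_def by blast
qed

end

text \<open>The punctured plane is its own product with a point, so the product formula applies with
  a one-point \<open>F\<close>.\<close>

lemma homology_punctured_plane:
  fixes q :: int
  defines "B \<equiv> top_of_set (- {0::complex})"
  shows "homology_group 0 B \<cong> integer_group" "homology_group 1 B \<cong> integer_group"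
    "2 \<le> q \<Longrightarrow> trivial_group (homology_group q B)"
proof -
  let ?P = "discrete_topology {()}"
  have "homeomorphic_maps B (cyl ?P (- {0})) (\<lambda>z. ((), z)) snd"
    unfolding homeomorphic_maps_def B_def cyl_def
    by (auto simp: continuous_map_pairwise o_def continuous_map_snd)
  then have "B homeomorphic_space cyl ?P (- {0})" unfolding homeomorphic_space_def by blast
  then have iso: "homology_group q B \<cong> homology_group q ?P \<times>\<times> homology_group (q - 1) ?P" for q
    by (rule iso_trans[OF homeomorphic_space_imp_isomorphic_homology_groups homology_cyl_punctured_plane])
  have triv: "trivial_group (homology_group q ?P)" if "q \<noteq> 0" for q
    using that by (intro homology_dimension_axiom[of _ "()"]) auto
  have Z: "homology_group 0 ?P \<cong> integer_group" by (rule homology_coefficients[of _ "()"]) simp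
  show "homology_group 0 B \<cong> integer_group"
    using iso_trans[OF iso[of 0] iso_trans[OF DirProd_trivial_isomorphic(1)[OF _ triv] Z]] by simp
  show "homology_group 1 B \<cong> integer_group"
    using iso_trans[OF iso[of 1] iso_trans[OF DirProd_trivial_isomorphic(2)[OF _ triv]]] Z by simp
  assume q: "2 \<le> q"
  have "homology_group q B \<cong> homology_group (q - 1) ?P"
    using q by (intro iso_trans[OF iso[of q] DirProd_trivial_isomorphic(2)[OF _ triv]]) auto
  then show "trivial_group (homology_group q B)"
    using isomorphic_group_triviality[of "homology_group q B" "homology_group (q - 1) ?P"] triv[of "q - 1"] q by simp
qed

theorem corollary3p8:
  fixes G :: "(complex ^ 'n) monoid"
    and H S :: "(complex ^ 'n) set"
    and X :: "(complex ^ 'n) set \<Rightarrow> complex"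
  assumes "affine_algebraic_group G"
    and "connected (carrier G)"
    and "closed_algebraic_subgroup H G"
    and "regular_on_quotient G H X"
    and "\<forall>c \<in> lcosets\<^bsub>G\<^esub> H. X c \<noteq> 0"
    and "\<not> X constant_on (lcosets\<^bsub>G\<^esub> H)"
    and "X (coset_proj G H \<one>\<^bsub>G\<^esub>) = 1"
    and "S = kernel G Cstar (X \<circ> coset_proj G H)"
    and "connected S"
  shows "cohomologically_trivial
           (coset_space (G\<lparr>carrier := S\<rparr>) H) (coset_space G H) (top_of_set (carrier Cstar))"
proof -
  let ?f = "X \<circ> coset_proj G H"
  have H: "subgroup H G" using assms(3) by (simp add: closed_algebraic_subgroup_def)
  interpret G: affine_group G by unfold_locales (rule assms(1))
  have lcoset: "coset_proj G H x \<in> lcosets\<^bsub>G\<^esub> H" if "x \<in> carrier G" for x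
    using that by (auto simp: coset_proj_def LCOSETS_def)
  interpret G: affine_unit G ?f
  proof
    show "connected (carrier G)" by (rule assms(2))
    show "regular_on (carrier G) ?f" using assms(4) by (simp add: regular_on_quotient_def)
    show "?f x \<noteq> 0" if "x \<in> carrier G" for x using assms(5) lcoset[OF that] by simp
    show "?f \<one>\<^bsub>G\<^esub> = 1" using assms(7) by simp
  qed
  have S: "G.S = S" unfolding G.S_kernel assms(8) ..
  have HS: "H \<subseteq> G.S"
  proof
    fix h assume h: "h \<in> H"
    then have hG: "h \<in> carrier G" using subgroup.subset[OF H] by blast
    \<comment> \<open>\<open>h\<close> lies in the coset of the unit, where \<open>X\<close> has the
      value 1.\<close>
    have "h \<in> \<one>\<^bsub>G\<^esub> <#\<^bsub>G\<^esub> H" using h hG by (force simp: l_coset_def)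
    then have "coset_proj G H \<one>\<^bsub>G\<^esub> = coset_proj G H h"
      unfolding coset_proj_def by (rule G.l_repr_independence[OF _ G.one_closed H])
    then show "h \<in> G.S" using hG assms(7) by (simp add: G.S_def)
  qed
  have nonconst: "\<exists>x\<in>carrier G. ?f x \<noteq> 1"
  proof (rule ccontr)
    assume "\<not> ?thesis"
    then have "X c = 1" if "c \<in> lcosets\<^bsub>G\<^esub> H" for c
      using that by (auto simp: coset_proj_def LCOSETS_def)
    then show False using assms(6) unfolding constant_on_def by blast
  qed
  have conn: "connected G.S" unfolding S by (rule assms(9))
  have "coset_space G H homeomorphic_space cyl (coset_space (G\<lparr>carrier := G.S\<rparr>) H) (- {0})"
    by (rule G.coset_space_homeomorphic[OF H HS conn nonconst]) (rule o_apply[symmetric])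
  then have "coset_space G H homeomorphic_space cyl (coset_space (G\<lparr>carrier := S\<rparr>) H) (- {0})"
    unfolding S .
  then have 1: "homology_group k (coset_space G H) \<cong>
      homology_group k (coset_space (G\<lparr>carrier := S\<rparr>) H) \<times>\<times> homology_group (k - 1) (coset_space (G\<lparr>carrier := S\<rparr>) H)" for k
    by (rule iso_trans[OF homeomorphic_space_imp_isomorphic_homology_groups homology_cyl_punctured_plane])
  have 2: "carrier Cstar = - {0}" by (simp add: Cstar_def)
  show ?thesis
    unfolding 2 by (rule cohomologically_trivial_homology[OF 1 homology_punctured_plane])
qed

end
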